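(* For every integer $m \ge 1$, $$\mathfrak{c}(2,m) = \frac{1}{2}(m^2+m)+m.$$
   Context: A matrix is treated as the multiset of its columns. Two vectors $\mathbf{a},\overline{\mathbf{a}}\in\mathbb{R}^d$ differ if $\mathbf{a}\neq\pm\overline{\mathbf{a}}$. A multiset $X\subseteq\mathbb{R}^d$ has differing columns if every pair of vectors in $X$ differs and $\mathbf{0}\notin X$. The number of differing columns of a matrix $A$, i.e. the largest cardinality of a subset of the columns of $A$ that has differing columns, is denoted $|A|$. For an integer matrix $A$ with $m$ rows and $\operatorname{rank} A=m$, let $\Delta(A):=\max\{|\det B| : B \text{ is an } m\times m \text{ submatrix of } A\}$; $A$ is $\Delta$-modular if $\Delta(A)\le\Delta$. For integers $\Delta,m\ge 1$, $$\mathfrak{c}(\Delta,m):=\max\{|A| : A \text{ is an integer matrix with } m \text{ rows},\ \operatorname{rank}A=m,\ \Delta(A)\le\Delta\}.$$ *)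

theory Defs
  imports
    Complex_Main
    "HOL-Library.Multiset"
    "Jordan_Normal_Form.Determinant"
    "Jordan_Normal_Form.DL_Submatrix"
    "Jordan_Normal_Form.DL_Rank"
begin

definition differ :: "'a :: comm_ring_1 vec \<Rightarrow> 'a vec \<Rightarrow> bool" where
  "differ a b \<longleftrightarrow> a \<noteq> b \<and> a \<noteq> - b"

text \<open>
  A pair of vectors in a multiset is a sub-multiset of size two, so a vector occurring twice
  forms a pair with itself and violates the condition.
\<close>

definition differing_columns :: "nat \<Rightarrow> 'a :: comm_ring_1 vec multiset \<Rightarrow> bool" where
  "differing_columns d X \<longleftrightarrow>
     set_mset X \<subseteq> carrier_vec d \<and>
     0\<^sub>v d \<notin># X \<and>
     (\<forall>a b. {#a, b#} \<subseteq># X \<longrightarrow> differ a b)"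

definition num_differing :: "'a :: comm_ring_1 mat \<Rightarrow> nat" where
  "num_differing A =
     Max {size X |X. X \<subseteq># mset (cols A) \<and> differing_columns (dim_row A) X}"

definition full_row_rank :: "int mat \<Rightarrow> bool" where
  "full_row_rank A \<longleftrightarrow> vec_space.rank (dim_row A) (map_mat real_of_int A) = dim_row A"

text \<open>
  Meaningful for matrices of full row rank: these have at least as many columns as rows, so
  the set below is nonempty.
\<close>

definition max_minor :: "int mat \<Rightarrow> int" where
  "max_minor A =
     Max {\<bar>det B\<bar> |B. B \<in> carrier_mat (dim_row A) (dim_row A) \<and> (\<exists>I J. B = submatrix A I J)}"

definition delta_modular :: "int \<Rightarrow> int mat \<Rightarrow> bool" where
  "delta_modular \<Delta> A \<longleftrightarrow> full_row_rank A \<and> max_minor A \<le> \<Delta>"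

text \<open>
  The number of columns is unrestricted. \<^const>\<open>Max\<close> is unspecified on infinite sets, so an
  equation giving its value as a function of \<open>m\<close> presupposes that the maximum exists.
\<close>

definition col_number :: "int \<Rightarrow> nat \<Rightarrow> nat" where
  "col_number \<Delta> m =
     Max {num_differing A |A. dim_row A = m \<and> delta_modular \<Delta> A}"

end

theory Submission
  imports Defs "HOL-Library.Function_Algebras"
begin

text \<open>
  The matrices in question have maximal minors in \<open>{-2, \<dots>, 2}\<close>. For the upper bound, replace
  the columns by the symmetric set \<open>A\<close> of all columns and their negatives. The absolute values
  of the determinants of its bases are \<open>1\<close> or \<open>2\<close>, and they change by Cramer's rule when one
  basis vector is exchanged; the locale \<open>volume_config\<close> keeps just this. Its theorem
  \<open>reduced_card\<close> bounds a set of differing elements by \<open>f n = n (n + 3) / 2\<close>, by induction on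
  the dimension \<open>n\<close>: contract an element \<open>a\<close>, that is, project along it. Differing elements
  \<open>s\<close> and \<open>s \<plusminus> a\<close> become equal, so the images of such doubled elements, and the elements on
  the line of \<open>a\<close>, are lost. Since \<open>f n - f (n - 1) = n + 1\<close>, the element \<open>a\<close> has to be chosen
  such that at most \<open>n + 1\<close> are lost.

  Unimodular matrices would lose at most \<open>n\<close>, because there doubled elements are independent.
  What disturbs independence is an odd circuit: an independent set whose sum is twice a vector
  of the lattice generated by \<open>A\<close>. If there is none with two, three or four elements, the
  doubled elements are still independent (\<open>card_doubled_no_short_odd_circuit\<close>), and at most
  two elements lie on the line of \<open>a\<close>. Otherwise \<open>a\<close> is taken from a shortest odd circuit \<open>J\<close>
  with at least two elements. Then only one element lies on the line of \<open>a\<close>, and the doubled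
  elements are, besides an independent set, of three further kinds: half sums \<open>\<Sum>b\<in>J. \<plusminus>b/2\<close>, at
  most one integral combination of \<open>J\<close>, which requires \<open>card J = 2\<close>, and elements that
  complete a square \<open>c\<close>, \<open>c \<plusminus> a\<close>, \<open>c \<plusminus> d\<close>, \<open>c \<plusminus> a \<plusminus> d\<close> with \<open>d \<in> J\<close>. Each \<open>d\<close> arises from at
  most one such element, and in the presence of half sums only one \<open>d\<close> does (\<open>half_squares\<close>).
  The count (\<open>card_S\<close>) yields at most \<open>n\<close> doubled elements, except for \<open>n + 1\<close> if \<open>card J = 4\<close>
  and all half sums of \<open>J\<close> are present. This excess is compensated one level below: after the
  contraction, \<open>J - {a}\<close> is a shortest odd circuit with three elements and a half sum, some
  element of it has no square, and contracting that element gains one (\<open>reduced_card_three\<close>).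

  For the lower bound take the columns \<open>e\<^sub>j - e\<^sub>i\<close>, \<open>e\<^sub>j + s e\<^sub>0\<close> and \<open>e\<^sub>0\<close>, \<open>2 e\<^sub>0\<close> with
  \<open>0 < i < j\<close> and \<open>s \<in> {0, 1, 2}\<close>. A minor is linear in row \<open>0\<close>, and this row is the sum of two
  rows with entries \<open>0\<close> and \<open>1\<close>; each of them completes the other rows to a network matrix up
  to sign, whose determinant is \<open>0\<close> or \<open>\<plusminus>1\<close>. So the minors are at most \<open>2\<close> in absolute value
  (\<open>extremal_det\<close>).
\<close>

section \<open>Configurations of vectors with a volume\<close>

text \<open>
  An abstract stand-in for the columns of an integer matrix of full row rank together with their
  negatives; \<open>vol B\<close> is the absolute value of the determinant of a basis \<open>B\<close>. Cramer's rule
  survives as the exchange axiom, and integrality of determinants as the restriction to the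
  values \<open>1\<close> and \<open>2\<close>. No coordinates of the ambient space are involved, so passing to a quotient
  amounts to computing modulo \<open>span P\<close> for an independent \<open>P \<subseteq> A\<close>.
\<close>
locale volume_config = vector_space scale
  for scale :: "real \<Rightarrow> 'v::ab_group_add \<Rightarrow> 'v" (infixr \<open>*s\<close> 75) +
  fixes A :: "'v set" and vol :: "'v set \<Rightarrow> real"
  assumes finite_A: "finite A"
    and uminus_A: "x \<in> A \<Longrightarrow> - x \<in> A"
    and vol_values: "\<lbrakk>B \<subseteq> A; independent B; A \<subseteq> span B\<rbrakk> \<Longrightarrow> vol B \<in> {1, 2}"
    and vol_exchange: "\<lbrakk>B \<subseteq> A; independent B; A \<subseteq> span B; b \<in> B; v \<in> A; representation B v b \<noteq> 0\<rbrakk>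
      \<Longrightarrow> vol (insert v (B - {b})) = \<bar>representation B v b\<bar> * vol B"
begin

abbreviation crd :: "'v set \<Rightarrow> 'v \<Rightarrow> 'v \<Rightarrow> real" where "crd \<equiv> representation"

definition basis :: "'v set \<Rightarrow> bool" where
  "basis B \<longleftrightarrow> B \<subseteq> A \<and> independent B \<and> A \<subseteq> span B"

lemma basisD: assumes "basis B" shows "B \<subseteq> A" "independent B" "span B = span A" "finite B"
  using assms finite_A finite_subset span_mono[of B A] span_mono[of A "span B"] span_span
  unfolding basis_def by auto

lemma card_basis: "basis B \<Longrightarrow> card B = dim A"
  using basis_card_eq_dim unfolding basis_def by blast

lemma basis_extend:
  assumes "T \<subseteq> A" "independent T"
  obtains B where "basis B" "T \<subseteq> B"
  using maximal_independent_subset_extend[OF assms] unfolding basis_def by metis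

lemma crd_linear:
  assumes "basis B" "x \<in> span A" "y \<in> span A"
  shows "crd B (x + y) b = crd B x b + crd B y b" "crd B (x - y) b = crd B x b - crd B y b"
  using assms basisD[OF assms(1)] representation_add representation_diff by auto

lemma crd_scale:
  assumes "basis B" "x \<in> span A" shows "crd B (r *s x) b = r * crd B x b" "crd B (- x) b = - crd B x b"
  using assms basisD[OF assms(1)] representation_scale representation_neg by auto

lemma crd_sum:
  assumes "basis B" "\<And>i. i \<in> I \<Longrightarrow> f i \<in> span A"
  shows "crd B (sum f I) b = (\<Sum>i\<in>I. crd B (f i) b)"
  using assms basisD[OF assms(1)] representation_sum by metis

lemma crd_self: "basis B \<Longrightarrow> c \<in> B \<Longrightarrow> crd B c b = (if b = c then 1 else 0)"
  using basisD representation_basis by metis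

lemma crd_expand: "basis B \<Longrightarrow> x \<in> span A \<Longrightarrow> x = (\<Sum>b\<in>B. crd B x b *s b)"
  using basisD sum_representation_eq[of B x B] by auto

lemma crd_span:
  assumes "basis B" "T \<subseteq> B" "x \<in> span T" "b \<notin> T" shows "crd B x b = 0"
proof -
  have "crd B x = crd T x" using assms basisD[OF assms(1)] by (intro representation_extend) auto
  then show ?thesis using assms representation_ne_zero by metis
qed

lemma A_span: "x \<in> A \<Longrightarrow> x \<in> span A" by (rule span_base)

lemma crd_unique:
  assumes "basis B" "x = (\<Sum>b\<in>B. f b *s b)" "b \<in> B"
  shows "crd B x b = f b"
proof -
  have "crd B x b = (\<Sum>c\<in>B. crd B (f c *s c) b)" unfolding assms(2)
    using assms basisD[OF assms(1)] by (intro crd_sum) (auto intro: span_scale span_base)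
  also have "\<dots> = (\<Sum>c\<in>B. if c = b then f b else 0)"
    using assms basisD[OF assms(1)] by (intro sum.cong) (auto simp: crd_scale A_span crd_self subset_iff)
  finally show ?thesis using assms basisD[OF assms(1)] by simp
qed

lemma crd_zero_span:
  assumes "basis B" "x \<in> span A" "T \<subseteq> B" "\<And>b. b \<in> B - T \<Longrightarrow> crd B x b = 0"
  shows "x \<in> span T"
proof -
  have "x = (\<Sum>b\<in>B. crd B x b *s b)" using crd_expand assms by blast
  also have "\<dots> = (\<Sum>b\<in>T. crd B x b *s b)"
    using assms basisD[OF assms(1)] by (intro sum.mono_neutral_right) auto
  also have "\<dots> \<in> span T" by (intro span_sum span_scale span_base)
  finally show ?thesis .
qed

text \<open>
  Exchanging \<open>b\<close> for \<open>v\<close> acts on coordinates like one step of Gaussian elimination. Almost all later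
  arguments follow this pattern: exchange until some coordinate or some volume violates the bound
  \<open>vol \<le> 2\<close>.
\<close>
lemma pivot:
  assumes B: "basis B" "b \<in> B" "v \<in> A" and nz: "crd B v b \<noteq> 0"
  defines "B' \<equiv> insert v (B - {b})"
  shows "basis B'" "v \<notin> B - {b}" "vol B' = \<bar>crd B v b\<bar> * vol B"
    "\<And>x. x \<in> span A \<Longrightarrow> crd B' x v = crd B x b / crd B v b"
    "\<And>x d. x \<in> span A \<Longrightarrow> d \<in> B - {b} \<Longrightarrow> crd B' x d = crd B x d - crd B x b / crd B v b * crd B v d"
proof -
  note BD = basisD[OF B(1)]
  show v: "v \<notin> B - {b}" using crd_self[OF B(1), of v b] nz by (auto split: if_splits)
  have v0: "v \<notin> span (B - {b})" using crd_span[OF B(1), of "B - {b}" v b] nz by auto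
  have ind: "independent B'" unfolding B'_def using v0 BD independent_mono
    by (intro independent_insertI) auto
  have ex: "x = (\<Sum>d\<in>B'. (if d = v then crd B x b / crd B v b
      else crd B x d - crd B x b / crd B v b * crd B v d) *s d)" (is "x = ?R") if "x \<in> span A" for x
  proof -
    let ?r = "crd B x b / crd B v b"
    have v': "v - crd B v b *s b = (\<Sum>d\<in>B-{b}. crd B v d *s d)"
      using crd_expand[OF B(1) A_span[OF B(3)]] sum.remove[OF BD(4) B(2), of "\<lambda>d. crd B v d *s d"] by (simp add: algebra_simps)
    have x': "x = crd B x b *s b + (\<Sum>d\<in>B-{b}. crd B x d *s d)"
      using crd_expand[OF B(1) that] sum.remove[OF BD(4) B(2), of "\<lambda>d. crd B x d *s d"] by simp
    have "?R = ?r *s v + (\<Sum>d\<in>B-{b}. (crd B x d - ?r * crd B v d) *s d)"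
    proof -
      have "(\<Sum>d\<in>B-{b}. (if d = v then ?r else crd B x d - ?r * crd B v d) *s d)
          = (\<Sum>d\<in>B-{b}. (crd B x d - ?r * crd B v d) *s d)"
        using v by (intro sum.cong) (auto simp del: scale_cancel_left scale_cancel_right)
      then show ?thesis unfolding B'_def using v BD(4) by (subst sum.insert) auto
    qed
    also have "\<dots> = ?r *s v + ((\<Sum>d\<in>B-{b}. crd B x d *s d) - ?r *s (\<Sum>d\<in>B-{b}. crd B v d *s d))"
      by (simp add: scale_left_diff_distrib sum_subtractf scale_sum_right)
    also have "\<dots> = ?r *s (crd B v b *s b) + (\<Sum>d\<in>B-{b}. crd B x d *s d)"
      unfolding v'[symmetric] by (simp add: scale_right_diff_distrib)
    also have "\<dots> = x" using nz by (subst (3) x') simp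
    finally show ?thesis by simp
  qed
  have sp: "A \<subseteq> span B'"
  proof
    fix x assume "x \<in> A"
    then show "x \<in> span B'" by (subst ex[OF A_span]) (assumption, intro span_sum span_scale span_base)
  qed
  show bas: "basis B'" using ind sp B BD unfolding basis_def B'_def by auto
  show "vol B' = \<bar>crd B v b\<bar> * vol B" unfolding B'_def
    using B nz unfolding basis_def by (intro vol_exchange) auto
  show "crd B' x v = crd B x b / crd B v b" if "x \<in> span A" for x
    using crd_unique[OF bas ex[OF that], of v] B'_def by auto
  show "crd B' x d = crd B x d - crd B x b / crd B v b * crd B v d" if "x \<in> span A" "d \<in> B - {b}" for x d
    using crd_unique[OF bas ex[OF that(1)], of d] that v B'_def by auto
qed

lemma vol_cases: "basis B \<Longrightarrow> vol B = 1 \<or> vol B = 2"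
  using vol_values unfolding basis_def by auto

text \<open>
  The product is \<open>0\<close> or the volume of the basis in which \<open>x\<close> has replaced \<open>b\<close>.
\<close>
lemma vol_crd:
  assumes "basis B" "b \<in> B" "x \<in> A"
  shows "vol B * \<bar>crd B x b\<bar> \<in> {0, 1, 2}"
proof (cases "crd B x b = 0")
  case False
  from pivot[OF assms False] vol_cases[of "insert x (B - {b})"] show ?thesis by (auto simp: mult.commute)
qed auto

lemma vol_crd_le: assumes "basis B" "b \<in> B" "x \<in> A" shows "vol B * \<bar>crd B x b\<bar> \<le> 2"
  using vol_crd[OF assms] by auto

lemma vol_crd_int: assumes "basis B" "b \<in> B" "x \<in> A" shows "vol B * crd B x b \<in> \<int>"
proof -
  have "vol B * crd B x b \<in> {0,1,2,-1,-2}"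
    using vol_crd[OF assms] vol_cases[OF assms(1)] by (auto simp: abs_if split: if_splits)
  then show ?thesis by auto
qed

section \<open>The lattice modulo two and odd circuits\<close>

text \<open>
  The lattice generated by \<open>A\<close>; symmetry of \<open>A\<close> makes a closure under adding elements of \<open>A\<close>
  sufficient.
\<close>
inductive_set lat :: "'v set" where
  lat_0: "0 \<in> lat"
| lat_step: "z \<in> lat \<Longrightarrow> x \<in> A \<Longrightarrow> z + x \<in> lat"

lemma lat_A: "x \<in> A \<Longrightarrow> x \<in> lat" using lat_step[OF lat_0] by simp

lemma lat_add: "y \<in> lat \<Longrightarrow> x \<in> lat \<Longrightarrow> x + y \<in> lat"
  by (induction y rule: lat.induct) (auto simp: add.assoc[symmetric] lat_step)

lemma lat_uminus: "x \<in> lat \<Longrightarrow> - x \<in> lat"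
proof (induction rule: lat.induct)
  case (lat_step z x)
  then show ?case using lat.lat_step[of "- z" "- x"] uminus_A by simp
qed (simp add: lat_0)

lemma lat_diff: "x \<in> lat \<Longrightarrow> y \<in> lat \<Longrightarrow> x - y \<in> lat"
  using lat_add[of "- y" x] lat_uminus by simp

lemma lat_of_nat: "x \<in> lat \<Longrightarrow> real n *s x \<in> lat"
  by (induction n) (auto simp: lat_0 scale_left_distrib lat_add)

lemma lat_of_int: "x \<in> lat \<Longrightarrow> of_int n *s x \<in> lat"
  using lat_of_nat[of x "nat n"] lat_of_nat[of "- x" "nat (- n)"] lat_uminus[of x] by (cases "n \<ge> 0") (auto)

lemma lat_sum: "(\<And>i. i \<in> I \<Longrightarrow> f i \<in> lat) \<Longrightarrow> sum f I \<in> lat"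
  by (induction I rule: infinite_finite_induct) (auto simp: lat_0 lat_add)

lemma lat_span: "z \<in> lat \<Longrightarrow> z \<in> span A"
  by (induction rule: lat.induct) (auto intro: span_zero span_add span_base)

text \<open>
  Stated for a combination of two coordinates so that it yields both that coordinates are
  integral (\<open>s = 0\<close>) and that two coordinates agree modulo integers (\<open>r = s = 1\<close>).
\<close>
lemma lat_crd_induct:
  assumes "basis B" "z \<in> lat" "\<And>x. x \<in> A \<Longrightarrow> r * crd B x b - s * crd B x c \<in> \<int>"
  shows "r * crd B z b - s * crd B z c \<in> \<int>"
  using assms(2)
proof (induction rule: lat.induct)
  case lat_0 show ?case by (simp add: representation_zero)
next
  case (lat_step z x)
  have "r * crd B (z + x) b - s * crd B (z + x) c = (r * crd B z b - s * crd B z c) + (r * crd B x b - s * crd B x c)"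
    using lat_step assms(1) by (simp add: crd_linear lat_span A_span algebra_simps)
  then show ?case using lat_step assms(3) by auto
qed

lemma vol_lat_int: assumes "basis B" "b \<in> B" "z \<in> lat" shows "vol B * crd B z b \<in> \<int>"
  using lat_crd_induct[OF assms(1,3), of "vol B" b 0 b] vol_crd_int[OF assms(1,2)] by simp

text \<open>
  Vanishing in the lattice of the quotient by \<open>span P\<close>, taken modulo \<open>2\<close>.
\<close>
definition evn :: "'v set \<Rightarrow> 'v \<Rightarrow> bool" where
  "evn P x \<longleftrightarrow> (\<exists>z\<in>lat. x - (z + z) \<in> span P)"

lemma evn_add: "evn P x \<Longrightarrow> evn P y \<Longrightarrow> evn P (x + y)"
  unfolding evn_def
proof safe
  fix z w assume "z \<in> lat" "w \<in> lat" "x - (z + z) \<in> span P" "y - (w + w) \<in> span P"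
  moreover have "x + y - ((z + w) + (z + w)) = (x - (z + z)) + (y - (w + w))" by simp
  ultimately show "\<exists>z\<in>lat. x + y - (z + z) \<in> span P" using lat_add span_add by metis
qed

lemma evn_uminus: "evn P x \<Longrightarrow> evn P (- x)"
  unfolding evn_def
proof safe
  fix z assume "z \<in> lat" "x - (z + z) \<in> span P"
  moreover have "- x - (- z + - z) = - (x - (z + z))" by simp
  ultimately show "\<exists>z\<in>lat. - x - (z + z) \<in> span P" using lat_uminus span_neg by metis
qed

lemma evn_diff: "evn P x \<Longrightarrow> evn P y \<Longrightarrow> evn P (x - y)"
  using evn_add[of P x "- y"] evn_uminus by simp

lemma evn_span: "x \<in> span P \<Longrightarrow> evn P x"
  unfolding evn_def using lat_0 by (intro bexI[of _ 0]) auto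

lemma evn_double: "z \<in> lat \<Longrightarrow> evn P (z + z)"
  unfolding evn_def using span_zero by (intro bexI[of _ z]) auto

lemma evn_even: "z \<in> lat \<Longrightarrow> even n \<Longrightarrow> evn P (of_int n *s z)"
proof -
  assume z: "z \<in> lat" and "even n"
  then obtain k where "n = k + k" by (metis evenE mult_2)
  then have "of_int n *s z = of_int k *s z + of_int k *s z" by (simp only: of_int_add scale_left_distrib)
  then show ?thesis using evn_double[OF lat_of_int[OF z, of k], of P] by simp
qed

lemma evn_sum: "(\<And>i. i \<in> I \<Longrightarrow> evn P (f i)) \<Longrightarrow> evn P (sum f I)"
  by (induction I rule: infinite_finite_induct) (auto simp: evn_add intro: evn_span span_zero)

lemma evn_parity: 
  assumes "evn P (x + of_int n *s z)" "z \<in> lat" "even (n - k)" shows "evn P (x + of_int k *s z)"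
proof -
  have "x + of_int k *s z = (x + of_int n *s z) - of_int (n - k) *s z" by (simp add: scale_left_diff_distrib)
  then show ?thesis using assms evn_diff evn_even by metis
qed

text \<open>
  In a basis containing \<open>P \<union> Q\<close>, half of the sum of \<open>Q\<close> is a lattice vector up to \<open>span P\<close>, which forces
  volume \<open>2\<close>. For instance, the edges \<open>e\<^sub>i + e\<^sub>j\<close> of an odd cycle are one if the unit vectors
  belong to \<open>A\<close>.
\<close>
definition odd_circuit :: "'v set \<Rightarrow> 'v set \<Rightarrow> bool" where
  "odd_circuit P Q \<longleftrightarrow> Q \<subseteq> A \<and> Q \<noteq> {} \<and> P \<inter> Q = {} \<and> independent (P \<union> Q) \<and> evn P (\<Sum>Q)"

lemma odd_circuit_half:
  assumes "odd_circuit P Q" "basis B" "P \<subseteq> B" "Q \<subseteq> B"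
  shows "\<exists>z\<in>lat. (\<forall>q\<in>Q. crd B z q = 1/2) \<and> (\<forall>b. b \<notin> Q \<longrightarrow> b \<notin> P \<longrightarrow> crd B z b = 0)"
proof -
  note BD = basisD[OF assms(2)]
  obtain z where z: "z \<in> lat" "\<Sum>Q - (z + z) \<in> span P" using assms unfolding odd_circuit_def evn_def by auto
  have Qs: "\<Sum>Q \<in> span A" using assms by (intro span_sum span_base) (auto simp: odd_circuit_def)
  have finQ: "finite Q" using BD(4) assms(4) by (rule rev_finite_subset)
  have c: "crd B (\<Sum>Q) b = (if b \<in> Q then 1 else 0)" for b
  proof -
    have "crd B (\<Sum>Q) b = (\<Sum>q\<in>Q. crd B q b)" using assms BD by (intro crd_sum) (auto intro: A_span)
    also have "\<dots> = (\<Sum>q\<in>Q. if q = b then 1 else 0)" using assms by (intro sum.cong) (auto simp: crd_self subset_iff)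
    finally show ?thesis using finQ by simp
  qed
  have "crd B (\<Sum>Q - (z + z)) b = 0" if "b \<notin> P" for b using crd_span[OF assms(2,3) z(2) that] .
  then have "crd B z b = (if b \<in> Q then 1/2 else 0)" if "b \<notin> P" for b
    using c[of b] that z Qs lat_span[OF z(1)] span_add assms(2) by (auto simp: crd_linear split: if_splits)
  moreover have "q \<notin> P" if "q \<in> Q" for q using that assms unfolding odd_circuit_def by auto
  ultimately show ?thesis using z by (intro bexI[of _ z]) auto
qed

lemma odd_circuit_vol:
  assumes "odd_circuit P Q" "basis B" "P \<subseteq> B" "Q \<subseteq> B" shows "vol B = 2"
proof -
  obtain z where z: "z \<in> lat" "\<And>q. q \<in> Q \<Longrightarrow> crd B z q = 1/2"
    using odd_circuit_half[OF assms] by auto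
  obtain q where "q \<in> Q" using assms unfolding odd_circuit_def by auto
  then have "vol B * (1/2) \<in> \<int>" using vol_lat_int[OF assms(2) _ z(1), of q] z(2) assms by auto
  moreover have "(1/2::real) \<notin> \<int>"
  proof
    assume "(1/2::real) \<in> \<int>" then obtain n :: int where "1/2 = real_of_int n" by (auto elim: Ints_cases)
    then have "1 = 2 * n" by linarith then show False by presburger
  qed
  ultimately show ?thesis using vol_cases[OF assms(2)] by auto
qed

text \<open>
  Let \<open>B\<close> contain both circuits. Since \<open>Q\<close> puts a half-integral point into the lattice, some
  \<open>x \<in> A\<close> has coordinate \<open>\<plusminus>1/2\<close> at an element of \<open>Q\<close>. Exchanging \<open>x\<close> for that element halves the
  volume to \<open>1\<close>, although \<open>R\<close> stays in the basis and forces volume \<open>2\<close>.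
\<close>
lemma disjoint_odd_circuits:
  assumes "odd_circuit P Q" "odd_circuit P R" "Q \<inter> R = {}" "independent (P \<union> Q \<union> R)" "P \<subseteq> A"
  shows False
proof -
  have "P \<union> Q \<union> R \<subseteq> A" using assms unfolding odd_circuit_def by auto
  then obtain B where B: "basis B" "P \<union> Q \<union> R \<subseteq> B" using basis_extend assms(4) by metis
  have v: "vol B = 2" using odd_circuit_vol[OF assms(1) B(1)] B by auto
  obtain z where z: "z \<in> lat" "\<And>q. q \<in> Q \<Longrightarrow> crd B z q = 1/2"
    using odd_circuit_half[OF assms(1) B(1)] B(2) by auto
  obtain q where q: "q \<in> Q" using assms unfolding odd_circuit_def by auto
  \<comment> \<open>the lattice is generated by \<open>A\<close>, so it cannot be integral at \<open>q\<close> on all of \<open>A\<close>\<close>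
  have "\<exists>x\<in>A. crd B x q \<notin> \<int>"
  proof (rule ccontr)
    assume "\<not> ?thesis"
    then have "crd B z q \<in> \<int>" using lat_crd_induct[OF B(1) z(1), of 1 q 0 q] by auto
    then obtain n :: int where "1/2 = real_of_int n" using z(2)[OF q] by (auto elim: Ints_cases)
    then have "1 = 2 * n" by linarith then show False by presburger
  qed
  then obtain x where x: "x \<in> A" "crd B x q \<notin> \<int>" by auto
  have qB: "q \<in> B" using q B by auto
  have "\<bar>crd B x q\<bar> = 1/2"
    using vol_crd[OF B(1) qB x(1)] v x by (auto simp: abs_if split: if_splits)
  then have n: "crd B x q \<noteq> 0" "\<bar>crd B x q\<bar> = 1/2" by auto
  note pv = pivot[OF B(1) qB x(1) n(1)]
  have "P \<union> R \<subseteq> insert x (B - {q})" using B q assms unfolding odd_circuit_def by auto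
  then have "vol (insert x (B - {q})) = 2" using odd_circuit_vol[OF assms(2) pv(1)] by auto
  then show False using pv(3) n v by simp
qed

section \<open>Doubled elements and shears\<close>

definition mem :: "'v set \<Rightarrow> 'v \<Rightarrow> bool" where
  "mem P x \<longleftrightarrow> (\<exists>y\<in>A. y - x \<in> span P)"

text \<open>
  The image in the quotient by \<open>span P\<close> has differing columns.
\<close>
definition reduced :: "'v set \<Rightarrow> 'v set \<Rightarrow> bool" where
  "reduced P Y \<longleftrightarrow> Y \<subseteq> A \<and> (\<forall>y\<in>Y. y \<notin> span P) \<and>
     (\<forall>y\<in>Y. \<forall>z\<in>Y. y \<noteq> z \<longrightarrow> y - z \<notin> span P \<and> y + z \<notin> span P)"

text \<open>
  After contracting \<open>a\<close> the vectors \<open>s\<close> and \<open>s \<plusminus> a\<close> coincide, so the class of \<open>s\<close> loses a column.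
  Counting such classes is the heart of the proof.
\<close>
definition double :: "'v set \<Rightarrow> 'v \<Rightarrow> 'v \<Rightarrow> bool" where
  "double P a s \<longleftrightarrow> s \<in> A \<and> (\<exists>\<sigma>\<in>{1,-1}. mem P (s + \<sigma> *s a))"

lemma crd_cong:
  assumes "basis B" "P \<subseteq> B" "x - y \<in> span P" "x \<in> span A" "y \<in> span A" "b \<notin> P"
  shows "crd B x b = crd B y b"
  using crd_span[OF assms(1,2,3,6)] crd_linear(2)[OF assms(1,4,5)] by simp

lemma crd_lift:
  assumes "basis B" "P \<subseteq> B" "a \<in> B" "y - (x + r *s a) \<in> span P" "x \<in> span A" "y \<in> span A" "b \<notin> P"
  shows "crd B y b = crd B x b + (if b = a then r else 0)"
proof -
  have a: "a \<in> span A" "r *s a \<in> span A" using assms basisD[OF assms(1)] by (auto intro: span_base span_scale)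
  have "crd B y b = crd B (x + r *s a) b" using assms a by (intro crd_cong[of B P]) (auto intro: span_add)
  then show ?thesis using assms a by (simp add: crd_linear crd_scale crd_self)
qed

text \<open>
  If \<open>c\<close> is doubled along \<open>a\<close>, then \<open>c\<close> can be replaced in a basis by its companion \<open>c \<plusminus> a\<close>. This keeps
  the volume and all coordinates except the one at \<open>a\<close>, to which it adds a multiple of the coordinate
  at \<open>c\<close>. Doing this for a whole set \<open>T\<close> of doubled basis elements shears the coordinate at \<open>a\<close>.
\<close>
lemma shear:
  assumes B: "basis B" "P \<subseteq> B" "a \<in> B" "a \<notin> P"
    and T: "finite T" "T \<subseteq> B" "T \<inter> P = {}" "a \<notin> T"
    and lf: "\<And>c. c \<in> T \<Longrightarrow> lf c \<in> A \<and> lf c - (c + sg c *s a) \<in> span P"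
  shows "\<exists>B'. basis B' \<and> vol B' = vol B \<and> B' = (B - T) \<union> lf ` T \<and>
    (\<forall>x\<in>span A. crd B' x a = crd B x a - (\<Sum>c\<in>T. sg c * crd B x c) \<and>
      (\<forall>b\<in>B - T - P - {a}. crd B' x b = crd B x b) \<and> (\<forall>c\<in>T. crd B' x (lf c) = crd B x c))"
  using T lf
proof (induction T rule: finite_induct)
  case empty
  show ?case using B by auto
next
  case (insert c T)
  note BD = basisD[OF B(1)]
  from insert obtain B1 where B1: "basis B1" "vol B1 = vol B" "B1 = (B - T) \<union> lf ` T"
    "\<And>x. x\<in>span A \<Longrightarrow> crd B1 x a = crd B x a - (\<Sum>c\<in>T. sg c * crd B x c)"
    "\<And>x b. x\<in>span A \<Longrightarrow> b\<in>B - T - P - {a} \<Longrightarrow> crd B1 x b = crd B x b" 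
    "\<And>x c. x\<in>span A \<Longrightarrow> c\<in>T \<Longrightarrow> crd B1 x (lf c) = crd B x c"
    by (auto 0 3)
  let ?l = "lf c"
  have l: "?l \<in> A" "?l - (c + sg c *s a) \<in> span P" "c \<in> B" "c \<notin> T" "c \<notin> P" "c \<noteq> a" using insert by auto
  have sA: "c \<in> span A" "?l \<in> span A" using l BD by (auto intro: span_base)
  have lc: "crd B ?l b = (if b = c then 1 else 0) + (if b = a then sg c else 0)" if "b \<notin> P" for b
    using crd_lift[OF B(1,2,3) l(2) sA that] l B by (simp add: crd_self)
  have cB1: "c \<in> B1" using l B1 by auto
  have one: "crd B1 ?l c = 1" using B1(5)[OF sA(2), of c] l lc[of c] by auto
  then have nz: "crd B1 ?l c \<noteq> 0" by simp
  note pv = pivot[OF B1(1) cB1 l(1) nz]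
  have TP: "T \<subseteq> B" "T \<inter> P = {}" "a \<notin> T" using insert by auto
  have cl: "lf d \<noteq> c" if "d \<in> T" for d
  proof
    assume "lf d = c"
    then have "crd B1 c c = crd B c d" using B1(6)[OF sA(1) that] by simp
    then show False using crd_self[OF B1(1) cB1] crd_self[OF B(1) l(3)] that l by (auto split: if_splits)
  qed
  have sum0: "(\<Sum>d\<in>T. sg d * crd B ?l d) = 0"
    using TP l by (intro sum.neutral) (auto simp: lc disjoint_iff)
  have la: "crd B1 ?l a = sg c" using B1(4)[OF sA(2)] sum0 lc[of a] B l by auto
  have cx: "crd B1 x c = crd B x c" if "x \<in> span A" for x using B1(5)[OF that, of c] l by auto
  show ?case
  proof (intro exI conjI ballI)
    show "basis (insert ?l (B1 - {c}))" by (rule pv)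
    show "vol (insert ?l (B1 - {c})) = vol B" using pv(3) one B1 by simp
    show "insert ?l (B1 - {c}) = B - insert c T \<union> lf ` insert c T" using B1(3) cl by auto
  next
    fix x assume x: "x \<in> span A"
    have "a \<in> B1 - {c}" using B1 B insert by auto
    then have "crd (insert ?l (B1 - {c})) x a = crd B1 x a - crd B1 x c * sg c"
      using pv(5)[OF x] one la by simp
    then show "crd (insert ?l (B1 - {c})) x a = crd B x a - (\<Sum>c\<in>insert c T. sg c * crd B x c)"
      using insert B1(4)[OF x] cx[OF x] by simp
  next
    fix x b assume x: "x \<in> span A" "b \<in> B - insert c T - P - {a}"
    have "b \<in> B1 - {c}" using B1 x by auto
    moreover have "crd B1 ?l b = 0" using B1(5)[OF sA(2), of b] lc[of b] x by auto
    ultimately have "crd (insert ?l (B1 - {c})) x b = crd B1 x b" using pv(5)[OF x(1)] one by simp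
    then show "crd (insert ?l (B1 - {c})) x b = crd B x b" using B1(5)[OF x(1), of b] x by auto
  next
    fix x d assume x: "x \<in> span A" "d \<in> insert c T"
    show "crd (insert ?l (B1 - {c})) x (lf d) = crd B x d"
    proof (cases "d = c")
      case True
      then show ?thesis using pv(4)[OF x(1)] one cx[OF x(1)] by simp
    next
      case False
      then have d: "d \<in> T" using x by auto
      then have "lf d \<in> B1 - {c}" using B1 cl by auto
      moreover have "d \<notin> P" "d \<noteq> c" "d \<noteq> a" using d TP l by auto
      then have "crd B1 ?l (lf d) = 0" using B1(6)[OF sA(2) d] lc[of d] by auto
      ultimately have "crd (insert ?l (B1 - {c})) x (lf d) = crd B1 x (lf d)" using pv(5)[OF x(1)] one by simp
      then show ?thesis using B1(6)[OF x(1) d] by simp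
    qed
  qed
qed

lemma shear_bound:
  assumes B: "basis B" "P \<subseteq> B" "a \<in> B" "a \<notin> P"
    and T: "T \<subseteq> B" "T \<inter> P = {}" "a \<notin> T"
    and lf: "\<And>c. c \<in> T \<Longrightarrow> mem P (c + sg c *s a)"
    and x: "x \<in> A"
  shows "vol B * \<bar>crd B x a - (\<Sum>c\<in>T. sg c * crd B x c)\<bar> \<le> 2"
proof -
  have "\<exists>lf. \<forall>c\<in>T. lf c \<in> A \<and> lf c - (c + sg c *s a) \<in> span P"
    using lf unfolding mem_def by (intro bchoice) auto
  then obtain g where g: "\<And>c. c \<in> T \<Longrightarrow> g c \<in> A \<and> g c - (c + sg c *s a) \<in> span P" by blast
  have "finite T" using T(1) basisD(4)[OF B(1)] by (rule finite_subset)
  from shear[OF B this T g] obtain B' where B': "basis B'" "vol B' = vol B" "B' = (B - T) \<union> g ` T"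
    "crd B' x a = crd B x a - (\<Sum>c\<in>T. sg c * crd B x c)" using A_span[OF x] by blast
  have "a \<in> B'" using B' B T by auto
  from vol_crd_le[OF B'(1) this x] B' show ?thesis by simp
qed

text \<open>
  For every \<open>T \<subseteq> C\<close> the coordinate at \<open>a\<close>, sheared along \<open>T\<close>, is at most \<open>2 / vol B\<close> in absolute value,
  for \<open>x\<close> as well as for its companion, where it is shifted by \<open>\<plusminus>1\<close>. For the set \<open>T\<close> of elements with
  positive contribution and for its complement, the sheared values differ by the whole sum of
  absolute values.
\<close>
lemma doubled_width:
  assumes B: "basis B" "P \<subseteq> B" "a \<in> B" "a \<notin> P"
    and C: "C \<subseteq> B" "C \<inter> P = {}" "a \<notin> C" "\<And>c. c \<in> C \<Longrightarrow> double P a c"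
    and x: "double P a x"
  shows "vol B * (1 + (\<Sum>c\<in>C. \<bar>crd B x c\<bar>)) \<le> 4"
proof -
  have "\<forall>c\<in>C. \<exists>s. s \<in> {1,-1::real} \<and> mem P (c + s *s a)" using C(4) unfolding double_def by blast
  then have "\<exists>sg. \<forall>c\<in>C. sg c \<in> {1,-1::real} \<and> mem P (c + sg c *s a)" by (rule bchoice)
  then obtain sg where sg: "\<And>c. c \<in> C \<Longrightarrow> sg c \<in> {1,-1::real}" "\<And>c. c \<in> C \<Longrightarrow> mem P (c + sg c *s a)" by blast
  obtain t x' where x': "t \<in> {1,-1}" "x' \<in> A" "x' - (x + t *s a) \<in> span P" "x \<in> A"
    using x unfolding double_def mem_def by blast
  have fin: "finite C" using C(1) basisD(4)[OF B(1)] by (rule finite_subset)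
  have cx': "crd B x' b = crd B x b + (if b = a then t else 0)" if "b \<notin> P" for b
    using crd_lift[OF B(1-3) x'(3) A_span A_span that] x' by auto
  define S where "S T = (\<Sum>c\<in>T. sg c * crd B x c)" for T
  have bnd: "vol B * \<bar>crd B x a - S T\<bar> \<le> 2" "vol B * \<bar>crd B x a + t - S T\<bar> \<le> 2" if "T \<subseteq> C" for T
  proof -
    have T: "T \<subseteq> B" "T \<inter> P = {}" "a \<notin> T" using that C by auto
    have m: "mem P (c + sg c *s a)" if "c \<in> T" for c using that sg \<open>T \<subseteq> C\<close> by auto
    show "vol B * \<bar>crd B x a - S T\<bar> \<le> 2" unfolding S_def using shear_bound[OF B T m x'(4)] by simp
    have "(\<Sum>c\<in>T. sg c * crd B x' c) = S T" unfolding S_def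
      using cx' T by (intro sum.cong) (auto simp: disjoint_iff)
    then show "vol B * \<bar>crd B x a + t - S T\<bar> \<le> 2" using shear_bound[OF B T m x'(2)] cx'[of a] B(4) by simp
  qed
  \<comment> \<open>the two extreme choices of the set along which to shear\<close>
  define Tp where "Tp = {c\<in>C. sg c * crd B x c > 0}"
  define Tm where "Tm = {c\<in>C. sg c * crd B x c \<le> 0}"
  have "S Tp - S Tm = (\<Sum>c\<in>Tp. sg c * crd B x c) + (\<Sum>c\<in>Tm. - (sg c * crd B x c))"
    unfolding S_def by (simp add: sum_negf)
  also have "\<dots> = (\<Sum>c\<in>Tp. \<bar>crd B x c\<bar>) + (\<Sum>c\<in>Tm. \<bar>crd B x c\<bar>)"
  proof -
    have 1: "sg c * crd B x c = \<bar>crd B x c\<bar>" if "c \<in> Tp" for c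
      using that sg(1)[of c] unfolding Tp_def by auto
    have 2: "- (sg c * crd B x c) = \<bar>crd B x c\<bar>" if "c \<in> Tm" for c
      using that sg(1)[of c] unfolding Tm_def by auto
    show ?thesis using 1 2 by simp
  qed
  also have "\<dots> = (\<Sum>c\<in>Tp \<union> Tm. \<bar>crd B x c\<bar>)"
    using fin by (intro sum.union_disjoint[symmetric]) (auto simp: Tp_def Tm_def)
  also have "Tp \<union> Tm = C" unfolding Tp_def Tm_def by auto
  finally have d: "S Tp - S Tm = (\<Sum>c\<in>C. \<bar>crd B x c\<bar>)" .
  have sub: "Tp \<subseteq> C" "Tm \<subseteq> C" unfolding Tp_def Tm_def by auto
  show ?thesis using bnd[OF sub(1)] bnd[OF sub(2)] d x'(1) vol_cases[OF B(1)] by auto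
qed

end

section \<open>Doubled elements are independent without short odd circuits\<close>

lemma abs_eq_1_floor: "\<bar>r::real\<bar> = 1 \<Longrightarrow> r = of_int \<lfloor>r\<rfloor>" "\<bar>r::real\<bar> = 1 \<Longrightarrow> odd \<lfloor>r\<rfloor>"
proof -
  assume "\<bar>r\<bar> = 1"
  then have "r = 1 \<or> r = -1" by linarith
  then have "\<lfloor>r\<rfloor> = 1 \<and> r = 1 \<or> \<lfloor>r\<rfloor> = -1 \<and> r = -1" by (auto simp: floor_eq_iff)
  then show "r = of_int \<lfloor>r\<rfloor>" "odd \<lfloor>r\<rfloor>" by (elim disjE; simp)+
qed

lemma abs_eq_2_floor: "\<bar>r::real\<bar> = 2 \<Longrightarrow> r = of_int \<lfloor>r\<rfloor> \<and> even \<lfloor>r\<rfloor> \<and> \<lfloor>r\<rfloor> \<noteq> 0"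
proof -
  assume "\<bar>r\<bar> = 2"
  then have "r = 2 \<or> r = -2" by linarith
  then have "\<lfloor>r\<rfloor> = 2 \<and> r = 2 \<or> \<lfloor>r\<rfloor> = -2 \<and> r = -2" by (auto simp: floor_eq_iff)
  then show ?thesis by (elim disjE; simp)
qed

context volume_config begin

lemma independent_card_le: "T \<subseteq> A \<Longrightarrow> independent T \<Longrightarrow> card T \<le> dim A"
  using basis_extend[of T] card_basis basisD(4) card_mono by metis

lemma crd_decomp:
  assumes "basis B" "P \<subseteq> B" "x \<in> span A" "F \<subseteq> B" "F \<inter> P = {}" "\<And>b. b \<in> B - P - F \<Longrightarrow> crd B x b = 0"
  shows "x - (\<Sum>f\<in>F. crd B x f *s f) \<in> span P"
proof (rule crd_zero_span[OF assms(1) _ assms(2)])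
  have F: "finite F" "F \<subseteq> A" using basisD[OF assms(1)] assms(4) finite_subset by auto
  have s: "(\<Sum>f\<in>F. crd B x f *s f) \<in> span A" using F by (intro span_sum span_scale span_base) auto
  then show "x - (\<Sum>f\<in>F. crd B x f *s f) \<in> span A" using assms span_diff by auto
  fix b assume b: "b \<in> B - P"
  have "crd B (\<Sum>f\<in>F. crd B x f *s f) b = (\<Sum>f\<in>F. crd B (crd B x f *s f) b)"
    using F by (intro crd_sum assms) (auto intro: span_scale span_base)
  also have "\<dots> = (\<Sum>f\<in>F. if f = b then crd B x b else 0)"
    using F assms(1,4) by (intro sum.cong) (auto simp: crd_scale A_span crd_self subset_iff)
  also have "\<dots> = crd B x b" using F assms(6)[of b] b by auto
  finally show "crd B (x - (\<Sum>f\<in>F. crd B x f *s f)) b = 0" using s assms by (simp add: crd_linear)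
qed

lemma span_insert_crd:
  assumes "basis B" "insert a P \<subseteq> B" "a \<notin> P" "x \<in> span (insert a P)"
  shows "x - crd B x a *s a \<in> span P"
proof -
  have "x \<in> span A" using assms(4) span_mono[OF assms(2)] basisD(3)[OF assms(1)] by auto
  then show ?thesis using crd_decomp[of B P x "{a}"] assms crd_span[OF assms(1,2,4)] by auto
qed

lemma odd_circuitI:
  assumes "basis B" "P \<subseteq> B" "Q \<subseteq> B" "P \<inter> Q = {}" "Q \<noteq> {}" "evn P (\<Sum>Q)"
  shows "odd_circuit P Q"
  using assms basisD[OF assms(1)] independent_mono[of B "P \<union> Q"] unfolding odd_circuit_def by auto

text \<open>
  Coefficients matter only modulo \<open>2\<close>.
\<close>
lemma evn_odd_part:
  assumes "finite F" "F \<subseteq> lat" "evn P (x + (\<Sum>f\<in>F. of_int (n f) *s f))"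
  shows "evn P (x + \<Sum>{f\<in>F. odd (n f)})"
proof -
  let ?r = "\<Sum>f\<in>F. of_int (if odd (n f) then n f - 1 else n f) *s f"
  have "\<Sum>{f\<in>F. odd (n f)} = (\<Sum>f\<in>F. of_int (n f) *s f) - ?r"
    unfolding sum.inter_filter[OF assms(1)] sum_subtractf[symmetric]
    by (intro sum.cong) (auto simp: scale_left_diff_distrib)
  then have e: "x + \<Sum>{f\<in>F. odd (n f)} = (x + (\<Sum>f\<in>F. of_int (n f) *s f)) - ?r" by simp
  show ?thesis unfolding e using assms by (intro evn_diff[OF assms(3)] evn_sum evn_even) auto
qed

text \<open>
  Modulo \<open>span P\<close>, the relation \<open>x = \<Sum>f\<in>F. n f * f\<close> says that \<open>x\<close> plus the elements with odd coefficient
  is twice a lattice vector. Independence comes from exchanging \<open>x\<close> for the element \<open>d\<close>, whose even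
  coefficient keeps it out of the circuit.
\<close>
lemma odd_circuit_of_relation:
  assumes "basis B" "P \<subseteq> B" "x \<in> A" "F \<subseteq> B" "F \<inter> P = {}" "\<And>b. b \<in> B - P - F \<Longrightarrow> crd B x b = 0"
    and n: "\<And>f. f \<in> F \<Longrightarrow> crd B x f = of_int (n f)" and d: "d \<in> F" "even (n d)" "n d \<noteq> 0"
  shows "odd_circuit P (insert x {f\<in>F. odd (n f)})" "x \<notin> {f\<in>F. odd (n f)}"
proof -
  note BD = basisD[OF assms(1)]
  have F: "finite F" "F \<subseteq> A" using BD assms(4) finite_subset by auto
  have dB: "d \<in> B" "crd B x d \<noteq> 0" "d \<notin> P" using assms by auto
  note pv = pivot[OF assms(1) dB(1) assms(3) dB(2)]
  let ?O = "{f\<in>F. odd (n f)}"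
  show xO: "x \<notin> ?O" using pv(2) d assms(4) by auto
  have xP: "x \<notin> P" using pv(2) dB assms(2) by auto
  have "x - (\<Sum>f\<in>F. of_int (n f) *s f) \<in> span P"
    using crd_decomp[OF assms(1,2) A_span[OF assms(3)] assms(4-6)] n by simp
  then have "evn P (x + x - (x - (\<Sum>f\<in>F. of_int (n f) *s f)))"
    using lat_A[OF assms(3)] by (intro evn_diff evn_double evn_span)
  then have e: "evn P (x + (\<Sum>f\<in>F. of_int (n f) *s f))" by (simp add: algebra_simps)
  have "F \<subseteq> lat" using F lat_A by auto
  from evn_odd_part[OF F(1) this e] have "evn P (\<Sum>(insert x ?O))" using xO F by simp
  then show "odd_circuit P (insert x ?O)"
    using assms(2,4,5) dB d(2) xP by (intro odd_circuitI[OF pv(1)]) auto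
qed

lemma reduced_notin: "reduced P Y \<Longrightarrow> y \<in> Y \<Longrightarrow> y \<notin> P"
  using span_base unfolding reduced_def by blast

lemma reduced_single:
  assumes "basis B" "insert a P \<subseteq> B" "a \<notin> P" "reduced (insert a P) S" "x \<in> S" "c \<in> S" "x \<noteq> c" "c \<in> B"
    "\<And>b. b \<in> B - insert a P - {c} \<Longrightarrow> crd B x b = 0" "\<bar>crd B x c\<bar> = 1"
  shows False
proof -
  have SA: "S \<subseteq> A" and c: "c \<notin> span (insert a P)" using assms unfolding reduced_def by auto
  then have "c \<notin> insert a P" using span_base by blast
  then have "x - (\<Sum>f\<in>{c}. crd B x f *s f) \<in> span (insert a P)"
    using assms SA by (intro crd_decomp) (auto intro: span_base)
  then have "x - c \<in> span (insert a P) \<or> x + c \<in> span (insert a P)"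
    using assms(10) by (auto simp: abs_if split: if_splits)
  then show False using assms unfolding reduced_def by blast
qed

text \<open>
  In volume \<open>1\<close> all coordinates are integers, and by \<open>doubled_width\<close> the absolute values of the
  coordinates of \<open>x\<close> along \<open>C\<close> add up to at most \<open>3\<close>. A nonzero even coordinate gives an odd circuit with two elements. So two or
  three of them are \<open>\<plusminus>1\<close> and the rest vanish. Shearing along those of positive or of negative
  contribution moves the coordinate at \<open>a\<close>, for \<open>x\<close> or its companion, to \<open>\<plusminus>2\<close>; read as a relation,
  this is an odd circuit with two, three or four elements.
\<close>
lemma doubled_not_in_span_vol_1:
  assumes B: "basis B" "insert a P \<subseteq> B" "a \<notin> P" and v: "vol B = 1"
    and no: "\<And>Q. odd_circuit P Q \<Longrightarrow> card Q \<notin> {2,3,4}"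
    and S: "reduced (insert a P) S" "\<And>s. s \<in> S \<Longrightarrow> double P a s"
    and x: "x \<in> S" and C: "C \<subseteq> S" "C \<subseteq> B" "x \<notin> C" 
    and z: "\<And>b. b \<in> B - insert a P - C \<Longrightarrow> crd B x b = 0"
  shows False
proof -
  note BD = basisD[OF B(1)]
  have SA: "S \<subseteq> A" using S unfolding reduced_def by auto
  have fin: "finite C" using C(2) BD(4) by (rule finite_subset)
  have CP: "C \<inter> insert a P = {}" using reduced_notin[OF S(1)] C(1) by blast
  have xA: "x \<in> A" using SA x by auto
  have w: "1 + (\<Sum>c\<in>C. \<bar>crd B x c\<bar>) \<le> 4"
    using doubled_width[of B P a C x] B C CP S x v by auto
  define n where "n y f = \<lfloor>crd B y f\<rfloor>" for y f
  have n: "crd B y f = of_int (n y f)" if "y \<in> A" "f \<in> B" for y f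
    using vol_crd_int[OF B(1) that(2,1)] v unfolding n_def by (auto elim: Ints_cases)
  obtain t x' where x': "t \<in> {1,-1}" "x' \<in> A" "x' - (x + t *s a) \<in> span P"
    using S(2)[OF x] unfolding double_def mem_def by blast
  have aB: "a \<in> B" using B by auto
  have cx': "crd B x' b = crd B x b + (if b = a then t else 0)" if "b \<notin> P" for b
    using crd_lift[OF B(1) _ _ x'(3) A_span[OF xA] A_span[OF x'(2)] that] B by auto
  have nx': "n x' f = n x f" if "f \<in> C" for f unfolding n_def using cx'[of f] CP that
    by (cases "f \<in> P") auto
  have nxa: "n x' a = n x a + 1 \<or> n x' a = n x a - 1"
    using cx'[OF B(3)] n[OF xA aB] n[OF x'(2) aB] x'(1) by force
  have sumn: "(\<Sum>c\<in>C. \<bar>n x c\<bar>) \<le> 3"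
  proof -
    have "real_of_int (\<Sum>c\<in>C. \<bar>n x c\<bar>) = (\<Sum>c\<in>C. \<bar>crd B x c\<bar>)"
      using n[OF xA] C(2) by (simp add: subset_iff)
    then show ?thesis using w by linarith
  qed
  define K where "K = {c\<in>C. n x c \<noteq> 0}"
  have finK: "finite K" using fin K_def by auto
  have sumK: "(\<Sum>c\<in>K. \<bar>n x c\<bar>) \<le> 3"
    using sum_mono2[of C K "\<lambda>c. \<bar>n x c\<bar>"] fin sumn unfolding K_def by auto
  have K0: "K \<noteq> {}"
  proof
    assume "K = {}"
    then have "crd B x b = 0" if "b \<in> B - insert a P" for b
      using z[of b] n[OF xA, of b] that unfolding K_def by auto
    then have "x \<in> span (insert a P)" using crd_zero_span[OF B(1) A_span[OF xA] B(2)] by auto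
    then show False using S x unfolding reduced_def by auto
  qed
  show False
  proof (cases "\<exists>d\<in>K. even (n x d)")
    case True
    then obtain d where d: "d \<in> K" "even (n x d)" by auto
    let ?O = "{c\<in>C. odd (n x c)}"
    have "2 \<le> \<bar>n x d\<bar>" using d unfolding K_def by auto
    moreover have OK: "?O \<subseteq> K - {d}" using d unfolding K_def by auto
    have "(\<Sum>c\<in>K - {d}. \<bar>n x c\<bar>) + \<bar>n x d\<bar> \<le> 3" using sumK sum.remove[OF finK d(1), of "\<lambda>c. \<bar>n x c\<bar>"] by simp
    moreover have "int (card ?O) \<le> (\<Sum>c\<in>K - {d}. \<bar>n x c\<bar>)"
    proof -
      have "int (card ?O) = (\<Sum>c\<in>?O. 1)" by simp
      also have "\<dots> \<le> (\<Sum>c\<in>?O. \<bar>n x c\<bar>)" by (intro sum_mono) (auto simp: int_one_le_iff_zero_less)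
      also have "\<dots> \<le> (\<Sum>c\<in>K - {d}. \<bar>n x c\<bar>)" using OK finK by (intro sum_mono2) auto
      finally show ?thesis .
    qed
    ultimately have O1: "card ?O \<le> 1" by linarith
    \<comment> \<open>choose \<open>x\<close> or its companion, which differ by one at \<open>a\<close>, such that exactly one coefficient
      outside \<open>P\<close> is odd\<close>
    obtain y where y: "y \<in> A" "odd (n y a) \<longleftrightarrow> ?O = {}" "\<And>f. f \<in> C \<Longrightarrow> n y f = n x f"
      "\<And>b. b \<in> B - insert a P - C \<Longrightarrow> crd B y b = 0"
    proof (cases "odd (n x a) \<longleftrightarrow> ?O = {}")
      case True then show ?thesis using that[of x] xA z by auto
    next
      case False
      then have "odd (n x' a) \<longleftrightarrow> ?O = {}" using nxa by auto
      then show ?thesis using that[of x'] x'(2) nx' cx' z by auto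
    qed
    let ?F = "insert a C"
    have dF: "d \<in> ?F" "even (n y d)" "n y d \<noteq> 0" using d y(3) unfolding K_def by auto
    have oc: "odd_circuit P (insert y {f\<in>?F. odd (n y f)})" "y \<notin> {f\<in>?F. odd (n y f)}"
      by (rule odd_circuit_of_relation[OF B(1) _ y(1), of P ?F "n y" d]; use B C CP y dF n[OF y(1)] in auto)+
    have "{f\<in>?F. odd (n y f)} = (if ?O = {} then {a} else ?O)" using y(2,3) by auto
    moreover have "card ?O = 1" if "?O \<noteq> {}" using that O1 fin
      by (metis (no_types, lifting) Suc_leI card_gt_0_iff finite_Collect_conjI finite_subset le_antisym One_nat_def mem_Collect_eq subsetI)
    ultimately have "card {f\<in>?F. odd (n y f)} = 1" by auto
    then have "card (insert y {f\<in>?F. odd (n y f)}) = 2" using oc(2) fin by simp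
    then show False using no[OF oc(1)] by auto
  next
    case False
    have one: "\<bar>n x c\<bar> = 1" if "c \<in> K" for c
    proof -
      have "\<bar>n x c\<bar> \<le> (\<Sum>c\<in>K. \<bar>n x c\<bar>)" using finK that by (intro member_le_sum) auto
      then have "\<bar>n x c\<bar> \<le> 3" "n x c \<noteq> 0" "odd (n x c)" using sumK that False unfolding K_def by auto
      moreover have "vol B * \<bar>crd B x c\<bar> \<le> 2" using vol_crd_le[OF B(1) _ xA, of c] that C unfolding K_def by auto
      then have "\<bar>n x c\<bar> \<le> 2" using n[OF xA, of c] that C v unfolding K_def by auto
      ultimately show ?thesis by presburger
    qed
    have cK: "card K \<le> 3" using sumK one by simp
    have K2: "card K \<ge> 2"
    proof (rule ccontr)
      assume "\<not> card K \<ge> 2"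
      then have "card K = 1" using K0 finK by (metis One_nat_def Suc_1 card_0_eq leI less_2_cases)
      then obtain c where c: "K = {c}" by (rule card_1_singletonE)
      then have cC: "c \<in> C" "c \<in> B" unfolding K_def using C by auto
      have "crd B x b = 0" if "b \<in> B - insert a P - {c}" for b
      proof (cases "b \<in> C")
        case True
        then have "n x b = 0" using c that unfolding K_def by auto
        then show ?thesis using n[OF xA, of b] that by auto
      qed (use z that in auto)
      moreover have "\<bar>crd B x c\<bar> = 1" using one[of c] c n[OF xA cC(2)] by auto
      ultimately show False using reduced_single[OF B S(1) x, of c] C x cC by auto
    qed
    have "\<forall>c\<in>K. \<exists>s. s \<in> {1,-1::real} \<and> mem P (c + s *s a)"
      using S(2) C unfolding double_def K_def by blast
    then have "\<exists>sg. \<forall>c\<in>K. sg c \<in> {1,-1::real} \<and> mem P (c + sg c *s a)" by (rule bchoice)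
    then obtain sg where sg: "\<And>c. c \<in> K \<Longrightarrow> sg c \<in> {1,-1::real}" "\<And>c. c \<in> K \<Longrightarrow> mem P (c + sg c *s a)" by blast
    then have "\<exists>lf. \<forall>c\<in>K. lf c \<in> A \<and> lf c - (c + sg c *s a) \<in> span P"
      unfolding mem_def by (intro bchoice) auto
    then obtain lf where lf: "\<And>c. c \<in> K \<Longrightarrow> lf c \<in> A \<and> lf c - (c + sg c *s a) \<in> span P" by blast
    have KB: "K \<subseteq> B" "K \<inter> P = {}" "a \<notin> K" using C CP unfolding K_def by auto
    have Kc: "c \<in> B" "c \<notin> P" "c \<noteq> a" "c \<in> span A" if "c \<in> K" for c
      using that KB BD(1) A_span by blast+
    define U where "U T = (\<Sum>c\<in>T. sg c * crd B x c)" for T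
    define Tp where "Tp = {c\<in>K. sg c * crd B x c = 1}"
    define Tm where "Tm = {c\<in>K. sg c * crd B x c = -1}"
    have sub: "Tp \<subseteq> K" "Tm \<subseteq> K" and ft: "finite Tp" "finite Tm" unfolding Tp_def Tm_def using finK by auto
    have "\<bar>crd B x c\<bar> = 1" if "c \<in> K" for c using one[OF that] n[OF xA, of c] KB that by auto
    then have "sg c * crd B x c = 1 \<or> sg c * crd B x c = -1" if "c \<in> K" for c
    proof -
      have "crd B x c = 1 \<or> crd B x c = -1" using \<open>\<And>c. c \<in> K \<Longrightarrow> \<bar>crd B x c\<bar> = 1\<close>[OF that] by linarith
      then show ?thesis using sg(1)[OF that] by auto
    qed
    then have un: "K = Tp \<union> Tm" unfolding Tp_def Tm_def by auto
    have dis: "Tp \<inter> Tm = {}" unfolding Tp_def Tm_def by auto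
    have U: "U Tp = card Tp" "U Tm = - real (card Tm)" unfolding U_def Tp_def Tm_def by auto
    have cc: "card K = card Tp + card Tm" unfolding un using ft dis by (rule card_Un_disjoint)
    have bas: "\<exists>B'. basis B' \<and> vol B' = 1 \<and> B' = (B - T) \<union> lf ` T \<and> (\<forall>y\<in>span A. crd B' y a = crd B y a - (\<Sum>c\<in>T. sg c * crd B y c) \<and>
      (\<forall>b\<in>B - T - P - {a}. crd B' y b = crd B y b) \<and> (\<forall>c\<in>T. crd B' y (lf c) = crd B y c))" if "T \<subseteq> K" for T
      using shear[OF B(1) _ aB B(3), of T lf sg] finite_subset[OF that finK] that KB B lf v by auto
    \<comment> \<open>a sheared coordinate \<open>\<plusminus>2\<close> at \<open>a\<close>, next to coordinates \<open>\<plusminus>1\<close> on the sheared set \<open>K\<close>, is a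
      relation with an odd circuit of at most four elements\<close>
    have key: False if "T \<subseteq> K" "y \<in> {x, x'}" "\<bar>crd B y a - U T\<bar> = 2" for T y
    proof -
      from bas[OF that(1)] obtain B' where B': "basis B'" "vol B' = 1" "B' = (B - T) \<union> lf ` T"
        "\<And>y. y \<in> span A \<Longrightarrow> crd B' y a = crd B y a - (\<Sum>c\<in>T. sg c * crd B y c)"
        "\<And>y b. y \<in> span A \<Longrightarrow> b \<in> B - T - P - {a} \<Longrightarrow> crd B' y b = crd B y b"
        "\<And>y c. y \<in> span A \<Longrightarrow> c \<in> T \<Longrightarrow> crd B' y (lf c) = crd B y c" by blast
      have yA: "y \<in> A" "y \<in> span A" using that xA x' A_span by auto
      have yc: "crd B y b = crd B x b" if "b \<notin> P" "b \<noteq> a" for b using cx'[OF that(1)] that \<open>y \<in> {x,x'}\<close> by auto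
      have ya: "\<bar>crd B' y a\<bar> = 2"
      proof -
        have "(\<Sum>c\<in>T. sg c * crd B y c) = U T" unfolding U_def using yc that KB by (intro sum.cong) auto
        then show ?thesis using B'(4)[OF yA(2)] that(3) by simp
      qed
      have PB': "P \<subseteq> B'" "a \<in> B'" using B'(3) B KB that by auto
      have lP: "lf ` T \<inter> P = {}"
      proof -
        have "lf c \<notin> P" if "c \<in> T" for c
        proof
          assume l: "lf c \<in> P"
          have c: "c \<in> K" using that \<open>T \<subseteq> K\<close> by auto
          have lA: "lf c \<in> A" using lf[OF c] by simp
          have "crd B (lf c) c = 1"
            using crd_lift[OF B(1) _ aB conjunct2[OF lf[OF c]] Kc(4)[OF c] A_span[OF lA] Kc(2)[OF c]]
              B Kc[OF c] crd_self[OF B(1)] by auto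
          then show False using crd_span[OF B(1) _ span_base[OF l] Kc(2)[OF c]] B by auto
        qed
        then show ?thesis by auto
      qed
      define F where "F = insert a ((K - T) \<union> lf ` T)"
      have FB: "F \<subseteq> B'" "F \<inter> P = {}" unfolding F_def using B'(3) KB PB' lP B(3) by auto
      have vals: "\<bar>crd B' y f\<bar> = 1" if f: "f \<in> F" "f \<noteq> a" for f
      proof -
        have 1: "\<bar>crd B y c\<bar> = 1" if "c \<in> K" for c
          using one[OF that] n[OF xA Kc(1)[OF that]] yc[OF Kc(2,3)[OF that]] by simp
        from f consider "f \<in> K - T" | c where "c \<in> T" "f = lf c" unfolding F_def by auto
        then show ?thesis
        proof cases
          case 1
          then have "f \<in> B - T - P - {a}" using KB by auto
          then show ?thesis using B'(5)[OF yA(2)] \<open>\<And>c. c \<in> K \<Longrightarrow> \<bar>crd B y c\<bar> = 1\<close> 1 by simp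
        next
          case (2 c)
          then show ?thesis using B'(6)[OF yA(2)] \<open>\<And>c. c \<in> K \<Longrightarrow> \<bar>crd B y c\<bar> = 1\<close> \<open>T \<subseteq> K\<close> by auto
        qed
      qed
      have zero: "crd B' y b = 0" if "b \<in> B' - P - F" for b
      proof -
        have b: "b \<in> B - T - P - {a}" "b \<notin> K" using that B'(3) unfolding F_def by auto
        then have "crd B y b = crd B x b" using yc[of b] by auto
        also have "\<dots> = 0" using b z[of b] n[OF xA, of b] unfolding K_def by (cases "b \<in> C") auto
        finally show ?thesis using B'(5)[OF yA(2) b(1)] by simp
      qed
      define m where "m f = \<lfloor>crd B' y f\<rfloor>" for f
      have m: "crd B' y f = of_int (m f)" if "f \<in> F" for f
        using abs_eq_2_floor[OF ya] abs_eq_1_floor(1)[OF vals[OF that]] unfolding m_def by (cases "f = a") auto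
      have ma: "even (m a)" "m a \<noteq> 0" using abs_eq_2_floor[OF ya] unfolding m_def by auto
      have mo: "odd (m f)" if "f \<in> F" "f \<noteq> a" for f using abs_eq_1_floor(2)[OF vals[OF that]] unfolding m_def .
      have oc: "odd_circuit P (insert y {f\<in>F. odd (m f)})" "y \<notin> {f\<in>F. odd (m f)}"
        by (rule odd_circuit_of_relation[OF B'(1) PB'(1) yA(1) FB zero m _ ma]; (simp add: F_def)?)+
      have Feq: "{f\<in>F. odd (m f)} = F - {a}" using ma mo by auto
      have finT: "finite T" using that(1) finK by (rule finite_subset)
      have finF: "finite F" unfolding F_def using finK finT by auto
      have "card (F - {a}) \<le> card ((K - T) \<union> lf ` T)" unfolding F_def using finK finT by (intro card_mono) auto
      also have "\<dots> \<le> card (K - T) + card (lf ` T)" by (rule card_Un_le)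
      also have "\<dots> \<le> card (K - T) + card T" using card_image_le[OF finT] by simp
      also have "\<dots> = card K" using that(1) finK by (simp add: card_Diff_subset finT card_mono)
      finally have up: "card (F - {a}) \<le> 3" using cK by simp
      have "F - {a} \<noteq> {}"
      proof
        assume e: "F - {a} = {}"
        then have "K - T = {}" using KB unfolding F_def by auto
        then have TK: "T = K" using that(1) by auto
        then obtain c where "c \<in> T" "lf c = a" using e K0 unfolding F_def by auto
        then have "crd B' a a = crd B a c" using B'(6)[of a c] A_span BD aB by auto
        then show False using crd_self[OF B'(1) PB'(2), of a] crd_self[OF B(1) aB, of c] \<open>c \<in> T\<close> TK KB by (auto split: if_splits)
      qed
      then have "card (F - {a}) \<ge> 1" using finF by (simp add: Suc_leI card_gt_0_iff)
      then have "card (insert y {f\<in>F. odd (m f)}) \<in> {2,3,4}" using oc(2) finF up unfolding Feq by auto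
      then show False using no[OF oc(1)] by auto
    qed
    have bnd: "\<bar>crd B y a - U T\<bar> \<le> 2" if "T \<subseteq> K" "y \<in> {x, x'}" for T y
    proof -
      have T: "T \<subseteq> B" "T \<inter> P = {}" "a \<notin> T" and mT: "\<And>c. c \<in> T \<Longrightarrow> mem P (c + sg c *s a)"
        using that(1) KB sg by auto
      have yA: "y \<in> A" using that xA x' by auto
      have "(\<Sum>c\<in>T. sg c * crd B y c) = U T" unfolding U_def using cx' that(2) T
        by (intro sum.cong) (auto simp: disjoint_iff split: if_splits)
      then show ?thesis using shear_bound[OF B(1) _ aB B(3) T mT yA] B v by auto
    qed
    have i: "crd B x a \<in> \<int>" "crd B x' a \<in> \<int>" using n[OF xA aB] n[OF x'(2) aB] by auto
    obtain k where k: "crd B x a = of_int k" using i by (auto elim: Ints_cases)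
    have x'a: "crd B x' a = of_int k + t" using cx'[OF B(3)] k by simp
    \<comment> \<open>the sheared values for \<open>Tp\<close> and \<open>Tm\<close> are \<open>card K \<ge> 2\<close> apart; together with the companion,
      shifted by \<open>t = \<plusminus>1\<close>, one of them leaves the range from \<open>-1\<close> to \<open>1\<close>\<close>
    note b1 = bnd[OF sub(1), of x, simplified] bnd[OF sub(1), of x', simplified] bnd[OF sub(2), of x, simplified] bnd[OF sub(2), of x', simplified]
    note k1 = key[OF sub(1), of x, simplified] key[OF sub(1), of x', simplified] key[OF sub(2), of x, simplified] key[OF sub(2), of x', simplified]
    show False
    proof (cases "t = 1")
      case True
      have "\<bar>k - int (card Tp)\<bar> \<le> 2" "\<bar>k + 1 + int (card Tm)\<bar> \<le> 2" "\<bar>k - int (card Tp)\<bar> \<noteq> 2" "\<bar>k + 1 + int (card Tm)\<bar> \<noteq> 2"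
        using b1 k1 k x'a True U by auto linarith+
      then show False using K2 cc by linarith
    next
      case False
      then have "t = -1" using x' by auto
      then have "\<bar>k - 1 - int (card Tp)\<bar> \<le> 2" "\<bar>k + int (card Tm)\<bar> \<le> 2" "\<bar>k - 1 - int (card Tp)\<bar> \<noteq> 2" "\<bar>k + int (card Tm)\<bar> \<noteq> 2"
        using b1 k1 k x'a U by auto linarith+
      then show False using K2 cc by linarith
    qed
  qed
qed

end

lemma sum_abs_le_1:
  fixes f :: "'a \<Rightarrow> real"
  assumes "finite C" "c \<in> C" "\<bar>f c\<bar> = 1" "(\<Sum>c\<in>C. \<bar>f c\<bar>) \<le> 1" "d \<in> C" "d \<noteq> c"
  shows "f d = 0"
proof -
  have "\<bar>f d\<bar> \<le> (\<Sum>c\<in>C - {c}. \<bar>f c\<bar>)" using assms by (intro member_le_sum) auto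
  then show ?thesis using assms sum.remove[OF assms(1,2), of "\<lambda>c. \<bar>f c\<bar>"] by simp
qed

text \<open>
  The listed values are the coordinates possible in a basis of volume \<open>2\<close>.
\<close>
lemma half_integer_diff:
  assumes "r \<in> {-1, -1/2, 0, 1/2, 1::real}" "r \<notin> \<int>" "s \<in> {-1, -1/2, 0, 1/2, 1::real}" "s \<notin> \<int>"
  shows "r - s \<in> \<int>"
proof -
  have "r = -1/2 \<or> r = 1/2" "s = -1/2 \<or> s = 1/2" using assms by auto
  then have "r - s = -1 \<or> r - s = 0 \<or> r - s = 1" by argo
  then show ?thesis by auto
qed

context volume_config begin

text \<open>
  The doubled elements are independent modulo \<open>insert a P\<close>: otherwise some \<open>x \<in> S\<close> depends on a
  maximal independent part \<open>C\<close>. In volume \<open>1\<close> this was excluded above. In volume \<open>2\<close> the width bound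
  leaves room either for a single coordinate \<open>\<plusminus>1\<close>, which makes \<open>x\<close> congruent to an element of \<open>C\<close> up to
  sign, or for a coordinate \<open>\<plusminus>1/2\<close>, and exchanging \<open>x\<close> there leads back to volume \<open>1\<close>.
\<close>
lemma card_doubled_no_short_odd_circuit:
  assumes P: "P \<subseteq> A" "a \<in> A" "a \<notin> P" "independent (insert a P)"
    and no: "\<And>Q. odd_circuit P Q \<Longrightarrow> card Q \<notin> {2,3,4}"
    and S: "reduced (insert a P) S" "\<And>s. s \<in> S \<Longrightarrow> double P a s"
  shows "card S + card P + 1 \<le> dim A"
proof -
  let ?P = "insert a P"
  have SA: "S \<subseteq> A" using S unfolding reduced_def by auto
  obtain T where T: "?P \<subseteq> T" "T \<subseteq> ?P \<union> S" "independent T" "?P \<union> S \<subseteq> span T"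
    using maximal_independent_subset_extend[of ?P "?P \<union> S"] P by auto
  have TA: "T \<subseteq> A" using T SA P by auto
  obtain B where B: "basis B" "T \<subseteq> B" using basis_extend[OF TA T(3)] .
  note BD = basisD[OF B(1)]
  define C where "C = T - ?P"
  have C: "C \<subseteq> S" "C \<subseteq> B" "?P \<subseteq> B" using T B unfolding C_def by auto
  have z: "crd B x b = 0" if "x \<in> S" "b \<in> B - ?P - C" for x b
    using crd_span[OF B(1,2), of x b] T(4) that unfolding C_def by auto
  have "S \<subseteq> C"
  proof
    fix x assume x: "x \<in> S"
    show "x \<in> C"
    proof (rule ccontr)
      assume xC: "x \<notin> C"
      have xA: "x \<in> A" using x SA by auto
      have nP: "c \<notin> ?P" if "c \<in> S" for c using reduced_notin[OF S(1) that] .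
      have finC: "finite C" using C(2) BD(4) by (rule finite_subset)
      consider "vol B = 1" | "vol B = 2" using vol_cases B by auto
      then show False
      proof cases
        case 1
        then show False using doubled_not_in_span_vol_1[OF B(1) C(3) P(3) _ no S x C(1,2) xC z[OF x]] by auto
      next
        case 2
        have w: "(\<Sum>c\<in>C. \<bar>crd B x c\<bar>) \<le> 1"
          using doubled_width[of B P a C x] B(1) C P(3) S x 2 nP by auto
        have "\<exists>c\<in>C. crd B x c \<noteq> 0"
        proof (rule ccontr)
          assume "\<not> ?thesis"
          then have "x \<in> span ?P" using crd_zero_span[OF B(1) A_span[OF xA] C(3)] z[OF x] by blast
          then show False using S x unfolding reduced_def by auto
        qed
        then obtain c where c: "c \<in> C" "crd B x c \<noteq> 0" by auto
        have cB: "c \<in> B" "c \<in> S" "x \<noteq> c" using c C xC by auto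
        from vol_crd[OF B(1) cB(1) xA] 2 c have "\<bar>crd B x c\<bar> = 1 \<or> \<bar>crd B x c\<bar> = 1/2" by auto
        then show False
        proof
          assume one: "\<bar>crd B x c\<bar> = 1"
          have "crd B x d = 0" if "d \<in> C - {c}" for d
            using sum_abs_le_1[of C c "crd B x" d] finC c one w that by auto
          then have "crd B x b = 0" if "b \<in> B - ?P - {c}" for b using z[OF x, of b] that by auto
          then show False using reduced_single[OF B(1) C(3) P(3) S(1) x cB(2,3,1) _ one] by auto
        next
          \<comment> \<open>now \<open>c\<close> depends on \<open>x\<close> and the other elements, in a basis of volume \<open>1\<close>\<close>
          assume half: "\<bar>crd B x c\<bar> = 1/2"
          note pv = pivot[OF B(1) cB(1) xA c(2)]
          let ?B = "insert x (B - {c})" and ?C = "insert x (C - {c})"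
          have v1: "vol ?B = 1" using pv(3) half 2 by simp
          have 1: "?P \<subseteq> ?B" using C nP[OF cB(2)] by auto
          have 2: "?C \<subseteq> S" "?C \<subseteq> ?B" "c \<notin> ?C" using C x cB by auto
          have 3: "crd ?B c b = 0" if b: "b \<in> ?B - ?P - ?C" for b
          proof -
            have b': "b \<in> B - {c}" "b \<in> B - ?P - C" using b by auto
            have "crd ?B c b = crd B c b - crd B c c / crd B x c * crd B x b"
              using pv(5)[OF A_span b'(1)] cB SA by auto
            then show ?thesis using z[OF x b'(2)] crd_self[OF B(1) cB(1), of b] b' by auto
          qed
          show False using doubled_not_in_span_vol_1[OF pv(1) 1 P(3) v1 no S cB(2) 2 3] by auto
        qed
      qed
    qed
  qed
  then have "?P \<union> S \<subseteq> T" using T(1) unfolding C_def by auto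
  then have "independent (?P \<union> S)" using T(3) independent_mono by blast
  then have "card (?P \<union> S) \<le> dim A" using P SA by (intro independent_card_le) auto
  moreover have "?P \<inter> S = {}" using reduced_notin[OF S(1)] by blast
  moreover have "finite ?P" "finite S" using P SA finite_A finite_subset by auto
  ultimately show ?thesis using P by (simp add: card_Un_disjoint)
qed

end

section \<open>Frames of a shortest odd circuit\<close>

text \<open>
  Odd circuits with one element are disregarded here: such an element is twice a lattice vector
  modulo \<open>span P\<close>, and steps along it could be shorter than the element itself.
\<close>
locale shortest_odd_circuit = volume_config scale A vol
  for scale :: "real \<Rightarrow> 'v::ab_group_add \<Rightarrow> 'v" (infixr \<open>*s\<close> 75) and A vol +
  fixes P J :: "'v set"
  assumes P_A: "P \<subseteq> A" and odd_J: "odd_circuit P J" and card_J: "2 \<le> card J"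
    and shortest: "odd_circuit P Q \<Longrightarrow> 2 \<le> card Q \<Longrightarrow> card J \<le> card Q"
begin

lemma J_props: "J \<subseteq> A" "finite J" "J \<inter> P = {}" "independent (P \<union> J)" "evn P (\<Sum>J)" "finite P"
  using odd_J finite_A finite_subset P_A unfolding odd_circuit_def by auto

text \<open>
  Contains an odd circuit, hence has volume \<open>2\<close>.
\<close>
definition frame :: "'v set \<Rightarrow> bool" where "frame B \<longleftrightarrow> basis B \<and> P \<union> J \<subseteq> B"

lemma frameD: assumes "frame B" shows "basis B" "P \<subseteq> B" "J \<subseteq> B" "vol B = 2" "B \<subseteq> A" "finite B"
  using assms odd_circuit_vol[OF odd_J] basisD unfolding frame_def by auto

lemma frame_extend:
  assumes "R \<subseteq> A" "independent (P \<union> J \<union> R)"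
  obtains B where "frame B" "R \<subseteq> B"
proof -
  have "P \<union> J \<union> R \<subseteq> A" using assms P_A J_props by auto
  from basis_extend[OF this assms(2)] obtain B where "basis B" "P \<union> J \<union> R \<subseteq> B" .
  then show ?thesis using that[of B] unfolding frame_def by auto
qed

lemma frame_insert:
  assumes "c \<in> A" "c \<notin> span (P \<union> J)"
  obtains B where "frame B" "c \<in> B" "c \<notin> P \<union> J"
proof -
  have "independent (P \<union> J \<union> {c})" using independent_insertI[OF assms(2)] J_props by simp
  moreover have "c \<notin> P \<union> J" using assms(2) span_base by blast
  ultimately show ?thesis using frame_extend[of "{c}"] that assms by auto
qed

lemma frame_insert2:
  assumes "c \<in> A" "c \<notin> span (P \<union> J)" "c' \<in> A" "c' \<notin> span (P \<union> J \<union> {c})"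
  obtains B where "frame B" "c \<in> B" "c' \<in> B" "c \<notin> P \<union> J" "c' \<notin> P \<union> J" "c' \<noteq> c"
proof -
  have c: "independent (insert c (P \<union> J))" by (rule independent_insertI[OF assms(2) J_props(4)])
  have "c' \<notin> span (insert c (P \<union> J))" using assms(4) by simp
  then have "independent (insert c' (insert c (P \<union> J)))" using c by (rule independent_insertI)
  moreover have "P \<union> J \<union> {c, c'} = insert c' (insert c (P \<union> J))" by auto
  ultimately have ind: "independent (P \<union> J \<union> {c, c'})" by simp
  have n: "c \<notin> P \<union> J" "c' \<notin> P \<union> J" "c' \<noteq> c"
    using assms(2) assms(4) span_base[of _ "P \<union> J"] span_base[of _ "P \<union> J \<union> {c}"] by auto
  have "{c, c'} \<subseteq> A" using assms by simp
  from frame_extend[OF this ind] obtain B where "frame B" "{c, c'} \<subseteq> B" .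
  then show ?thesis using that n by simp
qed

lemma frame_exists: obtains B where "frame B"
  using frame_extend[of "{}"] J_props by auto

text \<open>
  Exchanging outside \<open>J\<close> keeps the odd circuit in the basis and therefore the volume \<open>2\<close>.
\<close>
lemma frame_off:
  assumes "frame B" "b \<in> B" "b \<notin> P" "b \<notin> J" "x \<in> A"
  shows "crd B x b \<in> {-1, 0, 1}"
proof (cases "crd B x b = 0")
  case False
  note F = frameD[OF assms(1)]
  note pv = pivot[OF F(1) assms(2,5) False]
  have "vol (insert x (B - {b})) = 2"
    using odd_circuit_vol[OF odd_J pv(1)] F assms by auto
  then show ?thesis using pv(3) F by (auto simp: abs_if split: if_splits)
qed auto

lemma frame_J:
  assumes "frame B" "b \<in> B" "x \<in> A"
  shows "crd B x b \<in> {-1, -1/2, 0, 1/2, 1}"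
proof -
  note F = frameD[OF assms(1)]
  show ?thesis using vol_crd[OF F(1) assms(2,3)] F(4) by (auto simp: abs_if split: if_splits)
qed

text \<open>
  On \<open>J\<close> the coordinates of \<open>x\<close> are all integral or all half-integral. Otherwise, since twice \<open>x\<close> is even,
  the elements of \<open>J\<close> with half-integral coordinate form an odd circuit, and so does the rest of
  \<open>J\<close>, but two disjoint independent odd circuits cannot coexist.
\<close>
lemma frame_parity:
  assumes F: "frame B" and x: "x \<in> A" and b: "b \<in> J" "b' \<in> J"
  shows "crd B x b - crd B x b' \<in> \<int>"
proof -
  note FD = frameD[OF F]
  define H where "H = {b\<in>J. crd B x b \<notin> \<int>}"
  have "H = {} \<or> H = J"
  proof (rule ccontr)
    assume neg: "\<not> ?thesis"
    have "(2::real) *s x = x + x" using scale_left_distrib[of 1 1 x] by simp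
    define n where "n f = \<lfloor>2 * crd B x f\<rfloor>" for f
    have n: "2 * crd B x f = of_int (n f)" if "f \<in> B" for f
      using vol_crd_int[OF FD(1) that x] FD(4) unfolding n_def by (auto elim: Ints_cases)
    have Fs: "finite (B - P)" "B - P \<subseteq> B" "(B - P) \<inter> P = {}" using FD by auto
    have "x - (\<Sum>f\<in>B-P. crd B x f *s f) \<in> span P"
      by (rule crd_decomp[OF FD(1,2) A_span[OF x] Fs(2,3)]) auto
    then have "2 *s (x - (\<Sum>f\<in>B-P. crd B x f *s f)) \<in> span P" by (rule span_scale)
    also have "2 *s (x - (\<Sum>f\<in>B-P. crd B x f *s f)) = x + x - (\<Sum>f\<in>B-P. of_int (n f) *s f)"
      using n \<open>2 *s x = x + x\<close> by (simp add: scale_right_diff_distrib scale_sum_right)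
    finally have "evn P (x + x - (x + x - (\<Sum>f\<in>B-P. of_int (n f) *s f)))"
      using lat_A[OF x] by (intro evn_diff evn_double evn_span)
    then have "evn P (\<Sum>f\<in>B-P. of_int (n f) *s f)" by simp
    then have "evn P (\<Sum>{f\<in>B-P. odd (n f)})" using evn_odd_part[of "B - P" P 0 n] FD lat_A by auto
    moreover have "{f\<in>B-P. odd (n f)} = H"
    proof -
      have "odd (n f) \<longleftrightarrow> f \<in> H" if "f \<in> B - P" for f
      proof (cases "f \<in> J")
        case True
        have "odd (n f) \<longleftrightarrow> crd B x f \<notin> \<int>"
        proof
          assume "odd (n f)"
          show "crd B x f \<notin> \<int>"
          proof
            assume "crd B x f \<in> \<int>"
            then obtain k :: int where "crd B x f = of_int k" by (auto elim: Ints_cases)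
            then have "of_int (n f) = (of_int (2 * k) :: real)" using n[of f] that by simp
            then show False using \<open>odd (n f)\<close> by (simp only: of_int_eq_iff) simp
          qed
        next
          assume "crd B x f \<notin> \<int>"
          show "odd (n f)"
          proof
            assume "even (n f)"
            then obtain k where "n f = 2 * k" by auto
            then have "crd B x f = of_int k" using n[of f] that by simp
            then show False using \<open>crd B x f \<notin> \<int>\<close> by simp
          qed
        qed
        then show ?thesis using True unfolding H_def by simp
      next
        case False
        then have "crd B x f \<in> {-1, 0, 1}" using frame_off[OF F _ _ False x] that by auto
        then have "n f \<in> {-2, 0, 2}" using n[of f] that by auto
        then show ?thesis using False unfolding H_def by auto
      qed
      moreover have "H \<subseteq> B - P" using FD(3) J_props unfolding H_def by auto
      ultimately show ?thesis by auto
    qed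
    ultimately have eH: "evn P (\<Sum>H)" by simp
    \<comment> \<open>both \<open>H\<close> and its complement in \<open>J\<close> are odd circuits\<close>
    have HJ: "H \<subset> J" "H \<noteq> {}" using neg unfolding H_def by auto
    have HP: "P \<inter> H = {}" "H \<subseteq> B" using HJ J_props FD by auto
    have oH: "odd_circuit P H" using odd_circuitI[OF FD(1,2) HP(2,1) HJ(2) eH] .
    have "evn P (\<Sum>J - \<Sum>H)" using J_props eH by (intro evn_diff) auto
    also have "\<Sum>J - \<Sum>H = \<Sum>(J - H)" using HJ J_props by (simp add: sum_diff)
    finally have "odd_circuit P (J - H)" using HJ FD J_props by (intro odd_circuitI[OF FD(1,2)]) auto
    then show False using disjoint_odd_circuits[OF oH _ _ _ P_A, of "J - H"] HJ J_props
      by (metis Diff_disjoint Diff_partition psubset_imp_subset sup_assoc)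
  qed
  then show ?thesis
  proof
    assume "H = {}"
    then show ?thesis using b unfolding H_def by auto
  next
    assume "H = J"
    then have "crd B x b \<notin> \<int>" "crd B x b' \<notin> \<int>" using b unfolding H_def by auto
    then show ?thesis using half_integer_diff frame_J[OF F _ x, of b] frame_J[OF F _ x, of b'] b FD(3) by blast
  qed
qed

end

context volume_config begin

lemma cong_by_crd:
  assumes "basis B" "P \<subseteq> B" "x \<in> span A" "y \<in> span A" "\<And>b. b \<in> B - P \<Longrightarrow> crd B x b = crd B y b"
  shows "x - y \<in> span P"
  using assms by (intro crd_zero_span[OF assms(1) _ assms(2)]) (auto simp: crd_linear intro: span_diff)

lemma crd_lift2:
  assumes "basis B" "P \<subseteq> B" "a \<in> B" "d \<in> B" "y - (x + r *s a + q *s d) \<in> span P" "x \<in> span A" "y \<in> span A" "b \<notin> P"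
  shows "crd B y b = crd B x b + (if b = a then r else 0) + (if b = d then q else 0)"
proof -
  have s: "a \<in> span A" "r *s a \<in> span A" "q *s d \<in> span A" "d \<in> span A"
    using assms basisD[OF assms(1)] by (auto intro: span_base span_scale)
  have "crd B y b = crd B (x + r *s a + q *s d) b" using assms s by (intro crd_cong[of B P]) (auto intro: span_add)
  then show ?thesis using assms s by (simp add: crd_linear crd_scale crd_self span_add)
qed

lemma sign_A: "x \<in> A \<Longrightarrow> \<bar>l\<bar> = 1 \<Longrightarrow> l *s x \<in> A"
  using uminus_A[of x] by (auto simp: abs_if split: if_splits)

end

context shortest_odd_circuit begin

lemma frame_lat_parity:
  assumes "frame B" "z \<in> lat" "b \<in> J" "b' \<in> J" shows "crd B z b - crd B z b' \<in> \<int>"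
  using lat_crd_induct[OF frameD(1)[OF assms(1)] assms(2), of 1 b 1 b'] frame_parity[OF assms(1) _ assms(3,4)] by simp

section \<open>Squares and half sums\<close>

text \<open>
  All four corners of the parallelogram spanned at \<open>c\<close> by \<open>\<plusminus>a\<close> and \<open>\<plusminus>d\<close> are present.
\<close>
definition square :: "'v \<Rightarrow> real \<Rightarrow> 'v \<Rightarrow> real \<Rightarrow> 'v \<Rightarrow> bool" where
  "square c \<sigma> a \<epsilon> d \<longleftrightarrow> c \<in> A \<and> c \<notin> span (P \<union> J) \<and> \<bar>\<sigma>\<bar> = 1 \<and> \<bar>\<epsilon>\<bar> = 1 \<and>
     mem P (c + \<sigma> *s a) \<and> mem P (c + \<epsilon> *s d) \<and> mem P (c + \<sigma> *s a + \<epsilon> *s d)"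

lemma square_sym: "square c \<sigma> a \<epsilon> d \<Longrightarrow> square c \<epsilon> d \<sigma> a"
  unfolding square_def by (simp add: add.assoc add.commute[of "\<epsilon> *s d" "\<sigma> *s a"])

lemma square_corner:
  assumes "square c \<sigma> a \<epsilon> d" "i \<in> {0,1}" "k \<in> {0,1}"
  shows "\<exists>e\<in>A. e - (c + (i * \<sigma>) *s a + (k * \<epsilon>) *s d) \<in> span P"
proof -
  have "c - c \<in> span P" by (simp add: span_zero)
  then have "mem P c" using assms(1) unfolding square_def mem_def by metis
  then have "mem P (c + (i * \<sigma>) *s a + (k * \<epsilon>) *s d)" using assms unfolding square_def by auto
  then show ?thesis unfolding mem_def .
qed

text \<open>
  For vectors without coordinate at \<open>c\<close>, a square allows the coordinate at \<open>d\<close> to be added to, or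
  subtracted from, the coordinate at \<open>a\<close> without changing the volume. The sign \<open>\<alpha> = \<sigma>\<close> is obtained by exchanging the far corner for \<open>d\<close>, the
  opposite sign by exchanging the two neighbours of \<open>c\<close> for \<open>c\<close> and \<open>d\<close>.
\<close>
lemma square_pivot:
  assumes B: "basis B" "P \<subseteq> B" and m: "a \<in> B - P" "c \<in> B - P" "d \<in> B - P" "a \<noteq> c" "a \<noteq> d" "c \<noteq> d"
    and sq: "square c \<sigma> a \<epsilon> d" and al: "\<bar>\<alpha>\<bar> = 1"
  shows "\<exists>B2. basis B2 \<and> vol B2 = vol B \<and> B - {c,d} \<subseteq> B2 \<and>
    (\<forall>x\<in>span A. crd B x c = 0 \<longrightarrow> crd B2 x a = crd B x a - \<epsilon> * \<alpha> * crd B x d \<and>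
      (\<forall>b\<in>B - P - {a,c,d}. crd B2 x b = crd B x b))"
proof -
  note BD = basisD[OF B(1)]
  have sg: "\<bar>\<sigma>\<bar> = 1" "\<bar>\<epsilon>\<bar> = 1" and cA: "c \<in> A" using sq unfolding square_def by auto
  have e: "\<epsilon> \<noteq> 0" "x / \<epsilon> = \<epsilon> * x" for x using sg(2) by (auto simp: abs_if field_simps split: if_splits)
  have cs: "c \<in> span A" using cA by (rule A_span)
  consider "\<alpha> = \<sigma>" | "\<alpha> = - \<sigma>" using sg(1) al by linarith
  then show ?thesis
  proof cases
    case 1
    obtain y where y: "y \<in> A" "y - (c + \<sigma> *s a + \<epsilon> *s d) \<in> span P"
      using square_corner[OF sq, of 1 1] by auto
    have cy: "crd B y b = (if b = c then 1 else 0) + (if b = a then \<sigma> else 0) + (if b = d then \<epsilon> else 0)" if "b \<notin> P" for b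
      using crd_lift2[OF B _ _ y(2) cs A_span[OF y(1)] that] m B by (simp add: crd_self)
    have yd: "crd B y d = \<epsilon>" using cy[of d] m by auto
    then have nz: "crd B y d \<noteq> 0" using e by simp
    have dB: "d \<in> B" using m by auto
    note pv = pivot[OF B(1) dB y(1) nz]
    show ?thesis
    proof (intro exI conjI ballI impI)
      show "basis (insert y (B - {d}))" by (rule pv)
      show "vol (insert y (B - {d})) = vol B" using pv(3) yd sg by simp
      show "B - {c,d} \<subseteq> insert y (B - {d})" by auto
    next
      fix x assume x: "x \<in> span A" "crd B x c = 0"
      have aB: "a \<in> B - {d}" using m by auto
      show "crd (insert y (B - {d})) x a = crd B x a - \<epsilon> * \<alpha> * crd B x d"
        using pv(5)[OF x(1) aB] cy[of a] m yd e(2) 1 by (auto simp: algebra_simps)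
      fix b assume b: "b \<in> B - P - {a,c,d}"
      then have bB: "b \<in> B - {d}" by auto
      show "crd (insert y (B - {d})) x b = crd B x b"
        using pv(5)[OF x(1) bB] cy[of b] b by auto
    qed
  next
    case 2
    obtain y1 where y1: "y1 \<in> A" "y1 - (c + \<sigma> *s a) \<in> span P"
      using square_corner[OF sq, of 1 0] by auto
    obtain y where y: "y \<in> A" "y - (c + \<epsilon> *s d) \<in> span P"
      using square_corner[OF sq, of 0 1] by auto
    have aB0: "a \<in> B" and dB0: "d \<in> B" and cB: "c \<in> B" using m by auto
    have cy1: "crd B y1 b = (if b = c then 1 else 0) + (if b = a then \<sigma> else 0)" if "b \<notin> P" for b
      using crd_lift[OF B aB0 y1(2) cs A_span[OF y1(1)] that] m B by (simp add: crd_self)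
    have cy: "crd B y b = (if b = c then 1 else 0) + (if b = d then \<epsilon> else 0)" if "b \<notin> P" for b
      using crd_lift[OF B dB0 y(2) cs A_span[OF y(1)] that] m B by (simp add: crd_self)
    have y1c: "crd B y1 c = 1" using cy1[of c] m by auto
    then have nz: "crd B y1 c \<noteq> 0" by simp
    note pv = pivot[OF B(1) cB y1(1) nz]
    let ?B1 = "insert y1 (B - {c})"
    have dB: "d \<in> ?B1" "d \<in> B - {c}" and aB: "a \<in> B - {c}" using m by auto
    have B1a: "crd ?B1 x a = crd B x a - \<sigma> * crd B x c" if "x \<in> span A" for x
      using pv(5)[OF that aB] y1c cy1[of a] m by auto
    have B1b: "crd ?B1 x b = crd B x b" if "x \<in> span A" "b \<in> B - P - {a,c}" for x b
      using pv(5)[of x b] that y1c cy1[of b] by auto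
    have yd: "crd ?B1 y d = \<epsilon>" using B1b[OF A_span[OF y(1)], of d] cy[of d] m by auto
    have ya: "crd ?B1 y a = - \<sigma>" using B1a[OF A_span[OF y(1)]] cy[of a] cy[of c] m by auto
    have nz2: "crd ?B1 y d \<noteq> 0" using yd e by simp
    note pv2 = pivot[OF pv(1) dB(1) y(1) nz2]
    show ?thesis
    proof (intro exI conjI ballI impI)
      show "basis (insert y (?B1 - {d}))" by (rule pv2)
      show "vol (insert y (?B1 - {d})) = vol B" using pv2(3) pv(3) y1c yd sg by simp
      show "B - {c,d} \<subseteq> insert y (?B1 - {d})" by auto
    next
      fix x assume x: "x \<in> span A" "crd B x c = 0"
      have aB2: "a \<in> ?B1 - {d}" using m by auto
      have "crd ?B1 x d = crd B x d" using B1b[OF x(1), of d] m by auto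
      then show "crd (insert y (?B1 - {d})) x a = crd B x a - \<epsilon> * \<alpha> * crd B x d"
        using pv2(5)[OF x(1) aB2] ya yd e(2) 2 B1a[OF x(1)] x(2) by (simp add: algebra_simps)
      fix b assume b: "b \<in> B - P - {a,c,d}"
      then have bB: "b \<in> ?B1 - {d}" by auto
      have "crd ?B1 y b = 0" using B1b[OF A_span[OF y(1)], of b] cy[of b] b by auto
      then show "crd (insert y (?B1 - {d})) x b = crd B x b"
        using pv2(5)[OF x(1) bB] B1b[OF x(1), of b] b by auto
    qed
  qed
qed

text \<open>
  If \<open>x\<close> and \<open>y\<close> differ by an integral combination of \<open>J\<close> with odd part \<open>O \<noteq> {}\<close>, then
  \<open>x + y + \<Sum>(J - O)\<close> is even, so \<open>x\<close>, \<open>y\<close> and \<open>J - O\<close> form an odd circuit. Minimality of \<open>J\<close> gives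
  \<open>card J \<le> 2 + card (J - O)\<close>.
\<close>
lemma odd_support_le_2:
  assumes F: "frame B" and x: "x \<in> A" and y: "y \<in> A" and nx: "x \<notin> span (P \<union> J)"
    and off: "\<And>b. b \<in> B - P - J \<Longrightarrow> crd B x b = crd B y b"
    and phi: "\<And>b. b \<in> J \<Longrightarrow> crd B x b - crd B y b = of_int (\<phi> b)"
  shows "card {b\<in>J. odd (\<phi> b)} \<le> 2"
proof (cases "{b\<in>J. odd (\<phi> b)} = {}")
  case True then show ?thesis by (metis card.empty le0)
next
  case False
  note FD = frameD[OF F]
  let ?O = "{b\<in>J. odd (\<phi> b)}"
  obtain b0 where b0: "b0 \<in> ?O" using False by blast
  have "\<exists>b\<in>B - (P \<union> J). crd B x b \<noteq> 0"
    using crd_zero_span[OF FD(1) A_span[OF x], of "P \<union> J"] nx FD by auto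
  then obtain b1 where b1: "b1 \<in> B - P - J" "crd B x b1 \<noteq> 0" by auto
  have nz: "crd B y b1 \<noteq> 0" and b1B: "b1 \<in> B" using b1 off by auto
  note pv = pivot[OF FD(1) b1B y nz]
  let ?B1 = "insert y (B - {b1})"
  have r1: "crd B x b1 / crd B y b1 = 1" using off[OF b1(1)] nz by simp
  have xJ: "crd ?B1 x b = of_int (\<phi> b)" if "b \<in> J" for b
  proof -
    have "b \<in> B - {b1}" using that FD b1 by auto
    then show ?thesis using pv(5)[OF A_span[OF x]] r1 phi[OF that] by simp
  qed
  have xy: "crd ?B1 x y = 1" using pv(4)[OF A_span[OF x]] r1 by simp
  have xo: "crd ?B1 x b = 0" if "b \<in> ?B1 - P - insert y J" for b
  proof -
    have "b \<in> B - {b1}" "b \<in> B - P - J" using that by auto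
    then show ?thesis using pv(5)[OF A_span[OF x], of b] r1 off[of b] by simp
  qed
  have sub: "P \<subseteq> ?B1" "J \<subseteq> ?B1" using FD b1 by auto
  have yPJ: "y \<notin> P" "y \<notin> J" using pv(2) FD b1 by auto
  have PJ: "P \<inter> J = {}" using J_props by auto
  have F1: "insert y J \<subseteq> ?B1" "insert y J \<inter> P = {}" using sub yPJ PJ by auto
  have fin: "finite J" using J_props by auto
  have "x - (\<Sum>f\<in>insert y J. crd ?B1 x f *s f) \<in> span P"
    by (rule crd_decomp[OF pv(1) sub(1) A_span[OF x] F1 xo])
  also have "(\<Sum>f\<in>insert y J. crd ?B1 x f *s f) = y + (\<Sum>b\<in>J. of_int (\<phi> b) *s b)"
    using fin yPJ xy xJ by simp
  finally have "evn P (x + x - (x - (y + (\<Sum>b\<in>J. of_int (\<phi> b) *s b))) - (x + x) - (y + y))"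
    using lat_A[OF x] lat_A[OF y] by (intro evn_diff evn_double evn_span)
  then have e1: "evn P (- x - y + (\<Sum>b\<in>J. of_int (\<phi> b) *s b))" by (simp add: algebra_simps)
  have "J \<subseteq> lat" using J_props lat_A by auto
  from evn_odd_part[OF fin this e1] have "evn P (\<Sum>J - (- x - y + \<Sum>?O))" by (intro evn_diff J_props)
  also have "\<Sum>J - (- x - y + \<Sum>?O) = x + y + (\<Sum>J - \<Sum>?O)" by (simp add: algebra_simps)
  also have "\<Sum>J - \<Sum>?O = \<Sum>(J - ?O)" using fin by (subst sum_diff) auto
  finally have ev: "evn P (x + y + \<Sum>(J - ?O))" .
  have b0B: "b0 \<in> ?B1" and nz0: "crd ?B1 x b0 \<noteq> 0" using b0 sub xJ[of b0] by (auto intro: ccontr)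
  note pv2 = pivot[OF pv(1) b0B x nz0]
  have b0J: "b0 \<in> J" "b0 \<noteq> y" "b0 \<notin> P" using b0 yPJ PJ by auto
  have xn: "x \<noteq> y" "x \<notin> P" "x \<notin> J - ?O" using pv2(2) b0J b0 sub PJ by auto
  let ?Q = "insert x (insert y (J - ?O))"
  have "\<Sum>?Q = x + y + \<Sum>(J - ?O)" using xn yPJ fin by (simp add: add.assoc)
  moreover have "?Q \<subseteq> insert x (?B1 - {b0})" "P \<subseteq> insert x (?B1 - {b0})" using sub b0 b0J by auto
  ultimately have "odd_circuit P ?Q" using ev xn yPJ PJ by (intro odd_circuitI[OF pv2(1)]) auto
  moreover have "card ?Q = 2 + card (J - ?O)" using xn yPJ fin by simp
  ultimately have "card J \<le> 2 + card (J - ?O)" using shortest[of ?Q] by simp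
  moreover have "card (J - ?O) = card J - card ?O" using fin by (intro card_Diff_subset) auto
  moreover have "card ?O \<le> card J" using fin by (intro card_mono) auto
  ultimately show ?thesis by linarith
qed

text \<open>
  The half sums of \<open>J\<close> with signs \<open>\<eta>\<close>; all of them are congruent to lattice vectors, but they need not
  be congruent to elements of \<open>A\<close>.
\<close>
definition half :: "('v \<Rightarrow> real) \<Rightarrow> 'v" where "half \<eta> = (\<Sum>b\<in>J. (\<eta> b / 2) *s b)"

lemma half_span: "half \<eta> \<in> span A"
  unfolding half_def using J_props by (intro span_sum span_scale span_base) auto

lemma crd_half:
  assumes "frame B" shows "crd B (half \<eta>) b = (if b \<in> J then \<eta> b / 2 else 0)"
proof -
  note FD = frameD[OF assms]
  have "crd B (half \<eta>) b = (\<Sum>c\<in>J. crd B ((\<eta> c / 2) *s c) b)" unfolding half_def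
    using J_props by (intro crd_sum FD) (auto intro: span_scale span_base)
  also have "\<dots> = (\<Sum>c\<in>J. if c = b then \<eta> c / 2 else 0)"
    using J_props FD by (intro sum.cong) (auto simp: crd_scale A_span crd_self subset_iff)
  finally show ?thesis using J_props by auto
qed

text \<open>
  The far corner of the second square has coordinates \<open>\<plusminus>1\<close> at \<open>a\<close> and \<open>d\<close>. Along the first square it
  can be sheared to coordinate \<open>\<plusminus>2\<close> at \<open>a\<close>, in a basis of volume \<open>2\<close>.
\<close>
lemma squares_same_direction:
  assumes sq: "square c \<sigma> a \<epsilon> d" "square c' \<sigma>' a \<epsilon>' d" and ad: "a \<in> J" "d \<in> J" "a \<noteq> d"
    and ind: "c' \<notin> span (P \<union> J \<union> {c})"
  shows False
proof -
  have A: "c \<in> A" "c' \<in> A" "c \<notin> span (P \<union> J)" and sg: "\<bar>\<epsilon>\<bar> = 1" "\<bar>\<sigma>'\<bar> = 1" "\<bar>\<epsilon>'\<bar> = 1"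
    using sq unfolding square_def by auto
  obtain B where F: "frame B" "c \<in> B" "c' \<in> B" and cn: "c \<notin> P \<union> J" "c' \<notin> P \<union> J" "c' \<noteq> c"
    using frame_insert2[OF A(1,3,2) ind] by blast
  note FD = frameD[OF F(1)]
  have JP: "a \<notin> P" "d \<notin> P" using ad J_props by auto
  obtain y where y: "y \<in> A" "y - (c' + \<sigma>' *s a + \<epsilon>' *s d) \<in> span P"
    using square_corner[OF sq(2), of 1 1] by auto
  have cy: "crd B y b = (if b = c' then 1 else 0) + (if b = a then \<sigma>' else 0) + (if b = d then \<epsilon>' else 0)" if "b \<notin> P" for b
    using crd_lift2[OF FD(1,2) subsetD[OF FD(3) ad(1)] subsetD[OF FD(3) ad(2)] y(2) A_span[OF A(2)] A_span[OF y(1)] that]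
      F crd_self[OF FD(1), of c' b] by simp
  define \<alpha> where "\<alpha> = - \<epsilon> * \<epsilon>' * \<sigma>'"
  have al: "\<bar>\<alpha>\<bar> = 1" unfolding \<alpha>_def using sg by (simp add: abs_mult)
  have m: "a \<in> B - P" "c \<in> B - P" "d \<in> B - P" "a \<noteq> c" "c \<noteq> d" using F FD ad JP cn by auto
  obtain B2 where B2: "basis B2" "vol B2 = vol B" "B - {c,d} \<subseteq> B2" 
    "\<And>x. x \<in> span A \<Longrightarrow> crd B x c = 0 \<Longrightarrow> crd B2 x a = crd B x a - \<epsilon> * \<alpha> * crd B x d"
    using square_pivot[OF FD(1,2) m(1-4) ad(3) m(5) sq(1) al] by blast
  have "crd B y c = 0" using cy[of c] cn ad by auto
  then have "crd B2 y a = \<sigma>' - \<epsilon> * \<alpha> * \<epsilon>'" using B2(4)[OF A_span[OF y(1)]] cy[of a] cy[of d] JP cn ad by auto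
  also have "\<dots> = \<sigma>' + (\<epsilon> * \<epsilon>) * (\<epsilon>' * \<epsilon>') * \<sigma>'" unfolding \<alpha>_def by (simp add: algebra_simps)
  finally have "crd B2 y a = \<sigma>' + (\<epsilon> * \<epsilon>) * (\<epsilon>' * \<epsilon>') * \<sigma>'" .
  moreover have "\<epsilon> * \<epsilon> = 1" "\<epsilon>' * \<epsilon>' = 1" using sg by (metis abs_mult_self_eq mult_1)+
  ultimately have "crd B2 y a = 2 * \<sigma>'" by simp
  moreover have "vol B2 * \<bar>crd B2 y a\<bar> \<le> 2" using B2(3) m ad by (intro vol_crd_le B2 y) auto
  ultimately show False using B2(2) FD(4) sg by (simp add: abs_mult)
qed

text \<open>
  If \<open>c\<close> and \<open>c'\<close> are independent modulo \<open>span (P \<union> J)\<close>, the half sum can be sheared along both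
  squares to coordinate \<open>\<plusminus>3/2\<close> at \<open>a\<close>, contradicting volume \<open>2\<close>. If they are dependent, suitable corners of
  the two squares differ by a combination of \<open>J\<close> that is odd at \<open>a\<close>, \<open>d\<close> and \<open>d'\<close>.
\<close>
lemma half_squares:
  assumes sq: "square c \<sigma> a \<epsilon> d" "square c' \<sigma>' a \<epsilon>' d'" and ad: "a \<in> J" "d \<in> J" "d' \<in> J" "a \<noteq> d" "a \<noteq> d'" "d \<noteq> d'"
    and eta: "\<And>b. b \<in> J \<Longrightarrow> \<bar>\<eta> b\<bar> = 1" "mem P (half \<eta>)"
  shows False
proof -
  have A: "c \<in> A" "c' \<in> A" "c \<notin> span (P \<union> J)" "c' \<notin> span (P \<union> J)"
    and sg: "\<bar>\<sigma>\<bar> = 1" "\<bar>\<epsilon>\<bar> = 1" "\<bar>\<sigma>'\<bar> = 1" "\<bar>\<epsilon>'\<bar> = 1"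
    using sq unfolding square_def by auto
  have JP: "a \<notin> P" "d \<notin> P" "d' \<notin> P" using ad J_props by auto
  have cn: "c \<notin> P \<union> J" "c' \<notin> P \<union> J" using A(3,4) span_base[of c "P \<union> J"] span_base[of c' "P \<union> J"] by auto
  show False
  proof (cases "c' \<in> span (P \<union> J \<union> {c})")
    case False
    then obtain B where F: "frame B" "c \<in> B" "c' \<in> B" and cc: "c' \<noteq> c" using frame_insert2[OF A(1,3,2)] by blast
    note FD = frameD[OF F(1)]
    obtain y where y: "y \<in> A" "y - half \<eta> \<in> span P" using eta(2) unfolding mem_def by auto
    have cy: "crd B y b = (if b \<in> J then \<eta> b / 2 else 0)" if "b \<notin> P" for b
      using crd_cong[OF FD(1,2) y(2) A_span[OF y(1)] half_span that] crd_half[OF F(1)] by simp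
    define \<alpha> where "\<alpha> = - \<epsilon> * \<eta> d * \<eta> a"
    define \<alpha>' where "\<alpha>' = - \<epsilon>' * \<eta> d' * \<eta> a"
    have al: "\<bar>\<alpha>\<bar> = 1" "\<bar>\<alpha>'\<bar> = 1" unfolding \<alpha>_def \<alpha>'_def using sg eta(1) ad by (simp_all add: abs_mult)
    have m: "a \<in> B - P" "c \<in> B - P" "d \<in> B - P" "a \<noteq> c" "c \<noteq> d" using F FD ad JP cn by auto
    obtain B2 where B2: "basis B2" "vol B2 = vol B" "B - {c,d} \<subseteq> B2" 
      "\<And>x. x \<in> span A \<Longrightarrow> crd B x c = 0 \<Longrightarrow> crd B2 x a = crd B x a - \<epsilon> * \<alpha> * crd B x d"
      "\<And>x b. x \<in> span A \<Longrightarrow> crd B x c = 0 \<Longrightarrow> b \<in> B - P - {a,c,d} \<Longrightarrow> crd B2 x b = crd B x b"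
      using square_pivot[OF FD(1,2) m(1-4) ad(4) m(5) sq(1) al(1)] by blast
    have yc: "crd B y c = 0" using cy[of c] cn by auto
    note ys = A_span[OF y(1)]
    have ya: "crd B2 y a = \<eta> a / 2 - \<epsilon> * \<alpha> * (\<eta> d / 2)" using B2(4)[OF ys yc] cy[of a] cy[of d] JP ad by auto
    have yd: "crd B2 y d' = \<eta> d' / 2" using B2(5)[OF ys yc, of d'] cy[of d'] JP ad cn FD by auto
    have yc': "crd B2 y c' = 0" using B2(5)[OF ys yc, of c'] cy[of c'] F cn cc ad by auto
    have P2: "P \<subseteq> B2" using B2(3) FD(2) cn JP by auto
    have m2: "a \<in> B2 - P" "c' \<in> B2 - P" "d' \<in> B2 - P" "a \<noteq> c'" "c' \<noteq> d'" using B2(3) F FD ad JP cn cc by auto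
    obtain B3 where B3: "basis B3" "vol B3 = vol B2" "B2 - {c',d'} \<subseteq> B3" 
      "\<And>x. x \<in> span A \<Longrightarrow> crd B2 x c' = 0 \<Longrightarrow> crd B3 x a = crd B2 x a - \<epsilon>' * \<alpha>' * crd B2 x d'"
      using square_pivot[OF B2(1) P2 m2(1-4) ad(5) m2(5) sq(2) al(2)] by blast
    have "crd B3 y a = \<eta> a / 2 - \<epsilon> * \<alpha> * (\<eta> d / 2) - \<epsilon>' * \<alpha>' * (\<eta> d' / 2)"
      using B3(4)[OF ys yc'] ya yd by simp
    also have "\<dots> = \<eta> a / 2 * (1 + (\<epsilon> * \<epsilon>) * (\<eta> d * \<eta> d) + (\<epsilon>' * \<epsilon>') * (\<eta> d' * \<eta> d'))"
      unfolding \<alpha>_def \<alpha>'_def by (simp add: algebra_simps)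
    finally have "crd B3 y a = \<eta> a / 2 * (1 + (\<epsilon> * \<epsilon>) * (\<eta> d * \<eta> d) + (\<epsilon>' * \<epsilon>') * (\<eta> d' * \<eta> d'))" .
    moreover have "\<epsilon> * \<epsilon> = 1" "\<epsilon>' * \<epsilon>' = 1" "\<eta> d * \<eta> d = 1" "\<eta> d' * \<eta> d' = 1"
      using sg eta(1) ad by (metis abs_mult_self_eq mult_1)+
    ultimately have "crd B3 y a = 3 / 2 * \<eta> a" by simp
    moreover have "vol B3 * \<bar>crd B3 y a\<bar> \<le> 2" using B3(3) m2 ad by (intro vol_crd_le B3 y) auto
    ultimately show False using B2(2) B3(2) FD(4) eta(1)[OF ad(1)] by (simp add: abs_mult)
  next
    case True
    obtain B where F: "frame B" "c \<in> B" using frame_insert[OF A(1,3)] by blast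
    note FD = frameD[OF F(1)]
    have cB: "c \<in> B" using F by auto
    have z: "crd B c' b = 0" if "b \<notin> P \<union> J \<union> {c}" for b
      using crd_span[OF FD(1) _ True that] F FD by auto
    define l where "l = crd B c' c"
    have "l \<noteq> 0"
    proof
      assume "l = 0"
      then have "crd B c' b = 0" if "b \<notin> P \<union> J" for b
        using z[of b] that unfolding l_def by (cases "b = c") auto
      then have "c' \<in> span (P \<union> J)" using FD
        by (intro crd_zero_span[OF FD(1) A_span[OF A(2)]]) auto
      then show False using A by simp
    qed
    then have l: "\<bar>l\<bar> = 1" using frame_off[OF F(1) cB _ _ A(2)] cn unfolding l_def by auto
    have aB: "a \<in> B" using FD ad by auto
    have bnd: "\<bar>crd B x a\<bar> \<le> 1 \<and> \<bar>crd B x a - \<sigma> * crd B x c\<bar> \<le> 1" if "x \<in> A" for x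
      using shear_bound[OF FD(1,2) aB JP(1), of "{}" "\<lambda>_. \<sigma>" x] shear_bound[OF FD(1,2) aB JP(1), of "{c}" "\<lambda>_. \<sigma>" x]
        that cB cn ad sq(1) FD(4) unfolding square_def by auto
    obtain c1 where c1: "c1 \<in> A" "c1 - (c' + \<sigma>' *s a) \<in> span P" using square_corner[OF sq(2), of 1 0] by auto
    have cc1: "crd B c1 b = crd B c' b + (if b = a then \<sigma>' else 0)" if "b \<notin> P" for b
      using crd_lift[OF FD(1,2) aB c1(2) A_span[OF A(2)] A_span[OF c1(1)] that] .
    have "crd B c1 a = crd B c' a + \<sigma>'" "crd B c1 c = l" using cc1[of a] cc1[of c] JP cn ad unfolding l_def by auto
    then have "\<bar>crd B c' a\<bar> \<le> 1" "\<bar>crd B c' a - \<sigma> * l\<bar> \<le> 1" "\<bar>crd B c' a + \<sigma>'\<bar> \<le> 1" "\<bar>crd B c' a + \<sigma>' - \<sigma> * l\<bar> \<le> 1"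
      using bnd[OF A(2)] bnd[OF c1(1)] unfolding l_def by auto
    moreover have "\<bar>\<sigma> * l\<bar> = 1" using sg l by (simp add: abs_mult)
    ultimately have "crd B c' a = 0 \<or> crd B c' a = 1 \<or> crd B c' a = -1" using sg(3) by linarith
    then have ia: "crd B c' a \<in> \<int>" by auto
    have iJ: "crd B c' b \<in> \<int>" if "b \<in> J" for b
      using Ints_add[OF frame_parity[OF F(1) A(2) that ad(1)] ia] by simp
    define n where "n b = \<lfloor>crd B c' b\<rfloor>" for b
    have n: "crd B c' b = of_int (n b)" if "b \<in> J" for b using iJ[OF that] unfolding n_def by (auto elim: Ints_cases)
    define s' e' el where "s' = \<lfloor>\<sigma>'\<rfloor>" and "e' = \<lfloor>\<epsilon>'\<rfloor>" and "el = \<lfloor>\<epsilon> * l\<rfloor>"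
    have si: "\<sigma>' = of_int s'" "\<epsilon>' = of_int e'" "\<epsilon> * l = of_int el" "odd s'" "odd e'" "odd el"
      unfolding s'_def e'_def el_def using abs_eq_1_floor[of \<sigma>'] abs_eq_1_floor[of \<epsilon>'] abs_eq_1_floor[of "\<epsilon> * l"] sg l by (simp_all add: abs_mult)
    \<comment> \<open>the corners are chosen such that the coefficients at \<open>a\<close>, \<open>d'\<close> and \<open>d\<close> become odd\<close>
    define i where "i = (if odd (n a) then 0 else 1 :: int)"
    define k where "k = (if odd (n d') then 0 else 1 :: int)"
    define h where "h = (if odd (n d) then 0 else 1 :: int)"
    have ikh: "of_int i \<in> {0,1::real}" "of_int k \<in> {0,1::real}" "of_int h \<in> {0,1::real}"
      unfolding i_def k_def h_def by auto
    obtain e where e: "e \<in> A" "e - (c' + (of_int i * \<sigma>') *s a + (of_int k * \<epsilon>') *s d') \<in> span P"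
      using square_corner[OF sq(2) ikh(1,2)] by blast
    obtain g where g: "g \<in> A" "g - (c + 0 *s a + (of_int h * \<epsilon>) *s d) \<in> span P"
      using square_corner[OF sq(1) _ ikh(3), of 0] by auto
    have dB: "d \<in> B" "d' \<in> B" using FD ad by auto
    have ce: "crd B e b = crd B c' b + (if b = a then of_int i * \<sigma>' else 0) + (if b = d' then of_int k * \<epsilon>' else 0)" if "b \<notin> P" for b
      using crd_lift2[OF FD(1,2) aB dB(2) e(2) A_span[OF A(2)] A_span[OF e(1)] that] .
    have cg: "crd B g b = (if b = c then 1 else 0) + (if b = d then of_int h * \<epsilon> else 0)" if "b \<notin> P" for b
      using crd_lift2[OF FD(1,2) aB dB(1) g(2) A_span[OF A(1)] A_span[OF g(1)] that] crd_self[OF FD(1) cB, of b] by simp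
    have lg: "l *s g \<in> A" using sign_A[OF g(1) l] .
    have clg: "crd B (l *s g) b = l * crd B g b" for b using crd_scale(1)[OF FD(1) A_span[OF g(1)]] .
    define \<phi> where "\<phi> b = n b + (if b = a then i * s' else 0) + (if b = d' then k * e' else 0) - (if b = d then h * el else 0)" for b
    have "card {b\<in>J. odd (\<phi> b)} \<le> 2"
    proof (rule odd_support_le_2[OF F(1) e(1) lg])
      have "crd B e c \<noteq> 0" using ce[of c] cn ad l unfolding l_def by auto
      then show "e \<notin> span (P \<union> J)" using crd_span[OF FD(1), of "P \<union> J" e c] cn FD by auto
    next
      fix b assume b: "b \<in> B - P - J"
      show "crd B e b = crd B (l *s g) b"
        using b ce[of b] cg[of b] clg[of b] z[of b] ad unfolding l_def by auto
    next
      fix b assume b: "b \<in> J"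
      then have bP: "b \<notin> P" "b \<noteq> c" using J_props cn by auto
      have "crd B (l *s g) b = (if b = d then of_int (h * el) else 0)"
        using clg[of b] cg[OF bP(1)] bP si(3) by (auto simp: algebra_simps)
      then show "crd B e b - crd B (l *s g) b = of_int (\<phi> b)"
        unfolding \<phi>_def ce[OF bP(1)] n[OF b] si(1,2) by auto
    qed
    moreover have "{a, d, d'} \<subseteq> {b\<in>J. odd (\<phi> b)}"
      using ad si unfolding \<phi>_def i_def k_def h_def by auto
    moreover have "card {a, d, d'} = 3" using ad by simp
    moreover have "finite {b\<in>J. odd (\<phi> b)}" using J_props by auto
    ultimately show False using card_mono[of "{b\<in>J. odd (\<phi> b)}" "{a,d,d'}"] by simp
  qed
qed

end

context shortest_odd_circuit begin

text \<open>
  Modulo \<open>2\<close> the element \<open>y\<close> is the sum of the elements with odd coefficient, and because the sum of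
  \<open>J\<close> is even, also the sum of those with even coefficient.
\<close>
lemma pure_complement:
  assumes F: "frame B" and y: "y \<in> A" and off: "\<And>b. b \<in> B - P - J \<Longrightarrow> crd B y b = 0"
    and n: "\<And>b. b \<in> J \<Longrightarrow> crd B y b = of_int (n b)" and d: "d \<in> J" "odd (n d)"
  shows "odd_circuit P (insert y {b\<in>J. even (n b)})" "y \<notin> {b\<in>J. even (n b)}"
proof -
  note FD = frameD[OF F]
  let ?O = "{b\<in>J. odd (n b)}" and ?E = "{b\<in>J. even (n b)}"
  have fin: "finite J" and JA: "J \<subseteq> A" and PJ: "P \<inter> J = {}" using J_props by auto
  have dB: "d \<in> B" and nz: "crd B y d \<noteq> 0" using d FD n[OF d(1)] by (auto intro: ccontr)
  note pv = pivot[OF FD(1) dB y nz]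
  have "y - (\<Sum>b\<in>J. crd B y b *s b) \<in> span P"
    using J_props FD off by (intro crd_decomp[OF FD(1,2) A_span[OF y]]) auto
  then have e1: "evn P (y - (\<Sum>b\<in>J. of_int (n b) *s b))" using n by (intro evn_span) simp
  have e2: "evn P (- y + (\<Sum>b\<in>J. of_int (n b) *s b))" using evn_uminus[OF e1] by simp
  have "J \<subseteq> lat" using JA lat_A by auto
  from evn_odd_part[OF fin this e2] have "evn P (\<Sum>J - (- y + \<Sum>?O))" by (intro evn_diff J_props)
  also have "\<Sum>J - (- y + \<Sum>?O) = y + (\<Sum>J - \<Sum>?O)" by (simp add: algebra_simps)
  also have "\<Sum>J - \<Sum>?O = \<Sum>(J - ?O)" using fin by (subst sum_diff) auto
  also have "J - ?O = ?E" by auto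
  finally have ev: "evn P (y + \<Sum>?E)" .
  show yE: "y \<notin> ?E" using pv(2) FD d by auto
  have yP: "y \<notin> P" using pv(2) FD d PJ by auto
  have "d \<notin> P" using d PJ by auto
  then show "odd_circuit P (insert y ?E)"
    using ev yE yP PJ FD fin d by (intro odd_circuitI[OF pv(1)]) auto
qed

definition partners :: "'v \<Rightarrow> 'v set" where
  "partners a = {d \<in> J - {a}. \<exists>c \<sigma> \<epsilon>. square c \<sigma> a \<epsilon> d}"

lemma partners_sym: "a \<in> J \<Longrightarrow> d \<in> partners a \<Longrightarrow> a \<in> partners d"
  unfolding partners_def using square_sym by blast

lemma partners_half:
  assumes "a \<in> J" "\<And>b. b \<in> J \<Longrightarrow> \<bar>\<eta> b\<bar> = 1" "mem P (half \<eta>)" shows "card (partners a) \<le> 1"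
proof -
  have "d = d'" if dd: "d \<in> partners a" "d' \<in> partners a" for d d'
  proof (rule ccontr)
    assume ne: "d \<noteq> d'"
    obtain c \<sigma> \<epsilon> c' \<sigma>' \<epsilon>' where "square c \<sigma> a \<epsilon> d" "square c' \<sigma>' a \<epsilon>' d'" "d \<in> J" "d' \<in> J" "a \<noteq> d" "a \<noteq> d'"
      using dd unfolding partners_def by blast
    then show False using half_squares[of c \<sigma> a \<epsilon> d c' \<sigma>' \<epsilon>' d' \<eta>] assms ne by blast
  qed
  then have "card (partners a) \<le> Suc 0"
    using J_props by (subst card_le_Suc0_iff_eq) (auto simp: partners_def)
  then show ?thesis by simp
qed

text \<open>
  Having a partner is symmetric and, in the presence of a half sum, partners are unique; so
  partnership would be a perfect matching of three points.
\<close>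
lemma three_without_partner:
  assumes "card J = 3" "\<And>b. b \<in> J \<Longrightarrow> \<bar>\<eta> b\<bar> = 1" "mem P (half \<eta>)"
  shows "\<exists>a\<in>J. partners a = {}"
proof (rule ccontr)
  assume "\<not> ?thesis"
  then have ne: "\<And>a. a \<in> J \<Longrightarrow> partners a \<noteq> {}" by auto
  have PJ: "partners a \<subseteq> J - {a}" for a unfolding partners_def by auto
  have uniq: "d = d'" if "a \<in> J" "d \<in> partners a" "d' \<in> partners a" for a d d'
  proof -
    have "finite (partners a)" using PJ J_props finite_subset by (metis finite_Diff)
    then show ?thesis using partners_half[OF that(1) assms(2,3)] that card_le_Suc0_iff_eq by auto
  qed
  from assms(1) obtain x y z where J: "J = {x,y,z}" "x \<noteq> y" "x \<noteq> z" "y \<noteq> z" by (auto simp: card_3_iff)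
  obtain d where d: "d \<in> partners x" using ne[of x] J by auto
  then have dJ: "d \<in> J" "d \<noteq> x" using PJ by blast+
  have xd: "x \<in> partners d" using partners_sym[of x d] d J by auto
  obtain w where w: "w \<in> J" "w \<noteq> x" "w \<noteq> d" using J dJ by auto
  obtain v where v: "v \<in> partners w" using ne[OF w(1)] by auto
  then have wv: "w \<in> partners v" "v \<in> J" "v \<noteq> w" using partners_sym[OF w(1)] PJ by blast+
  then have "v = x \<or> v = d" using J dJ w by auto
  then show False
  proof
    assume "v = x"
    then show False using uniq[of x d w] d wv w J by auto
  next
    assume "v = d"
    then show False using uniq[of d x w] xd wv w dJ by auto
  qed
qed

end

section \<open>Counting doubled elements over a shortest odd circuit\<close>

text \<open>
  A set \<open>S\<close> of elements doubled along \<open>a \<in> J\<close>, written in a frame \<open>B\<close> that contains a maximal part \<open>C\<close> of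
  \<open>S\<close> independent modulo \<open>P \<union> J\<close>. The remaining elements of \<open>S\<close> are sorted by their
  coordinates: those with a \<open>C\<close>-coordinate, and the pure ones, which are supported on \<open>J\<close> and are
  either half-integral or integral there.
\<close>
locale odd_doubles = shortest_odd_circuit scale A vol P J
  for scale :: "real \<Rightarrow> 'v::ab_group_add \<Rightarrow> 'v" (infixr \<open>*s\<close> 75) and A vol P J +
  fixes a :: 'v and S B C :: "'v set"
  assumes a_J: "a \<in> J" and red: "reduced (insert a P) S" and dbl: "s \<in> S \<Longrightarrow> double P a s"
    and frB: "frame B" and C_S: "C \<subseteq> S" and C_B: "C \<subseteq> B" and C_PJ: "C \<inter> (P \<union> J) = {}"
    and off: "x \<in> S \<Longrightarrow> b \<in> B - P - J - C \<Longrightarrow> crd B x b = 0"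
begin

lemmas FD = frameD[OF frB]

lemma S_A: "S \<subseteq> A" using red unfolding reduced_def by auto

lemma a_props: "a \<in> B" "a \<notin> P" "insert a P \<subseteq> B" "a \<notin> C" using a_J FD J_props C_PJ by auto

lemma C_props: "c \<in> C \<Longrightarrow> c \<in> A \<and> c \<in> B \<and> c \<notin> P \<and> c \<notin> J \<and> c \<in> S"
  using C_S S_A C_B C_PJ by auto

lemma lift:
  assumes "x \<in> S"
  obtains t x' where "\<bar>t\<bar> = 1" "x' \<in> A" "\<And>b. b \<notin> P \<Longrightarrow> crd B x' b = crd B x b + (if b = a then t else 0)"
proof -
  from dbl[OF assms] obtain t x' where t: "t \<in> {1,-1}" "x' \<in> A" "x' - (x + t *s a) \<in> span P"
    unfolding double_def mem_def by blast
  show ?thesis using that[of t x'] t crd_lift[OF FD(1,2) a_props(1) t(3)] assms S_A A_span by auto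
qed

text \<open>
  In volume \<open>2\<close> the width bound leaves only \<open>1\<close> for all coordinates along \<open>C\<close> together.
\<close>
lemma single_coordinate:
  assumes "x \<in> S" "c \<in> C" "crd B x c \<noteq> 0"
  shows "\<bar>crd B x c\<bar> = 1" "\<And>c'. c' \<in> C \<Longrightarrow> c' \<noteq> c \<Longrightarrow> crd B x c' = 0"
proof -
  have xA: "x \<in> A" using assms S_A by auto
  show one: "\<bar>crd B x c\<bar> = 1" using frame_off[OF frB _ _ _ xA, of c] C_props[OF assms(2)] assms(3) by auto
  have fin: "finite C" using C_B FD(6) by (rule finite_subset)
  have "vol B * (1 + (\<Sum>c\<in>C. \<bar>crd B x c\<bar>)) \<le> 4"
    using C_PJ C_S by (intro doubled_width[OF FD(1,2) a_props(1,2) C_B _ a_props(4)] dbl assms) auto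
  then have w: "(\<Sum>c\<in>C. \<bar>crd B x c\<bar>) \<le> 1" using FD by simp
  show "crd B x c' = 0" if "c' \<in> C" "c' \<noteq> c" for c'
    using sum_abs_le_1[of C c "crd B x" c'] fin assms(2) one w that by auto
qed

lemma bound_a: "y \<in> A \<Longrightarrow> \<bar>crd B y a\<bar> \<le> 1"
  using vol_crd_le[OF FD(1) a_props(1)] FD(4) by fastforce

lemma bound_ac: "y \<in> A \<Longrightarrow> c \<in> C \<Longrightarrow> mem P (c + \<sigma> *s a) \<Longrightarrow> \<bar>crd B y a - \<sigma> * crd B y c\<bar> \<le> 1"
  using shear_bound[OF FD(1,2) a_props(1,2), of "{c}" "\<lambda>_. \<sigma>" y] C_props[of c] a_props(4) FD(4) by auto

lemma integral_J:
  assumes "x \<in> A" "crd B x a \<in> \<int>" "b \<in> J"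
  shows "crd B x b \<in> \<int>" "crd B x b \<noteq> 0 \<Longrightarrow> \<bar>crd B x b\<bar> = 1"
proof -
  show i: "crd B x b \<in> \<int>" using Ints_add[OF frame_parity[OF frB assms(1,3) a_J] assms(2)] by simp
  show "\<bar>crd B x b\<bar> = 1" if "crd B x b \<noteq> 0"
    using frame_J[OF frB subsetD[OF FD(3) assms(3)] assms(1)] that i by (auto elim!: Ints_cases)
qed

lemma pure_off:
  assumes "x \<in> S" "\<And>c. c \<in> C \<Longrightarrow> crd B x c = 0" "b \<in> B - P - J" shows "crd B x b = 0"
  using assms off by (cases "b \<in> C") auto

text \<open>
  The element \<open>x\<close> is \<open>\<plusminus>c\<close> plus a combination of \<open>J\<close>. Since \<open>c\<close> and \<open>x\<close> are both doubled, the two bounds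
  on the coordinate at \<open>a\<close> force it to be \<open>0\<close> and \<open>\<plusminus>1\<close> at \<open>x\<close> and its companion. The companion with
  \<open>\<plusminus>1\<close> differs from \<open>\<plusminus>c\<close> by a combination with odd part of size at most \<open>2\<close>, one of whose elements is
  \<open>a\<close>; the other one is \<open>d\<close>, and the elements \<open>c\<close>, \<open>x\<close> and their companions are a square.
\<close>
lemma excess:
  assumes x: "x \<in> S" "x \<notin> C" and c: "c \<in> C" "crd B x c \<noteq> 0"
  shows "\<exists>d\<in>J - {a}. \<exists>\<sigma>. square c \<sigma> a (crd B x c * crd B x d) d \<and> \<bar>crd B x d\<bar> = 1 \<and> (\<forall>b\<in>J - {a,d}. crd B x b = 0)"
proof -
  have xA: "x \<in> A" using x S_A by auto
  define l where "l = crd B x c"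
  have l: "\<bar>l\<bar> = 1" "l * l = 1" using single_coordinate(1)[OF x(1) c] unfolding l_def by (auto simp: abs_if split: if_splits)
  note cp = C_props[OF c(1)]
  have ac: "a \<noteq> c" using a_props c by auto
  from dbl[of c] cp obtain s where s: "s \<in> {1,-1}" "mem P (c + s *s a)" unfolding double_def by blast
  obtain t x' where x': "\<bar>t\<bar> = 1" "x' \<in> A" "\<And>b. b \<notin> P \<Longrightarrow> crd B x' b = crd B x b + (if b = a then t else 0)"
    using lift[OF x(1)] by blast
  have x'a: "crd B x' a = crd B x a + t" "crd B x' c = l" using x'(3)[of a] x'(3)[of c] a_props cp ac unfolding l_def by auto
  have b: "\<bar>crd B x a\<bar> \<le> 1" "\<bar>crd B x a + t\<bar> \<le> 1" "\<bar>crd B x a - s * l\<bar> \<le> 1" "\<bar>crd B x a + t - s * l\<bar> \<le> 1"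
    using bound_a[OF xA] bound_a[OF x'(2)] bound_ac[OF xA c(1) s(2)] bound_ac[OF x'(2) c(1) s(2)] x'a unfolding l_def by auto
  define \<mu> where "\<mu> = s * l"
  have mu: "\<mu> = 1 \<or> \<mu> = -1" "l * \<mu> = s" using s l unfolding \<mu>_def by (auto simp: abs_if split: if_splits)
  \<comment> \<open>the coordinate moves by \<open>t\<close> in one direction and by \<open>- \<mu>\<close> in the other and must stay within
    \<open>-1\<close> and \<open>1\<close> throughout\<close>
  have vals: "(crd B x a = 0 \<and> t = \<mu>) \<or> (crd B x a = \<mu> \<and> t = - \<mu>)"
    using b x'(1) mu(1) unfolding \<mu>_def[symmetric] by linarith
  have ia: "crd B x a \<in> \<int>" using vals mu by auto
  note iJ = integral_J(1)[OF xA ia] and small = integral_J(2)[OF xA ia]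
  obtain x0 where x0: "x0 \<in> A" "\<And>b. b \<notin> P \<Longrightarrow> crd B x0 b = (if b = a then 0 else crd B x b)"
    using vals x'(2,3) xA by (cases "crd B x a = 0") (metis add_cancel_right_right, metis add.right_inverse add_cancel_right_right)
  obtain x1 where x1: "x1 \<in> A" "\<And>b. b \<notin> P \<Longrightarrow> crd B x1 b = (if b = a then \<mu> else crd B x b)"
    using vals x'(2,3) xA by (cases "crd B x a = 0") (metis add_cancel_left_left add_cancel_right_right, metis)
  define n where "n b = \<lfloor>crd B x b\<rfloor>" for b
  have n: "crd B x b = of_int (n b)" if "b \<in> J" for b using iJ[OF that] unfolding n_def by (auto elim: Ints_cases)
  define \<phi> where "\<phi> b = (if b = a then \<lfloor>\<mu>\<rfloor> else n b)" for b
  have cl: "l *s c \<in> A" using sign_A l cp by auto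
  have ccl: "crd B (l *s c) b = (if b = c then l else 0)" for b
    using crd_scale(1)[OF FD(1) A_span[of c]] crd_self[OF FD(1), of c b] cp by auto
  have "card {b\<in>J. odd (\<phi> b)} \<le> 2"
  proof (rule odd_support_le_2[OF frB x1(1) cl])
    have "crd B x1 c \<noteq> 0" using x1(2)[of c] cp ac c by auto
    then show "x1 \<notin> span (P \<union> J)" using crd_span[OF FD(1), of "P \<union> J" x1 c] cp FD by auto
  next
    fix b assume b: "b \<in> B - P - J"
    then show "crd B x1 b = crd B (l *s c) b"
      using x1(2)[of b] ccl[of b] a_J off[OF x(1), of b] single_coordinate(2)[OF x(1) c, of b] unfolding l_def
      by (cases "b \<in> C") auto
  next
    fix b assume b: "b \<in> J"
    then have "b \<notin> P" "b \<noteq> c" using J_props cp by auto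
    then show "crd B x1 b - crd B (l *s c) b = of_int (\<phi> b)"
      using x1(2)[of b] ccl[of b] n[OF b] mu(1) unfolding \<phi>_def by auto
  qed
  moreover have "odd (\<phi> a)" using mu(1) abs_eq_1_floor(2)[of \<mu>] unfolding \<phi>_def by auto
  ultimately have c1: "card {b\<in>J - {a}. odd (n b)} \<le> 1"
  proof -
    have "{b\<in>J. odd (\<phi> b)} = insert a {b\<in>J - {a}. odd (n b)}" using \<open>odd (\<phi> a)\<close> a_J unfolding \<phi>_def by auto
    then show ?thesis using \<open>card {b\<in>J. odd (\<phi> b)} \<le> 2\<close> J_props by simp
  qed
  have oddn: "odd (n b) \<longleftrightarrow> crd B x b \<noteq> 0" if "b \<in> J" for b
    using abs_eq_1_floor(2)[of "crd B x b"] small[OF that] unfolding n_def by (cases "crd B x b = 0") auto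
  have "\<exists>d\<in>J - {a}. crd B x d \<noteq> 0"
  proof (rule ccontr)
    assume neg: "\<not> ?thesis"
    have "crd B x b = 0" if "b \<in> B - insert a P - {c}" for b
      using that neg off[OF x(1), of b] single_coordinate(2)[OF x(1) c, of b] by (cases "b \<in> J"; cases "b \<in> C") auto
    then show False using reduced_single[OF FD(1) a_props(3,2) red x(1), of c] c x cp l unfolding l_def by auto
  qed
  then obtain d where d: "d \<in> J - {a}" "crd B x d \<noteq> 0" by auto
  have others: "crd B x b = 0" if "b \<in> J - {a,d}" for b
  proof (rule ccontr)
    assume "crd B x b \<noteq> 0"
    then have "{b, d} \<subseteq> {b\<in>J - {a}. odd (n b)}" using that d oddn by auto
    moreover have "finite {b\<in>J - {a}. odd (n b)}" using J_props by auto
    moreover have "card {b, d} = 2" using that by auto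
    ultimately show False using c1 card_mono[of "{b\<in>J - {a}. odd (n b)}" "{b,d}"] by linarith
  qed
  have dm: "\<bar>crd B x d\<bar> = 1" using small d by auto
  let ?e = "l * crd B x d"
  have dB: "d \<in> B" "d \<notin> P" "d \<noteq> c" "d \<noteq> a" using d FD J_props cp by auto
  have sp: "c \<in> span A" "a \<in> span A" "d \<in> span A" using cp FD(5) a_props(1) dB A_span by auto
  have e0: "e \<notin> P \<Longrightarrow> crd B x e = (if e = c then l else 0) + (if e = d then crd B x d else 0)" if "e \<noteq> a" "e \<in> B" for e
    using that off[OF x(1), of e] single_coordinate(2)[OF x(1) c, of e] others[of e] dB unfolding l_def
    by (cases "e \<in> J"; cases "e \<in> C") auto
  have m1: "mem P (c + ?e *s d)"
    unfolding mem_def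
  proof (intro bexI)
    show "l *s x0 \<in> A" using sign_A x0 l by auto
    show "l *s x0 - (c + ?e *s d) \<in> span P"
    proof (rule cong_by_crd[OF FD(1,2)])
      fix b assume b: "b \<in> B - P"
      show "crd B (l *s x0) b = crd B (c + ?e *s d) b"
        using b sp x0 dB cp ac e0[of b] l(2) by (cases "b = a") (auto simp: crd_linear crd_scale FD(1) span_scale A_span crd_self)
    qed (use sp x0 in \<open>auto intro: span_add span_scale A_span\<close>)
  qed
  have m2: "mem P (c + s *s a + ?e *s d)"
    unfolding mem_def
  proof (intro bexI)
    show "l *s x1 \<in> A" using sign_A x1 l by auto
    show "l *s x1 - (c + s *s a + ?e *s d) \<in> span P"
    proof (rule cong_by_crd[OF FD(1,2)])
      fix b assume b: "b \<in> B - P"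
      show "crd B (l *s x1) b = crd B (c + s *s a + ?e *s d) b"
        using b sp x1 dB cp ac e0[of b] l(2) mu(2) a_props(1)
        by (cases "b = a") (auto simp: crd_linear crd_scale FD(1) span_scale A_span crd_self span_add)
    qed (use sp x1 in \<open>auto intro: span_add span_scale A_span\<close>)
  qed
  have "c \<notin> span (P \<union> J)" using crd_span[OF FD(1), of "P \<union> J" c c] cp FD crd_self[OF FD(1), of c c] by auto
  then have "square c s a ?e d" unfolding square_def using s m1 m2 cp l dm by (auto simp: abs_mult)
  then show ?thesis using d dm others unfolding l_def by (intro bexI[of _ d] exI[of _ s]) auto
qed

end

text \<open>
  Used to turn agreement of two sign patterns into proportionality.
\<close>
lemma sign_product:
  assumes "u = 1 \<or> u = -1" "u0 = 1 \<or> u0 = -1" "v = 1 \<or> v = -1" "v0 = 1 \<or> v0 = (-1::real)" "u = u0 \<longleftrightarrow> v = v0"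
  shows "u = u0 * v0 * v"
  using assms by auto

context odd_doubles begin

lemma equal_up_to_sign:
  assumes "x \<in> S" "y \<in> S" "\<bar>l\<bar> = 1" "\<And>b. b \<in> B - insert a P \<Longrightarrow> crd B x b = l * crd B y b"
  shows "x = y"
proof (rule ccontr)
  assume "x \<noteq> y"
  then have "x - l *s y \<notin> span (insert a P)"
    using assms(1-3) red unfolding reduced_def by (auto simp: abs_if split: if_splits)
  moreover have "x \<in> span A" "y \<in> span A" using assms S_A A_span by auto
  ultimately show False using cong_by_crd[OF FD(1) a_props(3), of x "l *s y"] assms(4)
    by (auto simp: crd_scale FD(1) span_scale)
qed

text \<open>
  Squares over different elements of \<open>C\<close> cannot share a direction. Over the same \<open>c\<close>, either \<open>x\<close> and
  \<open>y\<close> agree up to sign, or exchanging \<open>x\<close> for \<open>c\<close> gives \<open>y\<close> the coordinate \<open>\<plusminus>2\<close> at \<open>d\<close>.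
\<close>
lemma excess_inj:
  assumes x: "x \<in> S" and c: "c \<in> C" "crd B x c \<noteq> 0" and y: "y \<in> S" and c': "c' \<in> C" "crd B y c' \<noteq> 0"
    and sx: "square c \<sigma> a (crd B x c * crd B x d) d" and xd: "\<bar>crd B x d\<bar> = 1" "\<And>b. b \<in> J - {a,d} \<Longrightarrow> crd B x b = 0"
    and sy: "square c' \<sigma>' a (crd B y c' * crd B y d) d" and yd: "\<bar>crd B y d\<bar> = 1" "\<And>b. b \<in> J - {a,d} \<Longrightarrow> crd B y b = 0"
    and d: "d \<in> J - {a}"
  shows "x = y"
proof (rule ccontr)
  assume ne: "x \<noteq> y"
  have xyA: "x \<in> A" "y \<in> A" using x y S_A by auto
  show False
  proof (cases "c = c'")
    case False
    have "c' \<notin> span (P \<union> J \<union> {c})"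
      using crd_span[OF FD(1), of "P \<union> J \<union> {c}" c' c'] C_props[OF c(1)] C_props[OF c'(1)] FD crd_self[OF FD(1), of c' c'] False by auto
    then show False using squares_same_direction[OF sx sy] a_J d by auto
  next
    case True
    define l m p q where "l = crd B x c" and "m = crd B y c" and "p = crd B x d" and "q = crd B y d"
    have one: "\<bar>l\<bar> = 1" "\<bar>m\<bar> = 1" "\<bar>p\<bar> = 1" "\<bar>q\<bar> = 1"
      using single_coordinate(1)[OF x c] single_coordinate(1)[OF y c'] xd yd True unfolding l_def m_def p_def q_def by auto
    have sq: "l * l = 1" "m * m = 1" using one by (metis abs_mult_self_eq mult_1)+
    note cp = C_props[OF c(1)]
    have dB: "d \<in> B" "d \<noteq> c" "d \<notin> P" using d FD J_props cp by auto
    show False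
    proof (cases "q = l * m * p")
      case True
      have "crd B x b = l * m * crd B y b" if b: "b \<in> B - insert a P" for b
      proof -
        consider "b = c" | "b = d" | "b \<in> J - {a,d}" | "b \<in> C - {c}" | "b \<in> B - P - J - C" using b by auto
        then show ?thesis
        proof cases
          case 1
          then show ?thesis using sq by (simp add: l_def[symmetric] m_def[symmetric] mult.assoc)
        next
          case 2
          have "l * m * q = (l * l) * (m * m) * p" using True by (simp add: algebra_simps)
          then show ?thesis using 2 sq by (simp add: p_def[symmetric] q_def[symmetric])
        next
          case 3 then show ?thesis using xd(2) yd(2) by simp
        next
          case 4 then show ?thesis using single_coordinate(2)[OF x c] single_coordinate(2)[OF y c'] \<open>c = c'\<close> by auto
        next
          case 5 then show ?thesis using off[OF x] off[OF y] by auto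
        qed
      qed
      then show False using equal_up_to_sign[OF x y, of "l * m"] one ne by (simp add: abs_mult)
    next
      case False
      have lB: "c \<in> B" "crd B x c \<noteq> 0" using cp c by auto
      note pv = pivot[OF FD(1) lB(1) xyA(1) lB(2)]
      have dB': "d \<in> B - {c}" using dB by auto
      have "crd (insert x (B - {c})) y d = q - m / l * p"
        using pv(5)[OF A_span[OF xyA(2)] dB'] unfolding l_def m_def p_def q_def by simp
      also have "m / l = m * l" using sq(1) one(1) by (auto simp: field_simps)
      also have "\<bar>q - m * l * p\<bar> = 2"
      proof -
        have "\<bar>l * m * p\<bar> = 1" using one by (simp add: abs_mult)
        then show ?thesis using False one(4) by (simp add: mult.commute[of m l])
      qed
      finally have "\<bar>crd (insert x (B - {c})) y d\<bar> = 2" .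
      moreover have "vol (insert x (B - {c})) = 2" using pv(3) FD(4) one(1) unfolding l_def by simp
      ultimately show False using vol_crd_le[OF pv(1), of d y] dB' xyA by auto
    qed
  qed
qed

text \<open>
  One of \<open>x\<close> and its companion is odd at \<open>a\<close>, and its even part has at most \<open>card J - 2\<close> elements. By
  \<open>pure_complement\<close> and minimality of \<open>J\<close> that part is empty; hence for the other one the even part is
  \<open>{a}\<close>, and the resulting odd circuit has two elements, which bounds \<open>card J\<close>.
\<close>
lemma integral_pure:
  assumes x: "x \<in> S" "\<And>c. c \<in> C \<Longrightarrow> crd B x c = 0" "crd B x a \<in> \<int>"
  shows "\<exists>d. J = {a, d} \<and> d \<noteq> a \<and> \<bar>crd B x d\<bar> = 1"
proof -
  have xA: "x \<in> A" using x S_A by auto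
  obtain t x' where x': "\<bar>t\<bar> = 1" "x' \<in> A" "\<And>b. b \<notin> P \<Longrightarrow> crd B x' b = crd B x b + (if b = a then t else 0)"
    using lift[OF x(1)] by blast
  note iJ = integral_J(1)[OF xA x(3)] and small = integral_J(2)[OF xA x(3)]
  have z: "crd B x b = 0" if "b \<in> B - P - J" for b using pure_off[of x b] x that by blast
  have z': "crd B x' b = 0" if "b \<in> B - P - J" for b using x'(3)[of b] z[OF that] that a_J by auto
  have "\<exists>d\<in>J - {a}. crd B x d \<noteq> 0"
  proof (rule ccontr)
    assume neg: "\<not> ?thesis"
    have "x \<in> span (insert a P)"
      using neg z by (intro crd_zero_span[OF FD(1) A_span[OF xA] a_props(3)]) auto
    then show False using red x unfolding reduced_def by auto
  qed
  then obtain d where d: "d \<in> J" "d \<noteq> a" "crd B x d \<noteq> 0" by auto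
  define n where "n y b = \<lfloor>crd B y b\<rfloor>" for y b
  have aP: "a \<notin> P" using a_props by auto
  have ti: "t \<in> \<int>" using x'(1) by (auto simp: abs_if split: if_splits)
  have nx: "crd B x b = of_int (n x b)" if "b \<in> J" for b using iJ[OF that] unfolding n_def by (auto elim: Ints_cases)
  have nx': "crd B x' b = of_int (n x' b)" if "b \<in> J" for b
  proof -
    have "b \<notin> P" using that J_props by auto
    then have "crd B x' b \<in> \<int>" using iJ[OF that] x'(3)[of b] ti by (auto intro: Ints_add)
    then show ?thesis unfolding n_def by (auto elim: Ints_cases)
  qed
  have eqn: "n x' b = n x b" if "b \<in> J" "b \<noteq> a" for b
  proof -
    have "b \<notin> P" using that J_props by auto
    then show ?thesis using x'(3)[of b] that unfolding n_def by auto
  qed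
  have "of_int (n x' a) = of_int (n x a) + t" using nx[OF a_J] nx'[OF a_J] x'(3)[OF aP] by simp
  then have "n x' a = n x a + 1 \<or> n x' a = n x a - 1" using x'(1) by linarith
  then have "odd (n x a) \<noteq> odd (n x' a)" by auto
  then obtain u v where uv: "u \<in> {x,x'}" "odd (n u a)" "v \<in> {x, x'}" "even (n v a)" by (cases "odd (n x a)") auto
  have nb: "n y b = n x b" if "y \<in> {x,x'}" "b \<in> J" "b \<noteq> a" for y b using that eqn by auto
  have on: "odd (n x b) \<longleftrightarrow> crd B x b \<noteq> 0" if "b \<in> J" for b
    using abs_eq_1_floor(2)[of "crd B x b"] small[OF that] unfolding n_def by (cases "crd B x b = 0") auto
  have com: "odd_circuit P (insert y {b\<in>J. even (n y b)})" "y \<notin> {b\<in>J. even (n y b)}" if "y \<in> {x,x'}" for y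
  proof -
    have "odd (n y d)" using on[OF d(1)] d nb[OF that d(1,2)] by auto
    then show "odd_circuit P (insert y {b\<in>J. even (n y b)})" "y \<notin> {b\<in>J. even (n y b)}"
      using pure_complement[OF frB, of y "n y" d] that xA x'(2) z z' nx nx' d(1) by auto
  qed
  have fin: "finite {b\<in>J. even (n y b)}" for y using J_props by auto
  have E: "{b\<in>J. even (n u b)} = {}"
  proof (rule ccontr)
    assume "\<not> ?thesis"
    then have "card {b\<in>J. even (n u b)} \<ge> 1" using fin by (simp add: Suc_leI card_gt_0_iff)
    then have "2 \<le> card (insert u {b\<in>J. even (n u b)})" using com(2)[OF uv(1)] fin by simp
    then have "card J \<le> Suc (card {b\<in>J. even (n u b)})" using shortest[OF com(1)[OF uv(1)]] com(2)[OF uv(1)] fin by simp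
    moreover have "{b\<in>J. even (n u b)} \<subseteq> J - {a,d}" using uv on[OF d(1)] d nb[OF uv(1) d(1,2)] by auto
    then have "card {b\<in>J. even (n u b)} \<le> card (J - {a,d})" using J_props by (intro card_mono) auto
    moreover have "card (J - {a,d}) = card J - 2" using d a_J J_props by (simp add: card_Diff_subset)
    ultimately show False using card_J by linarith
  qed
  have "{b\<in>J. even (n v b)} = {a}"
  proof -
    have "odd (n v b)" if "b \<in> J" "b \<noteq> a" for b using E that nb[OF uv(1) that] nb[OF uv(3) that] by auto
    then show ?thesis using uv a_J by auto
  qed
  then have "odd_circuit P {v, a}" "v \<noteq> a" using com[OF uv(3)] by auto
  then have "card J \<le> 2" using shortest[of "{v,a}"] by simp
  then have "card J = 2" using card_J by simp
  moreover have "{a,d} \<subseteq> J" "card {a,d} = 2" using d a_J by auto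
  ultimately have "J = {a,d}" using card_subset_eq[of J "{a,d}"] J_props by metis
  then show ?thesis using d small[OF d(1,3)] by blast
qed

text \<open>
  An integral pure element has, in one of its two versions, coordinates \<open>\<plusminus>1\<close> at both elements of
  \<open>J\<close>; a square would shear this to \<open>\<plusminus>2\<close> at \<open>a\<close>.
\<close>
lemma integral_pure_no_partner:
  assumes x: "x \<in> S" "\<And>c. c \<in> C \<Longrightarrow> crd B x c = 0" "crd B x a \<in> \<int>"
  shows "partners a = {}"
proof (rule ccontr)
  assume "partners a \<noteq> {}"
  then obtain c \<sigma> \<epsilon> d where sq: "square c \<sigma> a \<epsilon> d" "d \<in> J" "d \<noteq> a" unfolding partners_def by auto
  obtain d' where "J = {a,d'}" "\<bar>crd B x d'\<bar> = 1" using integral_pure[OF assms] by auto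
  then have J: "J = {a,d}" "\<bar>crd B x d\<bar> = 1" using sq by auto
  have xA: "x \<in> A" using x S_A by auto
  obtain t x' where x': "\<bar>t\<bar> = 1" "x' \<in> A" "\<And>b. b \<notin> P \<Longrightarrow> crd B x' b = crd B x b + (if b = a then t else 0)"
    using lift[OF x(1)] by blast
  have z: "crd B x b = 0" if "b \<in> B - P - J" for b using pure_off[of x b] x that by blast
  have dP: "d \<notin> P" "a \<notin> P" using sq J_props a_props by auto
  have ba: "\<bar>crd B x a\<bar> \<le> 1" "\<bar>crd B x a + t\<bar> \<le> 1" using bound_a[OF xA] bound_a[OF x'(2)] x'(3)[OF dP(2)] by auto
  obtain k :: int where k: "crd B x a = of_int k" using x(3) by (auto elim: Ints_cases)
  obtain s :: int where s: "t = of_int s" "\<bar>s\<bar> = 1" using x'(1) by (metis abs_eq_1_floor(1) of_int_abs of_int_eq_1_iff)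
  have "\<bar>k\<bar> \<le> 1" "\<bar>k + s\<bar> \<le> 1" using ba k s by linarith+
  then have "\<bar>k\<bar> = 1 \<or> \<bar>k + s\<bar> = 1" using s(2) by linarith
  then have "\<bar>crd B x a\<bar> = 1 \<or> \<bar>crd B x' a\<bar> = 1" using k s x'(3)[OF dP(2)] by auto
  then obtain y where y: "y \<in> {x,x'}" "\<bar>crd B y a\<bar> = 1" by auto
  have yA: "y \<in> A" using y xA x' by auto
  have yd: "crd B y d = crd B x d" "\<And>b. b \<in> B - P - J \<Longrightarrow> crd B y b = 0" using y x'(3) dP sq(3) z a_J by auto
  have cA: "c \<in> A" "c \<notin> span (P \<union> J)" and sg: "\<bar>\<epsilon>\<bar> = 1" using sq unfolding square_def by auto
  obtain B' where F: "frame B'" "c \<in> B'" and cn: "c \<notin> P \<union> J" using frame_insert[OF cA] by blast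
  note F' = frameD[OF F(1)]
  have dB: "d \<in> B" "a \<in> B'" "d \<in> B'" using sq FD F' a_J by auto
  define w where "w = crd B y a *s a + crd B y d *s d"
  have sp: "a \<in> span A" "d \<in> span A" using FD(5) a_props dB A_span by auto
  then have ws: "w \<in> span A" unfolding w_def by (auto intro: span_add span_scale)
  have "y - w \<in> span P"
  proof (rule cong_by_crd[OF FD(1,2) A_span[OF yA] ws])
    fix b assume b: "b \<in> B - P"
    have "crd B w b = crd B y a * (if b = a then 1 else 0) + crd B y d * (if b = d then 1 else 0)"
      unfolding w_def using sp a_props dB by (simp add: crd_linear crd_scale FD(1) span_scale crd_self)
    then show "crd B y b = crd B w b" using yd(2)[of b] b J sq by auto
  qed
  then have cw: "crd B' y b = crd B' w b" if "b \<notin> P" for b using crd_cong[OF F'(1,2) _ A_span[OF yA] ws that] by auto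
  have wb: "crd B' w b = crd B y a * (if b = a then 1 else 0) + crd B y d * (if b = d then 1 else 0)" for b
      unfolding w_def using sp dB by (simp add: crd_linear crd_scale F'(1) span_scale crd_self)
  define \<alpha> where "\<alpha> = - \<epsilon> * crd B y d * crd B y a"
  have al: "\<bar>\<alpha>\<bar> = 1" unfolding \<alpha>_def using sg y yd J by (simp add: abs_mult)
  have m: "a \<in> B' - P" "c \<in> B' - P" "d \<in> B' - P" "a \<noteq> c" "a \<noteq> d" "c \<noteq> d" using F dB dP cn a_J sq by auto
  obtain B2 where B2: "basis B2" "vol B2 = vol B'" "B' - {c,d} \<subseteq> B2" 
    "\<And>x. x \<in> span A \<Longrightarrow> crd B' x c = 0 \<Longrightarrow> crd B2 x a = crd B' x a - \<epsilon> * \<alpha> * crd B' x d"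
    using square_pivot[OF F'(1,2) m sq(1) al] by blast
  have "crd B' y c = 0" using cw[of c] wb[of c] m by auto
  then have "crd B2 y a = crd B y a - \<epsilon> * \<alpha> * crd B y d"
    using B2(4)[OF A_span[OF yA]] cw[of a] cw[of d] wb[of a] wb[of d] dP sq by auto
  then have "crd B2 y a = crd B y a + (\<epsilon> * \<epsilon>) * (crd B y d * crd B y d) * crd B y a"
    unfolding \<alpha>_def by (simp add: algebra_simps)
  moreover have "\<epsilon> * \<epsilon> = 1" "crd B y d * crd B y d = 1" using sg yd J by (metis abs_mult_self_eq mult_1)+
  ultimately have "crd B2 y a = 2 * crd B y a" by simp
  moreover have "vol B2 * \<bar>crd B2 y a\<bar> \<le> 2" using B2(3) m by (intro vol_crd_le B2 yA) auto
  ultimately show False using B2(2) F'(4) y(2) by (simp add: abs_mult)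
qed

text \<open>
  The two versions \<open>x\<close> and \<open>x \<plusminus> a\<close> have opposite coordinates \<open>\<plusminus>1/2\<close> at \<open>a\<close>, so one of them is the
  half sum \<open>half \<eta>\<close> up to sign.
\<close>
lemma half_pure_mem:
  assumes x: "x \<in> S" "\<And>c. c \<in> C \<Longrightarrow> crd B x c = 0" "crd B x a \<notin> \<int>"
    and eta: "\<And>b. b \<in> J \<Longrightarrow> \<bar>\<eta> b\<bar> = 1" and s: "\<bar>s\<bar> = 1" "\<And>b. b \<in> J - {a} \<Longrightarrow> \<eta> b = s * (2 * crd B x b)"
  shows "mem P (half \<eta>)"
proof -
  have xA: "x \<in> A" using x S_A by auto
  obtain t x' where x': "\<bar>t\<bar> = 1" "x' \<in> A" "\<And>b. b \<notin> P \<Longrightarrow> crd B x' b = crd B x b + (if b = a then t else 0)"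
    using lift[OF x(1)] by blast
  have aP: "a \<notin> P" using a_props by auto
  have ha: "\<bar>crd B x a\<bar> = 1/2" using frame_J[OF frB a_props(1) xA] x(3) by auto
  have x'a: "crd B x' a = crd B x a + t" using x'(3)[OF aP] by simp
  then have "\<bar>crd B x a + t\<bar> \<le> 1" using bound_a[OF x'(2)] by simp
  then have t: "crd B x a + t = - crd B x a" using ha x'(1) by linarith
  have e1: "\<eta> a = 1 \<or> \<eta> a = -1" "s = 1 \<or> s = -1" using eta[OF a_J] s(1) by linarith+
  have ha': "2 * crd B x a = 1 \<or> 2 * crd B x a = -1" using ha by linarith
  have "\<eta> a = s * (2 * crd B x a) \<or> \<eta> a = s * (2 * crd B x' a)"
    unfolding x'a t using e1 ha' by auto
  then obtain y where y: "y \<in> {x,x'}" "\<eta> a = s * (2 * crd B y a)" by auto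
  have yA: "y \<in> A" using y xA x' by auto
  have yb: "crd B y b = crd B x b" if "b \<notin> P" "b \<noteq> a" for b using y x'(3)[OF that(1)] that by auto
  have z: "crd B x b = 0" if "b \<in> B - P - J" for b using pure_off[of x b] x that by blast
  have "s *s y - half \<eta> \<in> span P"
  proof (rule cong_by_crd[OF FD(1,2) _ half_span])
    show "s *s y \<in> span A" using yA by (auto intro: span_scale A_span)
    fix b assume b: "b \<in> B - P"
    have "crd B (s *s y) b = s * crd B y b" using yA by (simp add: crd_scale FD(1) A_span)
    moreover have "s * crd B y b = (if b \<in> J then \<eta> b / 2 else 0)"
      using yb[of b] z[of b] s(2)[of b] y(2) b a_J by (cases "b = a"; cases "b \<in> J") auto
    ultimately show "crd B (s *s y) b = crd B (half \<eta>) b" using crd_half[OF frB] by simp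
  qed
  then show ?thesis unfolding mem_def using sign_A[OF yA s(1)] by blast
qed

definition excesses where "excesses = {x \<in> S - C. \<exists>c\<in>C. crd B x c \<noteq> 0}"
definition half_pures where "half_pures = {x \<in> S. (\<forall>c\<in>C. crd B x c = 0) \<and> crd B x a \<notin> \<int>}"
definition int_pures where "int_pures = {x \<in> S. (\<forall>c\<in>C. crd B x c = 0) \<and> crd B x a \<in> \<int>}"

lemma finite_S: "finite S" using S_A finite_A by (rule finite_subset)

lemma card_excesses: "card excesses \<le> card (partners a)"
proof -
  have "\<forall>x\<in>excesses. \<exists>d. \<exists>c\<in>C. \<exists>\<sigma>. crd B x c \<noteq> 0 \<and> d \<in> J - {a} \<and> square c \<sigma> a (crd B x c * crd B x d) d \<and>
      \<bar>crd B x d\<bar> = 1 \<and> (\<forall>b\<in>J - {a,d}. crd B x b = 0)"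
  proof
    fix x assume "x \<in> excesses"
    then obtain c where "x \<in> S" "x \<notin> C" "c \<in> C" "crd B x c \<noteq> 0" unfolding excesses_def by auto
    with excess[OF this] show "\<exists>d. \<exists>c\<in>C. \<exists>\<sigma>. crd B x c \<noteq> 0 \<and> d \<in> J - {a} \<and> square c \<sigma> a (crd B x c * crd B x d) d \<and>
      \<bar>crd B x d\<bar> = 1 \<and> (\<forall>b\<in>J - {a,d}. crd B x b = 0)" by blast
  qed
  then obtain f where f: "\<And>x. x \<in> excesses \<Longrightarrow> \<exists>c\<in>C. \<exists>\<sigma>. crd B x c \<noteq> 0 \<and> f x \<in> J - {a} \<and> square c \<sigma> a (crd B x c * crd B x (f x)) (f x) \<and>
      \<bar>crd B x (f x)\<bar> = 1 \<and> (\<forall>b\<in>J - {a,f x}. crd B x b = 0)" by (auto dest!: bchoice)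
  have S: "x \<in> S" if "x \<in> excesses" for x using that unfolding excesses_def by auto
  have "inj_on f excesses"
  proof (rule inj_onI)
    fix x y assume xy: "x \<in> excesses" "y \<in> excesses" "f x = f y"
    obtain c \<sigma> where c: "c \<in> C" "crd B x c \<noteq> 0" "f x \<in> J - {a}" "square c \<sigma> a (crd B x c * crd B x (f x)) (f x)"
      "\<bar>crd B x (f x)\<bar> = 1" "\<And>b. b \<in> J - {a,f x} \<Longrightarrow> crd B x b = 0" using f[OF xy(1)] by blast
    obtain c' \<sigma>' where c': "c' \<in> C" "crd B y c' \<noteq> 0" "square c' \<sigma>' a (crd B y c' * crd B y (f x)) (f x)"
      "\<bar>crd B y (f x)\<bar> = 1" "\<And>b. b \<in> J - {a,f x} \<Longrightarrow> crd B y b = 0" using f[OF xy(2)] unfolding xy(3) by blast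
    show "x = y" by (rule excess_inj[OF S[OF xy(1)] c(1,2) S[OF xy(2)] c'(1,2) c(4,5,6) c'(3,4,5) c(3)])
  qed
  moreover have "f ` excesses \<subseteq> partners a" using f unfolding partners_def by blast
  moreover have "finite (partners a)" using J_props unfolding partners_def by auto
  ultimately show ?thesis by (rule card_inj_on_le)
qed

lemma card_partners: "card (partners a) \<le> card J - 1"
proof -
  have "card (partners a) \<le> card (J - {a})" unfolding partners_def using J_props by (intro card_mono) auto
  then show ?thesis using a_J by simp
qed

lemma half_pure_eta:
  assumes "x \<in> half_pures" shows "\<And>b. b \<in> J \<Longrightarrow> \<bar>2 * crd B x b\<bar> = 1"
proof -
  fix b assume b: "b \<in> J"
  have x: "x \<in> A" "crd B x a \<notin> \<int>" using assms S_A unfolding half_pures_def by auto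
  have "crd B x b \<notin> \<int>"
  proof
    assume "crd B x b \<in> \<int>"
    then have "crd B x a \<in> \<int>" using Ints_add[OF frame_parity[OF frB x(1) a_J b]] by fastforce
    then show False using x by simp
  qed
  then have "\<bar>crd B x b\<bar> = 1/2" using frame_J[OF frB subsetD[OF FD(3) b] x(1)] by auto
  then show "\<bar>2 * crd B x b\<bar> = 1" by simp
qed

lemma half_pures_partners: assumes "half_pures \<noteq> {}" shows "card (partners a) \<le> 1"
proof -
  obtain x where x: "x \<in> half_pures" using assms by auto
  define \<eta> where "\<eta> b = 2 * crd B x b" for b
  have eta: "\<bar>\<eta> b\<bar> = 1" if "b \<in> J" for b using half_pure_eta[OF x that] unfolding \<eta>_def .
  have "mem P (half \<eta>)" using x by (intro half_pure_mem[of x \<eta> 1] eta) (auto simp: half_pures_def \<eta>_def)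
  then show ?thesis using partners_half[OF a_J, of \<eta>] eta by blast
qed

text \<open>
  A half-integral pure element is determined, up to sign and up to its coordinate at \<open>a\<close>, by the set of
  positions where its sign agrees with that at a fixed \<open>b0 \<in> J - {a}\<close>. If every subset occurs, then
  every half sum is present.
\<close>
lemma card_half_pures:
  "card half_pures \<le> 2 ^ (card J - 2)"
  "card half_pures = 2 ^ (card J - 2) \<Longrightarrow> \<forall>\<eta>. (\<forall>b\<in>J. \<bar>\<eta> b\<bar> = 1) \<longrightarrow> mem P (half \<eta>)"
proof -
  have "J \<noteq> {a}" using card_J by auto
  then obtain b0 where b0: "b0 \<in> J" "b0 \<noteq> a" using a_J by auto
  define U where "U = Pow (J - {a,b0})"
  have cU: "card U = 2 ^ (card J - 2)" "finite U"
    using J_props a_J b0 unfolding U_def by (simp_all add: card_Pow card_Diff_subset)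
  define f where "f x = {b\<in>J - {a,b0}. crd B x b = crd B x b0}" for x
  have pm: "crd B x b = 1/2 \<or> crd B x b = -(1/2)" if "x \<in> half_pures" "b \<in> J" for x b
    using half_pure_eta[OF that] by linarith
  have SS: "x \<in> S" "\<And>c. c \<in> C \<Longrightarrow> crd B x c = 0" "crd B x a \<notin> \<int>" if "x \<in> half_pures" for x
    using that unfolding half_pures_def by auto
  have inj: "inj_on f half_pures"
  proof (rule inj_onI, rule ccontr)
    fix x y assume xy: "x \<in> half_pures" "y \<in> half_pures" "f x = f y" and ne: "x \<noteq> y"
    define s where "s = 4 * crd B x b0 * crd B y b0"
    have s2: "s = (2 * crd B x b0) * (2 * crd B y b0)" unfolding s_def by simp
    then have s1: "\<bar>s\<bar> = 1"
      unfolding s2 abs_mult half_pure_eta[OF xy(1) b0(1), unfolded abs_mult] half_pure_eta[OF xy(2) b0(1), unfolded abs_mult] by simp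
    have "crd B x b = s * crd B y b" if b: "b \<in> B - insert a P" for b
    proof (cases "b \<in> J")
      case False
      then have "b \<in> B - P - J" using b by auto
      then show ?thesis using pure_off[OF SS(1,2)[OF xy(1)]] pure_off[OF SS(1,2)[OF xy(2)]] by simp
    next
      case True
      have "crd B x b = crd B x b0 \<longleftrightarrow> crd B y b = crd B y b0"
      proof (cases "b = b0")
        case False
        then have "b \<in> f x \<longleftrightarrow> b \<in> f y" using xy(3) by simp
        then show ?thesis unfolding f_def using False True b by auto
      qed auto
      then have "2 * crd B x b = (2 * crd B x b0) * (2 * crd B y b0) * (2 * crd B y b)"
        using pm[OF xy(1) b0(1)] pm[OF xy(2) b0(1)] pm[OF xy(1) True] pm[OF xy(2) True] by (intro sign_product) linarith+
      then show ?thesis unfolding s2 by simp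
    qed
    then show False using equal_up_to_sign[OF SS(1)[OF xy(1)] SS(1)[OF xy(2)] s1] ne by blast
  qed
  have img: "f ` half_pures \<subseteq> U" unfolding f_def U_def by auto
  show "card half_pures \<le> 2 ^ (card J - 2)" using card_inj_on_le[OF inj img cU(2)] cU by simp
  assume eq: "card half_pures = 2 ^ (card J - 2)"
  have sur: "f ` half_pures = U"
    using img cU eq card_image[OF inj] by (intro card_subset_eq) auto
  show "\<forall>\<eta>. (\<forall>b\<in>J. \<bar>\<eta> b\<bar> = 1) \<longrightarrow> mem P (half \<eta>)"
  proof (intro allI impI)
    fix \<eta> :: "'v \<Rightarrow> real" assume eta: "\<forall>b\<in>J. \<bar>\<eta> b\<bar> = 1"
    have "{b\<in>J - {a,b0}. \<eta> b = \<eta> b0} \<in> U" unfolding U_def by auto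
    then obtain x where x: "x \<in> half_pures" "f x = {b\<in>J - {a,b0}. \<eta> b = \<eta> b0}" using sur by (metis (no_types, lifting) imageE)
    define s where "s = \<eta> b0 * (2 * crd B x b0)"
    have e: "\<eta> b = 1 \<or> \<eta> b = -1" if "b \<in> J" for b
    proof -
      have "\<bar>\<eta> b\<bar> = 1" using eta that by auto
      then show ?thesis by linarith
    qed
    show "mem P (half \<eta>)"
    proof (rule half_pure_mem[OF SS[OF x(1)]])
      show "\<bar>\<eta> b\<bar> = 1" if "b \<in> J" for b using eta that by auto
      show "\<bar>s\<bar> = 1" unfolding s_def abs_mult[of "\<eta> b0"] half_pure_eta[OF x(1) b0(1)] using eta b0 by simp
      fix b assume b: "b \<in> J - {a}"
      have "\<eta> b = \<eta> b0 \<longleftrightarrow> crd B x b = crd B x b0"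
      proof (cases "b = b0")
        case False
        then have "b \<in> f x \<longleftrightarrow> \<eta> b = \<eta> b0" using x(2) b by auto
        then show ?thesis unfolding f_def using False b by auto
      qed auto
      moreover have "b \<in> J" using b by auto
      ultimately show "\<eta> b = s * (2 * crd B x b)" unfolding s_def
        using e[OF b0(1)] e[of b] pm[OF x(1) b0(1)] pm[OF x(1), of b] by (intro sign_product) linarith+
    qed
  qed
qed

lemma card_int_pures:
  "card int_pures \<le> 1" "int_pures \<noteq> {} \<Longrightarrow> card J = 2" "int_pures \<noteq> {} \<Longrightarrow> partners a = {}"
proof -
  have ip: "\<exists>d. J = {a, d} \<and> d \<noteq> a \<and> \<bar>crd B x d\<bar> = 1" if "x \<in> int_pures" for x
    using that by (intro integral_pure) (auto simp: int_pures_def)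
  show "card J = 2" if "int_pures \<noteq> {}" using that ip by fastforce
  show "partners a = {}" if "int_pures \<noteq> {}"
    using that integral_pure_no_partner unfolding int_pures_def by blast
  have "x = y" if xy: "x \<in> int_pures" "y \<in> int_pures" for x y
  proof (rule ccontr)
    assume ne: "x \<noteq> y"
    have SS: "x \<in> S" "y \<in> S" "\<And>c. c \<in> C \<Longrightarrow> crd B x c = 0" "\<And>c. c \<in> C \<Longrightarrow> crd B y c = 0" using xy unfolding int_pures_def by auto
    obtain d where d: "J = {a,d}" "d \<noteq> a" "\<bar>crd B x d\<bar> = 1" using ip[OF xy(1)] by auto
    then have dy: "\<bar>crd B y d\<bar> = 1" using ip[OF xy(2)] by auto
    define s where "s = crd B x d * crd B y d"
    have s1: "\<bar>s\<bar> = 1" unfolding s_def using d dy by (simp add: abs_mult)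
    have yy: "crd B y d * crd B y d = 1" using dy by (metis abs_mult_self_eq mult_1)
    have "crd B x b = s * crd B y b" if b: "b \<in> B - insert a P" for b
    proof (cases "b \<in> J")
      case False
      then have "b \<in> B - P - J" using b by auto
      then show ?thesis using pure_off[OF SS(1,3)] pure_off[OF SS(2,4)] by simp
    next
      case True
      then have "b = d" using d b by auto
      then show ?thesis using yy unfolding s_def by (simp add: mult.assoc)
    qed
    then show False using equal_up_to_sign[OF SS(1,2) s1] ne by blast
  qed
  then have "card int_pures \<le> Suc 0"
    using finite_S by (subst card_le_Suc0_iff_eq) (auto simp: int_pures_def)
  then show "card int_pures \<le> 1" by simp
qed

text \<open>
  The basis \<open>B\<close> contains the disjoint sets \<open>C\<close>, \<open>P\<close> and \<open>J\<close>.
\<close>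
lemma card_S_le: "card S + card P + card J \<le> dim A + card excesses + card half_pures + card int_pures"
proof -
  have "S \<subseteq> C \<union> excesses \<union> half_pures \<union> int_pures" unfolding excesses_def half_pures_def int_pures_def by auto
  moreover have fin: "finite C" "finite excesses" "finite half_pures" "finite int_pures"
    using finite_S C_S finite_subset unfolding excesses_def half_pures_def int_pures_def by auto
  ultimately have "card S \<le> card (C \<union> excesses \<union> half_pures \<union> int_pures)" by (intro card_mono) auto
  also have "\<dots> \<le> card C + card excesses + card half_pures + card int_pures"
    by (intro order_trans[OF card_Un_le] add_mono order_refl)
  finally have 1: "card S \<le> card C + card excesses + card half_pures + card int_pures" .
  have "card (C \<union> (P \<union> J)) \<le> card B" using C_B FD by (intro card_mono) auto
  moreover have "card (C \<union> (P \<union> J)) = card C + (card P + card J)"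
    using fin C_PJ J_props by (subst card_Un_disjoint; (subst card_Un_disjoint)?) auto
  ultimately show ?thesis using 1 card_basis[OF FD(1)] by linarith
qed

text \<open>
  With \<open>n = dim A - card P\<close>, the independent part contributes at most \<open>n - card J\<close>, so the claim
  \<open>card S \<le> n\<close> says that at most \<open>card J\<close> further elements occur. There are at most \<open>card J - 1\<close>
  excesses, but at most one next to a half-integral pure element, and at most \<open>2 ^ (card J - 2)\<close> of
  the latter; integral pure elements occur only for \<open>card J = 2\<close>, at most once and without excesses.
  Only \<open>1 + 4\<close> for \<open>card J = 4\<close> exceeds \<open>card J\<close>, which is the second alternative.
\<close>
lemma card_S:
  assumes "card J \<le> 4"
  shows "card S + card P \<le> dim A \<or>
    (card J = 4 \<and> (\<forall>\<eta>. (\<forall>b\<in>J. \<bar>\<eta> b\<bar> = 1) \<longrightarrow> mem P (half \<eta>)) \<and> card S + card P \<le> dim A + 1)"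
proof -
  have e: "card excesses \<le> card J - 1" "half_pures \<noteq> {} \<Longrightarrow> card excesses \<le> 1" "int_pures \<noteq> {} \<Longrightarrow> card excesses = 0"
    using card_excesses card_partners half_pures_partners card_int_pures(3) by (auto intro: order_trans)
  have h0: "half_pures = {} \<Longrightarrow> card half_pures = 0" and i0: "int_pures = {} \<Longrightarrow> card int_pures = 0" by auto
  consider "card J = 2" | "card J = 3" | "card J = 4" using card_J assms by linarith
  then show ?thesis
  proof cases
    case 1
    then show ?thesis using card_S_le e h0 i0 card_half_pures(1) card_int_pures(1)
      by (cases "int_pures = {}"; cases "half_pures = {}") auto
  next
    case 2
    then have "int_pures = {}" using card_int_pures(2) by auto
    then show ?thesis using 2 card_S_le e h0 i0 card_half_pures(1)
      by (cases "half_pures = {}") auto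
  next
    case 3
    then have ip: "int_pures = {}" using card_int_pures(2) by auto
    show ?thesis
    proof (cases "card half_pures = 4")
      case True
      then show ?thesis using 3 ip card_S_le e h0 i0 card_half_pures(2) by (cases "half_pures = {}") auto
    next
      case False
      then show ?thesis using 3 ip card_S_le e h0 i0 card_half_pures(1) by (cases "half_pures = {}") auto
    qed
  qed
qed

lemma card_S_no_partner:
  assumes "card J = 3" "partners a = {}"
  shows "card S + card P + 1 \<le> dim A"
proof -
  have "int_pures = {}" using card_int_pures(2) assms by auto
  then show ?thesis using card_S_le card_excesses card_half_pures(1) assms by auto
qed

end

context shortest_odd_circuit begin

lemma odd_doubles_exists:
  assumes "a \<in> J" "reduced (insert a P) S" "\<And>s. s \<in> S \<Longrightarrow> double P a s"
  obtains B C where "odd_doubles scale A vol P J a S B C"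
proof -
  have SA: "S \<subseteq> A" using assms unfolding reduced_def by auto
  obtain T where T: "P \<union> J \<subseteq> T" "T \<subseteq> P \<union> J \<union> S" "independent T" "P \<union> J \<union> S \<subseteq> span T"
    using maximal_independent_subset_extend[of "P \<union> J" "P \<union> J \<union> S"] J_props by auto
  have "T \<subseteq> A" using T SA P_A J_props by auto
  then obtain B where B: "basis B" "T \<subseteq> B" using basis_extend T(3) by blast
  have "odd_doubles scale A vol P J a S B (T - (P \<union> J))"
  proof (unfold_locales)
    fix x b assume "x \<in> S" "b \<in> B - P - J - (T - (P \<union> J))"
    then show "crd B x b = 0" using crd_span[OF B, of x b] T(4) by auto
  qed (use assms T B in \<open>auto simp: frame_def\<close>)
  then show ?thesis using that by blast
qed

end

context volume_config begin

section \<open>Contraction of an element\<close>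

lemma span_insertE:
  assumes "x \<in> span (insert a P)" obtains t where "x - t *s a \<in> span P"
  using assms unfolding span_insert by auto

lemma congruent_up_to_sign:
  assumes "y - c \<in> span Q \<or> y + c \<in> span Q" shows "\<exists>s. \<bar>s\<bar> = 1 \<and> s *s y - c \<in> span Q"
  using assms
proof
  assume "y - c \<in> span Q"
  then show ?thesis by (intro exI[of _ 1]) simp
next
  assume "y + c \<in> span Q"
  then have "- (y + c) \<in> span Q" by (rule span_neg)
  then show ?thesis by (intro exI[of _ "-1"]) simp
qed

text \<open>
  Sort \<open>Y\<close> by classes modulo \<open>span (insert a P)\<close> up to sign. If all steps along \<open>a\<close> are \<open>\<plusminus>1\<close>, three
  elements of a nonzero class would have pairwise distances \<open>1\<close> on a line. So such a class has at
  most two elements, and if it has two, its representative is doubled.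
\<close>
lemma contraction:
  assumes "P \<subseteq> A" "a \<in> A" and Y: "reduced P Y"
    and unit_steps: "\<forall>y\<in>A. \<forall>y'\<in>A. \<forall>t. y \<notin> span (insert a P) \<longrightarrow> y' - (y + t *s a) \<in> span P \<longrightarrow> t \<noteq> 0 \<longrightarrow> \<bar>t\<bar> = 1"
  obtains Y' S where "reduced (insert a P) Y'" "reduced (insert a P) S" "\<And>s. s \<in> S \<Longrightarrow> double P a s"
    "card Y \<le> card (Y \<inter> span (insert a P)) + card Y' + card S"
proof -
  let ?P = "insert a P"
  have step: "\<bar>t\<bar> = 1" if "y \<in> A" "y' \<in> A" "y \<notin> span ?P" "y' - (y + t *s a) \<in> span P" "t \<noteq> 0" for y y' t
    using unit_steps that by blast
  define Y0 where "Y0 = Y - span ?P"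
  define R where "R y z \<longleftrightarrow> y - z \<in> span ?P \<or> y + z \<in> span ?P" for y z
  have YA: "Y \<subseteq> A" using Y unfolding reduced_def by auto
  have finY: "finite Y" using YA finite_A by (rule finite_subset)
  have Rrefl: "R y y" for y unfolding R_def using span_zero by simp
  have Rsym: "R z y" if "R y z" for y z
    using that span_neg[of "y - z" ?P] unfolding R_def by (auto simp: add.commute)
  have Rtrans: "R x z" if "R x y" "R y z" for x y z
  proof -
    have e: "x - z = (x - y) + (y - z)" "x + z = (x - y) + (y + z)" "x + z = (x + y) - (y - z)" "x - z = (x + y) - (y + z)" by simp_all
    show ?thesis using that span_add[of _ ?P] span_diff[of _ ?P] unfolding R_def by (metis e)
  qed
  \<comment> \<open>a representative of each class, constant on the class by the choice operator\<close>
  define rep where "rep y = (SOME z. z \<in> Y0 \<and> R y z)" for y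
  have rep: "rep y \<in> Y0" "R y (rep y)" if "y \<in> Y0" for y
    using someI[of "\<lambda>z. z \<in> Y0 \<and> R y z" y] that Rrefl unfolding rep_def by auto
  have rep_eq: "rep y = rep z" if "R y z" for y z
  proof -
    have "(\<lambda>w. w \<in> Y0 \<and> R y w) = (\<lambda>w. w \<in> Y0 \<and> R z w)" using that Rtrans Rsym by blast
    then show ?thesis unfolding rep_def by simp
  qed
  define Y' where "Y' = rep ` Y0"
  have Y'0: "Y' \<subseteq> Y0" unfolding Y'_def using rep by auto
  have Y'rep: "rep c = c" if "c \<in> Y'" for c using that rep_eq rep Rsym unfolding Y'_def by blast
  have redY': "reduced ?P Y'"
    unfolding reduced_def
  proof (intro conjI ballI impI)
    show "Y' \<subseteq> A" using Y'0 YA unfolding Y0_def by auto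
    show "y \<notin> span ?P" if "y \<in> Y'" for y using that Y'0 unfolding Y0_def by auto
    fix y z assume yz: "y \<in> Y'" "z \<in> Y'" "y \<noteq> z"
    then have "\<not> R y z" using rep_eq Y'rep by metis
    then show "y - z \<notin> span ?P" "y + z \<notin> span ?P" unfolding R_def by auto
  qed
  define F where "F c = {y \<in> Y0. rep y = c}" for c
  define S where "S = {c \<in> Y'. 2 \<le> card (F c)}"
  have inF: "\<exists>s t. \<bar>s\<bar> = 1 \<and> s *s y - (c + t *s a) \<in> span P" if "y \<in> F c" for y c
  proof -
    have "R y c" using that rep unfolding F_def by auto
    then obtain s where s: "\<bar>s\<bar> = 1" "s *s y - c \<in> span ?P" using congruent_up_to_sign unfolding R_def by blast
    then obtain t where "s *s y - c - t *s a \<in> span P" using span_insertE by blast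
    then show ?thesis using s by (intro exI[of _ s] exI[of _ t]) (simp add: diff_diff_eq)
  qed
  have dist: "\<bar>t - t'\<bar> = 1" if yz: "y \<in> F c" "z \<in> F c" "y \<noteq> z"
    and s: "\<bar>s\<bar> = 1" "s *s y - (c + t *s a) \<in> span P" "\<bar>s'\<bar> = 1" "s' *s z - (c + t' *s a) \<in> span P" for y z c s t s' t'
  proof -
    have YY: "y \<in> Y" "z \<in> Y" "y \<in> A" "z \<in> A" "z \<notin> span ?P" using yz YA unfolding F_def Y0_def by auto
    have "(s *s y - (c + t *s a)) - (s' *s z - (c + t' *s a)) \<in> span P" by (rule span_diff[OF s(2) s(4)])
    then have d: "s *s y - (s' *s z + (t - t') *s a) \<in> span P" by (simp add: algebra_simps scale_left_diff_distrib)
    have "t - t' \<noteq> 0"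
    proof
      assume "t - t' = 0"
      then have e: "s *s y - s' *s z \<in> span P" using d by simp
      have "y - z \<in> span P \<or> y + z \<in> span P"
      proof -
        have "s = 1 \<or> s = -1" "s' = 1 \<or> s' = -1" using s by linarith+
        then show ?thesis using e span_neg[OF e] by (elim disjE) (auto simp: algebra_simps)
      qed
      then show False using Y YY yz unfolding reduced_def by blast
    qed
    moreover have "s' *s z \<notin> span ?P"
    proof
      assume "s' *s z \<in> span ?P"
      then have "s' *s (s' *s z) \<in> span ?P" by (rule span_scale)
      moreover have "s' * s' = 1" using s by (metis abs_mult_self_eq mult_1)
      ultimately show False using YY by simp
    qed
    ultimately show ?thesis using step[OF sign_A[OF YY(4) s(3)] sign_A[OF YY(3) s(1)] _ d] by auto
  qed
  have F2: "card (F c) \<le> 2" for c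
  proof (rule ccontr)
    assume "\<not> ?thesis"
    then have "3 \<le> card (F c)" by simp
    then obtain G where "G \<subseteq> F c" "card G = 3" by (rule obtain_subset_with_card_n)
    then obtain x y z where xyz: "x \<in> F c" "y \<in> F c" "z \<in> F c" "x \<noteq> y" "y \<noteq> z" "x \<noteq> z" by (auto simp: card_3_iff)
    obtain s1 t1 where 1: "\<bar>s1\<bar> = 1" "s1 *s x - (c + t1 *s a) \<in> span P" using inF[OF xyz(1)] by auto
    obtain s2 t2 where 2: "\<bar>s2\<bar> = 1" "s2 *s y - (c + t2 *s a) \<in> span P" using inF[OF xyz(2)] by auto
    obtain s3 t3 where 3: "\<bar>s3\<bar> = 1" "s3 *s z - (c + t3 *s a) \<in> span P" using inF[OF xyz(3)] by auto
    have "\<bar>t1 - t2\<bar> = 1" "\<bar>t2 - t3\<bar> = 1" "\<bar>t1 - t3\<bar> = 1"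
      using dist[OF xyz(1,2,4) 1 2] dist[OF xyz(2,3,5) 2 3] dist[OF xyz(1,3,6) 1 3] by auto
    then show False by linarith
  qed
  have redS: "reduced ?P S" using redY' unfolding S_def reduced_def by auto
  have dblS: "double P a c" if "c \<in> S" for c
  proof -
    have c: "c \<in> Y'" "2 \<le> card (F c)" "c \<in> A" using that redY' unfolding S_def reduced_def by auto
    have cF: "c \<in> F c" using c Y'0 Y'rep unfolding F_def by auto
    obtain y where y: "y \<in> F c" "y \<noteq> c"
    proof -
      have "\<not> F c \<subseteq> {c}" using c(2) card_mono[of "{c}" "F c"] by auto
      then show ?thesis using that by auto
    qed
    obtain s t where st: "\<bar>s\<bar> = 1" "s *s y - (c + t *s a) \<in> span P" using inF[OF y(1)] by auto
    have "\<bar>t - 0\<bar> = 1" using dist[OF y(1) cF y(2) st, of 1 0] span_zero by simp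
    moreover have "mem P (c + t *s a)" unfolding mem_def using st sign_A[of y s] y YA unfolding F_def Y0_def by auto
    ultimately show ?thesis using c(3) unfolding double_def by (auto simp: abs_if split: if_splits)
  qed
  have "Y0 = (\<Union>c\<in>Y'. F c)" unfolding F_def Y'_def by auto
  then have "card Y0 \<le> (\<Sum>c\<in>Y'. card (F c))" using card_UN_le[of Y' F] finY unfolding Y'_def Y0_def by simp
  also have "\<dots> \<le> (\<Sum>c\<in>Y'. 1 + (if c \<in> S then 1 else 0))"
  proof (rule sum_mono)
    fix c assume "c \<in> Y'"
    then show "card (F c) \<le> 1 + (if c \<in> S then 1 else 0)" using F2[of c] unfolding S_def by auto
  qed
  also have "\<dots> = card Y' + card S"
  proof -
    have "finite Y'" using finY unfolding Y'_def Y0_def by auto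
    moreover have "Y' \<inter> {c. c \<in> S} = S" unfolding S_def by auto
    moreover have "(\<Sum>c\<in>Y'. 1 + (if c \<in> S then 1 else 0)) = (\<Sum>c\<in>Y'. 1) + (\<Sum>c\<in>Y'. if c \<in> S then 1 else (0::nat))"
      by (rule sum.distrib)
    ultimately show ?thesis by (simp add: sum.If_cases)
  qed
  finally have "card Y0 \<le> card Y' + card S" .
  moreover have "card Y = card (Y \<inter> span ?P) + card Y0"
    unfolding Y0_def using card_Int_Diff[OF finY] .
  ultimately show ?thesis using that[OF redY' redS dblS] by auto
qed

lemma reduced_inj_bound:
  assumes "reduced P Y" "\<And>y. y \<in> Y \<Longrightarrow> y - f y *s a \<in> span P" "\<And>y. y \<in> Y \<Longrightarrow> \<bar>f y\<bar> \<in> K" "finite K"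
  shows "card Y \<le> card K"
proof -
  have "inj_on (\<lambda>y. \<bar>f y\<bar>) Y"
  proof (rule inj_onI, rule ccontr)
    fix y z assume yz: "y \<in> Y" "z \<in> Y" "\<bar>f y\<bar> = \<bar>f z\<bar>" "y \<noteq> z"
    then consider "f y = f z" | "f y = - f z" by linarith
    then have "y - z \<in> span P \<or> y + z \<in> span P"
    proof cases
      case 1
      then show ?thesis using span_diff[OF assms(2)[OF yz(1)] assms(2)[OF yz(2)]] by simp
    next
      case 2
      then show ?thesis using span_add[OF assms(2)[OF yz(1)] assms(2)[OF yz(2)]] by (simp add: algebra_simps)
    qed
    then show False using assms(1) yz unfolding reduced_def by blast
  qed
  moreover have "(\<lambda>y. \<bar>f y\<bar>) ` Y \<subseteq> K" using assms(3) by auto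
  ultimately show ?thesis using assms(4) by (rule card_inj_on_le)
qed

text \<open>
  A step of length \<open>2\<close> makes \<open>{y, y'}\<close> an odd circuit. A step of length \<open>1/2\<close> writes \<open>a\<close> as
  \<open>\<plusminus>2 (y' - y)\<close>, so that \<open>{a}\<close> would be one.
\<close>
lemma unit_step:
  assumes P: "P \<subseteq> A" "a \<in> A" "a \<notin> span P" "independent P"
    and na: "\<not> odd_circuit P {a}" and no: "\<And>Q. odd_circuit P Q \<Longrightarrow> card Q \<notin> {2,3,4}"
    and y: "y \<in> A" "y' \<in> A" "y \<notin> span (insert a P)" "y' - (y + t *s a) \<in> span P" "t \<noteq> 0"
  shows "\<bar>t\<bar> = 1"
proof -
  have ind: "independent (insert y (insert a P))" using P y by (intro independent_insertI)
  have "insert y (insert a P) \<subseteq> A" using P y by auto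
  then obtain B where B: "basis B" "insert y (insert a P) \<subseteq> B" using basis_extend ind by metis
  have n: "a \<notin> P" "y \<notin> P" "y \<noteq> a" using P(3) y(3) span_base[of _ P] span_base[of _ "insert a P"] by auto
  have PB: "P \<subseteq> B" "a \<in> B" "y \<in> B" using B by auto
  have c: "crd B y' b = (if b = y then 1 else 0) + (if b = a then t else 0)" if "b \<notin> P" for b
    using crd_lift[OF B(1) PB(1,2) y(4) A_span[OF y(1)] A_span[OF y(2)] that] crd_self[OF B(1) PB(3), of b] by simp
  have ca: "crd B y' a = t" "crd B y' y = 1" using c[of a] c[of y] n by auto
  have v: "vol B * \<bar>t\<bar> \<in> {0,1,2}" using vol_crd[OF B(1) PB(2) y(2)] ca by simp
  consider "\<bar>t\<bar> = 1" | "\<bar>t\<bar> = 2" | "\<bar>t\<bar> = 1/2" using v vol_cases[OF B(1)] y(5) by fastforce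
  then show ?thesis
  proof cases
    case 2
    have e: "odd_circuit P (insert y' {f\<in>{y,a}. odd \<lfloor>crd B y' f\<rfloor>})" "y' \<notin> {f\<in>{y,a}. odd \<lfloor>crd B y' f\<rfloor>}"
      by (rule odd_circuit_of_relation[OF B(1) PB(1) y(2), of "{y,a}" "\<lambda>f. \<lfloor>crd B y' f\<rfloor>" a];
          use PB n c ca abs_eq_2_floor[OF 2] in auto)+
    have "{f\<in>{y,a}. odd \<lfloor>crd B y' f\<rfloor>} = {y}" using ca n abs_eq_2_floor[OF 2] by auto
    then show ?thesis using no[OF e(1)] e(2) by auto
  next
    case 3
    have nz: "crd B y' a \<noteq> 0" using ca y by simp
    note pv = pivot[OF B(1) PB(2) y(2) nz]
    let ?B = "insert y' (B - {a})"
    have aA: "a \<in> span A" "y \<in> span A" using P y A_span by auto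
    have yn: "y' \<notin> P" "y' \<noteq> y" "y' \<notin> B - {a}" using pv(2) PB n by auto
    have t2: "1 / t = 2 \<or> 1 / t = -2" using 3 y(5) by (auto simp: abs_if field_simps split: if_splits)
    have c1: "crd ?B a y' = 1 / t" using pv(4)[OF aA(1)] ca crd_self[OF B(1) PB(2), of a] by simp
    have c2: "crd ?B a b = - (1 / t) * crd B y' b" if "b \<in> B - {a}" for b
      using pv(5)[OF aA(1) that] ca crd_self[OF B(1) PB(2)] that by auto
    have c2': "crd ?B a y = - (1/t)" using c2[of y] PB n ca by auto
    have r1: "\<bar>1/t\<bar> = 2" using t2 by linarith
    then have r2: "\<bar>-(1/t)\<bar> = 2" by (simp only: abs_minus_cancel)
    note r = r1 r2
    have o1: "odd_circuit P (insert a {f\<in>{y',y}. odd \<lfloor>crd ?B a f\<rfloor>})"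
    proof (rule odd_circuit_of_relation[OF pv(1) _ P(2), of P "{y',y}" "\<lambda>f. \<lfloor>crd ?B a f\<rfloor>" y'])
      show "P \<subseteq> ?B" "{y',y} \<subseteq> ?B" "{y',y} \<inter> P = {}" "y' \<in> {y',y}" using PB n yn by auto
      show "crd ?B a b = 0" if "b \<in> ?B - P - {y',y}" for b using that c2[of b] c[of b] by auto
      show "crd ?B a f = of_int \<lfloor>crd ?B a f\<rfloor>" if "f \<in> {y',y}" for f
        using that c1 c2' abs_eq_2_floor[OF r(1)] abs_eq_2_floor[OF r(2)] by auto
      show "even \<lfloor>crd ?B a y'\<rfloor>" "\<lfloor>crd ?B a y'\<rfloor> \<noteq> 0" using c1 abs_eq_2_floor[OF r(1)] by auto
    qed
    have o2: "{f\<in>{y',y}. odd \<lfloor>crd ?B a f\<rfloor>} = {}"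
      using c1 c2' abs_eq_2_floor[OF r(1)] abs_eq_2_floor[OF r(2)] by auto
    show ?thesis using o1 na unfolding o2 by simp
  qed auto
qed

text \<open>
  The elements on the line of \<open>a\<close> are multiples of \<open>a\<close> by \<open>\<plusminus>1\<close> or \<open>\<plusminus>2\<close>; a factor \<open>\<plusminus>1/2\<close> would turn \<open>{a}\<close>
  into an odd circuit.
\<close>
lemma card_zero_fibre:
  assumes P: "P \<subseteq> A" "a \<in> A" "a \<notin> span P" "independent P"
    and na: "\<not> odd_circuit P {a}" and Y: "reduced P Y"
  shows "card (Y \<inter> span (insert a P)) \<le> 2"
proof -
  have "insert a P \<subseteq> A" "independent (insert a P)" using P(1,2) independent_insertI[OF P(3,4)] by auto
  then obtain B where B: "basis B" "insert a P \<subseteq> B" using basis_extend by metis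
  have PB: "P \<subseteq> B" "a \<in> B" using B by auto
  have aP: "a \<notin> P" using P(3) span_base[of a P] by auto
  have redI: "reduced P (Y \<inter> span (insert a P))" using Y unfolding reduced_def by auto
  have main: "y - crd B y a *s a \<in> span P \<and> \<bar>crd B y a\<bar> \<in> {1,2}" if y: "y \<in> Y \<inter> span (insert a P)" for y
  proof -
    have yA: "y \<in> A" "y \<notin> span P" using y Y unfolding reduced_def by auto
    have z: "crd B y b = 0" if "b \<notin> insert a P" for b using crd_span[OF B _ that] y by auto
    have d: "y - crd B y a *s a \<in> span P" using span_insert_crd[OF B aP] y by auto
    define t where "t = crd B y a"
    have t0: "t \<noteq> 0" using d yA(2) unfolding t_def by auto
    have v: "vol B * \<bar>t\<bar> \<in> {0,1,2}" using vol_crd[OF B(1) PB(2) yA(1)] unfolding t_def by simp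
    consider "\<bar>t\<bar> = 1" | "\<bar>t\<bar> = 2" | "\<bar>t\<bar> = 1/2" using v vol_cases[OF B(1)] t0 by fastforce
    then show ?thesis
    proof cases
      case 3
      note pv = pivot[OF B(1) PB(2) yA(1) t0[unfolded t_def]]
      let ?B = "insert y (B - {a})"
      have aA: "a \<in> span A" using P A_span by auto
      have c1: "crd ?B a y = 1 / t" using pv(4)[OF aA] crd_self[OF B(1) PB(2), of a] unfolding t_def by simp
      have c2: "crd ?B a b = 0" if "b \<in> B - {a}" "b \<notin> P" for b
        using pv(5)[OF aA that(1)] crd_self[OF B(1) PB(2)] z[of b] that by auto
      have r: "\<bar>1/t\<bar> = 2" by (simp add: abs_divide 3)
      have yn: "y \<notin> P" using yA span_base by auto
      have o1: "odd_circuit P (insert a {f\<in>{y}. odd \<lfloor>crd ?B a f\<rfloor>})"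
      proof (rule odd_circuit_of_relation[OF pv(1) _ P(2), of P "{y}" "\<lambda>f. \<lfloor>crd ?B a f\<rfloor>" y])
        show "P \<subseteq> ?B" "{y} \<subseteq> ?B" "{y} \<inter> P = {}" "y \<in> {y}" using PB yn aP by auto
        show "crd ?B a b = 0" if "b \<in> ?B - P - {y}" for b using that c2[of b] by auto
        show "crd ?B a f = of_int \<lfloor>crd ?B a f\<rfloor>" if "f \<in> {y}" for f
          using that c1 abs_eq_2_floor[OF r] by auto
        show "even \<lfloor>crd ?B a y\<rfloor>" "\<lfloor>crd ?B a y\<rfloor> \<noteq> 0" using c1 abs_eq_2_floor[OF r] by auto
      qed
      have o2: "{f\<in>{y}. odd \<lfloor>crd ?B a f\<rfloor>} = {}" using c1 abs_eq_2_floor[OF r] by auto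
      show ?thesis using o1 na unfolding o2 by simp
    qed (use d in \<open>auto simp: t_def\<close>)
  qed
  have "card (Y \<inter> span (insert a P)) \<le> card {1,2::real}"
    by (rule reduced_inj_bound[OF redI, of "\<lambda>y. crd B y a" a]) (use main in auto)
  then show ?thesis by simp
qed

text \<open>
  This is the degenerate case in which every element is twice a lattice vector modulo \<open>span P\<close>. Since
  disjoint independent odd circuits cannot coexist, only one line is left.
\<close>
lemma card_all_odd:
  assumes P: "P \<subseteq> A" "independent P" and Y: "reduced P Y"
    and odd: "\<And>x. x \<in> A \<Longrightarrow> x \<notin> span P \<Longrightarrow> odd_circuit P {x}"
  shows "card Y \<le> 1"
proof -
  have YA: "Y \<subseteq> A" "\<And>y. y \<in> Y \<Longrightarrow> y \<notin> span P" using Y unfolding reduced_def by auto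
  have "y = z" if yz: "y \<in> Y" "z \<in> Y" for y z
  proof (rule ccontr)
    assume ne: "y \<noteq> z"
    have A: "y \<in> A" "z \<in> A" using yz YA by auto
    have o: "odd_circuit P {y}" "odd_circuit P {z}" using odd A YA(2) yz by auto
    have ind: "independent (insert y P)" using P YA yz by (intro independent_insertI) auto
    show False
    proof (cases "z \<in> span (insert y P)")
      case False
      then have "independent (insert z (insert y P))" using ind by (rule independent_insertI)
      then have "independent (P \<union> {y} \<union> {z})" by simp
      then show False using disjoint_odd_circuits[OF o _ _ P(1)] ne by auto
    next
      case True
      have "insert y P \<subseteq> A" using P A by auto
      then obtain B where B: "basis B" "insert y P \<subseteq> B" using basis_extend ind by metis
      have PB: "P \<subseteq> B" "y \<in> B" using B by auto
      have v: "vol B = 2" using odd_circuit_vol[OF o(1) B(1)] PB by auto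
      have yP: "y \<notin> P" using YA(2)[OF yz(1)] span_base[of y P] by auto
      have d: "z - crd B z y *s y \<in> span P" by (rule span_insert_crd[OF B yP True])
      then have nz: "crd B z y \<noteq> 0" using YA(2)[OF yz(2)] by auto
      note pv = pivot[OF B(1) PB(2) A(2) nz]
      have "vol (insert z (B - {y})) = 2" using odd_circuit_vol[OF o(2) pv(1)] PB yP by auto
      then have "\<bar>crd B z y\<bar> = 1" using pv(3) v by simp
      then have "crd B z y = 1 \<or> crd B z y = -1" by linarith
      then have "z - y \<in> span P \<or> z + y \<in> span P" using d by auto
      then show False using Y yz ne unfolding reduced_def by (metis add.commute)
    qed
  qed
  then have "card Y \<le> Suc 0" using YA(1) finite_A by (subst card_le_Suc0_iff_eq) (auto intro: finite_subset)
  then show ?thesis by simp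
qed

lemma evn_mono: "evn P x \<Longrightarrow> P \<subseteq> P' \<Longrightarrow> evn P' x"
  unfolding evn_def using span_mono[of P P'] by blast

end

context shortest_odd_circuit begin

text \<open>
  Comparing the coordinates at \<open>a\<close> and at another element of \<open>J\<close> shows that the step is an
  integer; the bound on coordinates excludes everything beyond \<open>\<plusminus>1\<close>.
\<close>
lemma unit_step_J:
  assumes a: "a \<in> J" and y: "y \<in> A" "y' \<in> A" "y \<notin> span (insert a P)" "y' - (y + t *s a) \<in> span P" "t \<noteq> 0"
  shows "\<bar>t\<bar> = 1"
proof -
  obtain B where F: "frame B" by (rule frame_exists)
  note FD = frameD[OF F]
  have aB: "a \<in> B" "a \<notin> P" using a FD J_props by auto
  have c: "crd B y' b = crd B y b + (if b = a then t else 0)" if "b \<notin> P" for b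
    using crd_lift[OF FD(1,2) aB(1) y(4) A_span[OF y(1)] A_span[OF y(2)] that] .
  have "J \<noteq> {a}" using card_J by auto
  then obtain b0 where b0: "b0 \<in> J" "b0 \<noteq> a" using a by auto
  have b0P: "b0 \<notin> P" using b0 J_props by auto
  have "(crd B y' a - crd B y' b0) - (crd B y a - crd B y b0) \<in> \<int>"
    using frame_parity[OF F y(2) a b0(1)] frame_parity[OF F y(1) a b0(1)] by (rule Ints_diff)
  then have "t \<in> \<int>" using c[OF aB(2)] c[OF b0P] b0 by simp
  then obtain k where k: "t = of_int k" by (auto elim: Ints_cases)
  have "\<exists>b\<in>B - insert a P. crd B y b \<noteq> 0"
    using crd_zero_span[OF FD(1) A_span[OF y(1)], of "insert a P"] y(3) FD(2) aB by auto
  then obtain b where b: "b \<in> B" "b \<noteq> a" "b \<notin> P" "crd B y b \<noteq> 0" by auto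
  have "\<bar>t\<bar> \<le> 1 \<or> \<bar>t\<bar> < 2"
  proof (cases "crd B y b \<in> \<int>")
    case True
    then have one: "\<bar>crd B y b\<bar> = 1" using frame_J[OF F b(1) y(1)] b(4) by (auto elim!: Ints_cases)
    note pv = pivot[OF FD(1) b(1) y(1) b(4)]
    have ab: "a \<in> B - {b}" using aB b by auto
    have "crd (insert y (B - {b})) y' a = t"
      using pv(5)[OF A_span[OF y(2)] ab] c[OF aB(2)] c[OF b(3)] b by simp
    then have "2 * \<bar>t\<bar> \<le> 2" using vol_crd_le[OF pv(1) _ y(2), of a] ab pv(3) one FD(4) by auto
    then show ?thesis by simp
  next
    case False
    have bJ: "b \<in> J"
    proof (rule ccontr)
      assume "b \<notin> J"
      then have "crd B y b \<in> {-1,0,1}" using frame_off[OF F b(1,3) _ y(1)] by auto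
      then show False using False by auto
    qed
    have "crd B y a \<notin> \<int>"
    proof
      assume "crd B y a \<in> \<int>"
      then have "(crd B y b - crd B y a) + crd B y a \<in> \<int>" using frame_parity[OF F y(1) bJ a] by (intro Ints_add)
      then show False using False by simp
    qed
    then have h: "\<bar>crd B y a\<bar> = 1/2" using frame_J[OF F aB(1) y(1)] by auto
    have "\<bar>crd B y' a\<bar> \<le> 1" using vol_crd_le[OF FD(1) aB(1) y(2)] FD(4) by simp
    then show ?thesis using c[OF aB(2)] h by (simp add: abs_if split: if_splits)
  qed
  then have "\<bar>k\<bar> < 2" "k \<noteq> 0" using k y(5) by auto
  then have "\<bar>k\<bar> = 1" by linarith
  then show ?thesis using k by simp
qed

lemma card_zero_fibre_J:
  assumes a: "a \<in> J" and Y: "reduced P Y"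
  shows "card (Y \<inter> span (insert a P)) \<le> 1"
proof -
  obtain B where F: "frame B" by (rule frame_exists)
  note FD = frameD[OF F]
  have aB: "a \<in> B" "a \<notin> P" using a FD J_props by auto
  have sub: "insert a P \<subseteq> B" using aB FD by auto
  have "J \<noteq> {a}" using card_J by auto
  then obtain b0 where b0: "b0 \<in> J" "b0 \<noteq> a" using a by auto
  have b0P: "b0 \<notin> P" using b0 J_props by auto
  have redI: "reduced P (Y \<inter> span (insert a P))" using Y unfolding reduced_def by auto
  have main: "y - crd B y a *s a \<in> span P \<and> \<bar>crd B y a\<bar> \<in> {1}" if y: "y \<in> Y \<inter> span (insert a P)" for y
  proof -
    have yA: "y \<in> A" "y \<notin> span P" using y Y unfolding reduced_def by auto
    have z: "crd B y b = 0" if "b \<notin> insert a P" for b using crd_span[OF FD(1) sub _ that] y by auto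
    have d: "y - crd B y a *s a \<in> span P" using span_insert_crd[OF FD(1) sub aB(2)] y by auto
    then have t0: "crd B y a \<noteq> 0" using yA(2) by auto
    have "crd B y b0 = 0" using z b0 b0P by auto
    then have "crd B y a \<in> \<int>" using frame_parity[OF F yA(1) a b0(1)] by simp
    then have "\<bar>crd B y a\<bar> = 1" using t0 frame_J[OF F aB(1) yA(1)] by (auto elim!: Ints_cases)
    then show ?thesis using d by simp
  qed
  have "card (Y \<inter> span (insert a P)) \<le> card {1::real}"
    by (rule reduced_inj_bound[OF redI, of "\<lambda>y. crd B y a" a]) (use main in auto)
  then show ?thesis by simp
qed

lemma reduced_card_step:
  assumes a: "a \<in> J" and Y: "reduced P Y"
    and K: "\<And>Y'. reduced (insert a P) Y' \<Longrightarrow> 2 * card Y' \<le> k"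
    and s: "\<And>S. reduced (insert a P) S \<Longrightarrow> (\<And>s. s \<in> S \<Longrightarrow> double P a s) \<Longrightarrow> card S \<le> s"
  shows "2 * card Y \<le> 2 + k + 2 * s"
proof -
  have aA: "a \<in> A" using a J_props by auto
  have st: "\<forall>y\<in>A. \<forall>y'\<in>A. \<forall>t. y \<notin> span (insert a P) \<longrightarrow> y' - (y + t *s a) \<in> span P \<longrightarrow> t \<noteq> 0 \<longrightarrow> \<bar>t\<bar> = 1"
        using unit_step_J[OF a] by blast
  obtain Y' S where "reduced (insert a P) Y'" "reduced (insert a P) S" "\<And>s. s \<in> S \<Longrightarrow> double P a s"
    "card Y \<le> card (Y \<inter> span (insert a P)) + card Y' + card S"
    using contraction[OF P_A aA Y st] by blast
  then show ?thesis using K[of Y'] s[of S] card_zero_fibre_J[OF a Y] by fastforce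
qed

text \<open>
  A relation of size two modulo \<open>insert a P\<close> lifts to one modulo \<open>P\<close> of size two or, with \<open>a\<close> added,
  three, contradicting the minimality of \<open>J\<close>.
\<close>
lemma contracted_shortest:
  assumes "card J = 4" "a \<in> J"
  shows "shortest_odd_circuit scale A vol (insert a P) (J - {a})"
proof unfold_locales
  let ?P = "insert a P"
  have aP: "a \<notin> P" using assms J_props by auto
  show "?P \<subseteq> A" using P_A assms J_props by auto
  have U: "?P \<union> (J - {a}) = P \<union> J" using assms by auto
  have "evn ?P (\<Sum>J - a)"
    by (intro evn_diff evn_mono[OF J_props(5)] evn_span span_base) auto
  moreover have "\<Sum>J - a = \<Sum>(J - {a})" using assms J_props by (simp add: sum_diff1)
  moreover have "card (J - {a}) = 3" using assms J_props by simp
  then have "J - {a} \<noteq> {}" by (metis card.empty zero_neq_numeral)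
  ultimately show "odd_circuit ?P (J - {a})"
    unfolding odd_circuit_def U using J_props by auto
  show "2 \<le> card (J - {a})" using assms by simp
  fix Q assume Q: "odd_circuit ?P Q" "2 \<le> card Q"
  show "card (J - {a}) \<le> card Q"
  proof (rule ccontr)
    assume "\<not> ?thesis"
    then have c2: "card Q = 2" using assms Q by simp
    then have finQ: "finite Q" using card.infinite by fastforce
    have QP: "Q \<subseteq> A" "Q \<noteq> {}" "?P \<inter> Q = {}" "independent (?P \<union> Q)" "evn ?P (\<Sum>Q)" using Q unfolding odd_circuit_def by auto
    then obtain z where z: "z \<in> lat" "\<Sum>Q - (z + z) \<in> span ?P" unfolding evn_def by auto
    define v where "v = \<Sum>Q - (z + z)"
    have vl: "v \<in> lat" unfolding v_def using z QP lat_A by (intro lat_diff lat_add lat_sum) auto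
    obtain t where t: "v - t *s a \<in> span P" using z(2) span_insertE unfolding v_def by blast
    obtain B where F: "frame B" by (rule frame_exists)
    note FD = frameD[OF F]
    have aB: "a \<in> B" using assms FD by auto
    have aA: "a \<in> A" "a \<in> span A" using aB FD A_span by auto
    have cv: "crd B v b = (if b = a then t else 0)" if "b \<notin> P" for b
      using crd_cong[OF FD(1,2) t lat_span[OF vl] span_scale[OF aA(2)] that] crd_self[OF FD(1) aB, of b] aA
      by (simp add: crd_scale FD(1))
    have "J \<noteq> {a}" using card_J by auto
    then obtain b0 where b0: "b0 \<in> J" "b0 \<noteq> a" using assms by auto
    have "b0 \<notin> P" using b0 J_props by auto
    then have "t \<in> \<int>" using frame_lat_parity[OF F vl assms(2) b0(1)] cv[of b0] cv[OF aP] b0 by simp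
    then obtain k where k: "t = of_int k" by (auto elim: Ints_cases)
    have "evn P ((v - t *s a) + (z + z))" using t z by (intro evn_add evn_span evn_double)
    then have e: "evn P (\<Sum>Q + of_int (- k) *s a)" unfolding v_def k by (simp add: algebra_simps)
    have PQ: "P \<inter> Q = {}" "a \<notin> Q" using QP by auto
    show False
    proof (cases "even k")
      case True
      then have "evn P (\<Sum>Q + of_int 0 *s a)" using lat_A[OF aA(1)] by (intro evn_parity[OF e]) auto
      then have "odd_circuit P Q"
        unfolding odd_circuit_def using QP PQ independent_mono[OF QP(4), of "P \<union> Q"] by auto
      then show False using shortest[of Q] c2 assms by simp
    next
      case False
      then have "evn P (\<Sum>Q + of_int 1 *s a)" using lat_A[OF aA(1)] by (intro evn_parity[OF e]) auto
      then have "evn P (\<Sum>(insert a Q))" using finQ PQ by (simp add: add.commute)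
      then have "odd_circuit P (insert a Q)"
        unfolding odd_circuit_def using QP PQ aA aP by auto
      then show False using shortest[of "insert a Q"] c2 assms finQ PQ by simp
    qed
  qed
qed

text \<open>
  An improvement by one over the general bound: contract an element of \<open>J\<close> that has no partner, so that
  there are no excesses.
\<close>
lemma reduced_card_three:
  assumes J3: "card J = 3" and eta: "\<And>b. b \<in> J \<Longrightarrow> \<bar>\<eta> b\<bar> = 1" "mem P (half \<eta>)"
    and n: "n + card P = dim A" and Y: "reduced P Y"
    and K: "\<And>a Y'. a \<in> J \<Longrightarrow> reduced (insert a P) Y' \<Longrightarrow> 2 * card Y' \<le> (n - 1) * (n + 2)"
  shows "2 * card Y + 2 \<le> n * (n + 3)"
proof -
  obtain a where a: "a \<in> J" "partners a = {}" using three_without_partner[OF J3 eta] by auto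
  have n3: "n \<ge> 3"
  proof -
    have "card (P \<union> J) \<le> dim A" using J_props P_A by (intro independent_card_le) auto
    moreover have "card (P \<union> J) = card P + 3" using J_props J3 by (subst card_Un_disjoint) auto
    ultimately show ?thesis using n by linarith
  qed
  have "2 * card Y \<le> 2 + (n - 1) * (n + 2) + 2 * (n - 1)"
  proof (rule reduced_card_step[OF a(1) Y K[OF a(1)]])
    fix S assume S: "reduced (insert a P) S" "\<And>s. s \<in> S \<Longrightarrow> double P a s"
    obtain B C where "odd_doubles scale A vol P J a S B C" by (rule odd_doubles_exists[OF a(1) S])
    then interpret odd_doubles scale A vol P J a S B C .
    show "card S \<le> n - 1" using card_S_no_partner[OF J3 a(2)] n by linarith
  qed
  moreover obtain m where "n = Suc m" using n3 by (cases n) auto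
  ultimately show ?thesis by (simp add: algebra_simps)
qed

end

context volume_config begin

section \<open>The number of differing elements\<close>

text \<open>
  Write \<open>f n = n (n + 3) / 2\<close>, so that \<open>f n - f (n - 1) = n + 1\<close>. By \<open>contraction\<close> it suffices that the
  zero class and the doubled classes together have at most \<open>n + 1\<close> elements. Without odd circuits of
  two to four elements they have at most \<open>2 + (n - 1)\<close>, and for an element of a shortest such
  circuit \<open>J\<close> at most \<open>1 + n\<close>, with one exception: they may number \<open>n + 2\<close> if \<open>card J = 4\<close> and all
  half sums of \<open>J\<close> are present. In this case the contraction has the shortest odd circuit \<open>J - {a}\<close>
  and contains a half sum of it, and \<open>reduced_card_three\<close> makes up for the surplus.
\<close>
theorem reduced_card:
  "\<lbrakk>reduced P Y; P \<subseteq> A; independent P; n + card P = dim A\<rbrakk> \<Longrightarrow> 2 * card Y \<le> n * (n + 3)"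
proof (induction n arbitrary: P Y rule: less_induct)
  case (less n)
  note Y = less.prems(1) and P = less.prems(2,3) and n = less.prems(4)
  have finP: "finite P" using P finite_A finite_subset by auto
  have YA: "Y \<subseteq> A" "\<And>y. y \<in> Y \<Longrightarrow> y \<notin> span P" using Y unfolding reduced_def by auto
  have pos: "n > 0" if "x \<in> A" "x \<notin> span P" for x
  proof -
    have i: "independent (insert x P)" using that P by (intro independent_insertI)
    have "x \<notin> P" using that span_base by auto
    then show ?thesis using independent_card_le[OF _ i] that P n finP by auto
  qed
  have IH: "2 * card Y' \<le> (n - 1) * (n + 2)" if "a \<in> A" "a \<notin> span P" "reduced (insert a P) Y'" for a Y'
  proof -
    have "a \<notin> P" using that span_base by auto
    then have "n - 1 + card (insert a P) = dim A" using n finP pos[OF that(1,2)] by simp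
    then have "2 * card Y' \<le> (n - 1) * (n - 1 + 3)"
      using pos[OF that(1,2)] that P independent_insertI[OF that(2) P(2)] by (intro less.IH) auto
    then show ?thesis using pos[OF that(1,2)] by (simp add: algebra_simps)
  qed
  have fin: "2 + (n - 1) * (n + 2) + 2 * n = n * (n + 3)" if "n > 0"
    using that by (cases n) (auto simp: algebra_simps)
  show ?case
  proof (cases "Y = {}")
    case True then show ?thesis by simp
  next
    case False
    then obtain y0 where y0: "y0 \<in> A" "y0 \<notin> span P" using YA by auto
    have n0: "n > 0" using pos y0 by blast
    consider "\<exists>Q. odd_circuit P Q \<and> card Q \<in> {2,3,4}"
      | "\<And>x. x \<in> A \<Longrightarrow> x \<notin> span P \<Longrightarrow> odd_circuit P {x}"
      | "\<not> (\<exists>Q. odd_circuit P Q \<and> card Q \<in> {2,3,4})" "\<exists>x\<in>A. x \<notin> span P \<and> \<not> odd_circuit P {x}" by blast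
    then show ?thesis
    proof cases
      case 2
      then have "card Y \<le> 1" using card_all_odd[OF P Y] by blast
      then have "2 * card Y \<le> 1 * 4" by simp
      also have "\<dots> \<le> n * (n + 3)" using n0 by (intro mult_le_mono) auto
      finally show ?thesis .
    next
      case 3
      then obtain a where a: "a \<in> A" "a \<notin> span P" "\<not> odd_circuit P {a}" by auto
      have no: "card Q \<notin> {2,3,4}" if "odd_circuit P Q" for Q using 3(1) that by auto
      have aP: "a \<notin> P" using a span_base by auto
      have st: "\<forall>y\<in>A. \<forall>y'\<in>A. \<forall>t. y \<notin> span (insert a P) \<longrightarrow> y' - (y + t *s a) \<in> span P \<longrightarrow> t \<noteq> 0 \<longrightarrow> \<bar>t\<bar> = 1"
        using unit_step[OF P(1) a(1,2) P(2) a(3) no] by blast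
      obtain Y' S where YS: "reduced (insert a P) Y'" "reduced (insert a P) S" "\<And>s. s \<in> S \<Longrightarrow> double P a s"
        "card Y \<le> card (Y \<inter> span (insert a P)) + card Y' + card S"
        using contraction[OF P(1) a(1) Y st] by blast
      have "card S + card P + 1 \<le> dim A"
        using P a aP YS(2,3) no independent_insertI[OF a(2) P(2)] by (intro card_doubled_no_short_odd_circuit[of P a]) auto
      then have "card S \<le> n - 1" using n by linarith
      moreover have "card (Y \<inter> span (insert a P)) \<le> 2" by (rule card_zero_fibre[OF P(1) a(1,2) P(2) a(3) Y])
      ultimately have "2 * card Y \<le> 2 + (n - 1) * (n + 2) + 2 * n" using YS(4) IH[OF a(1,2) YS(1)] n0 by linarith
      then show ?thesis using fin[OF n0] by simp
    next
      case 1
      \<comment> \<open>a shortest odd circuit with at least two elements has at most four\<close>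
      define Odd where "Odd Q \<longleftrightarrow> odd_circuit P Q \<and> 2 \<le> card Q" for Q
      obtain Q0 where "odd_circuit P Q0" "card Q0 \<in> {2,3,4}" using 1 by blast
      then have Q0: "Odd Q0" "card Q0 \<le> 4" unfolding Odd_def by auto
      define J where "J = arg_min card Odd"
      have J: "Odd J" "\<And>Q. Odd Q \<Longrightarrow> card J \<le> card Q"
        using arg_min_natI[of Odd, OF Q0(1), of card] arg_min_nat_le[of Odd _ card] unfolding J_def by auto
      interpret so: shortest_odd_circuit scale A vol P J
        using J P unfolding Odd_def by unfold_locales auto
      have J4: "card J \<le> 4" using J(2)[OF Q0(1)] Q0(2) by simp
      obtain a where a: "a \<in> J" using so.card_J by fastforce
      have aA: "a' \<in> A" "a' \<notin> span P" if "a' \<in> J" for a'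
      proof -
        show "a' \<in> A" using that so.J_props by auto
        have "independent (insert a' P)" using independent_mono[OF so.J_props(4), of "insert a' P"] that by auto
        moreover have "a' \<notin> P" using that so.J_props by auto
        ultimately show "a' \<notin> span P" by (simp add: independent_insert)
      qed
      define E where "E \<longleftrightarrow> card J = 4 \<and> (\<forall>\<eta>. (\<forall>b\<in>J. \<bar>\<eta> b\<bar> = 1) \<longrightarrow> mem P (so.half \<eta>))"
      have S: "card S \<le> n \<or> E \<and> card S \<le> n + 1" if SS: "reduced (insert a P) S" "\<And>s. s \<in> S \<Longrightarrow> double P a s" for S
      proof -
        obtain B C where "odd_doubles scale A vol P J a S B C" by (rule so.odd_doubles_exists[OF a SS])
        then interpret odd_doubles scale A vol P J a S B C .
        show ?thesis using card_S[OF J4] n unfolding E_def by auto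
      qed
      show ?thesis
      proof (cases E)
        case False
        have "2 * card Y \<le> 2 + (n - 1) * (n + 2) + 2 * n"
          using S False by (intro so.reduced_card_step[OF a Y IH[OF aA[OF a]]]) auto
        then show ?thesis using fin[OF n0] by simp
      next
        case True
        then have J4': "card J = 4" and half: "mem P (so.half (\<lambda>_. 1))" unfolding E_def by auto
        let ?P = "insert a P" and ?J = "J - {a}"
        interpret s3: shortest_odd_circuit scale A vol ?P ?J by (rule so.contracted_shortest[OF J4' a])
        have J3: "card ?J = 3" using a J4' so.J_props by simp
        have mem3: "mem ?P (s3.half (\<lambda>_. 1))"
        proof -
          obtain y where y: "y \<in> A" "y - so.half (\<lambda>_. 1) \<in> span P" using half unfolding mem_def by auto
          have "so.half (\<lambda>_. 1) = (1/2) *s a + s3.half (\<lambda>_. 1)"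
            unfolding so.half_def s3.half_def using so.J_props a by (simp add: sum.remove[of J a])
          moreover have "(y - so.half (\<lambda>_. 1)) + (1/2) *s a \<in> span ?P"
          proof (rule span_add)
            show "y - so.half (\<lambda>_. 1) \<in> span ?P" using y(2) span_mono[of P ?P] by auto
            show "(1/2) *s a \<in> span ?P" by (intro span_scale span_base) simp
          qed
          ultimately have "y - s3.half (\<lambda>_. 1) \<in> span ?P" by (simp add: algebra_simps)
          then show ?thesis using y unfolding mem_def by auto
        qed
        have aP: "a \<notin> P" using a so.J_props by auto
        have n1: "n - 1 + card ?P = dim A" using n finP n0 aP by simp
        have K: "2 * card Y' \<le> (n - 1 - 1) * (n - 1 + 2)" if "b \<in> ?J" "reduced (insert b ?P) Y'" for b Y'
        proof -
          have ind: "independent (insert b ?P)" using independent_mono[OF so.J_props(4), of "insert b ?P"] that a by auto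
          have b: "b \<notin> ?P" "insert b ?P \<subseteq> A" using that so.J_props P a by auto
          have "card (insert b ?P) \<le> dim A" using independent_card_le[OF b(2) ind] .
          then have "n \<ge> 2" using b finP aP n by simp
          then have "n - 2 + card (insert b ?P) = dim A" using b finP aP n by simp
          then have "2 * card Y' \<le> (n - 2) * (n - 2 + 3)"
            using \<open>n \<ge> 2\<close> by (intro less.IH[OF _ that(2) b(2) ind]) auto
          moreover obtain m where "n = m + 2" using \<open>n \<ge> 2\<close> by (metis le_add_diff_inverse2)
          ultimately show ?thesis by (simp add: algebra_simps)
        qed
        \<comment> \<open>one column less than the general bound\<close>
        have K3: "2 * card Y' \<le> (n - 1) * (n + 2) - 2" if "reduced ?P Y'" for Y'
        proof -
          have "2 * card Y' + 2 \<le> (n - 1) * (n - 1 + 3)"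
            by (rule s3.reduced_card_three[OF J3 _ mem3 n1 that K]) auto
          moreover have "n - 1 + 3 = n + 2" using n0 by simp
          ultimately show ?thesis by simp
        qed
        have ge2: "2 \<le> (n - 1) * (n + 2)"
        proof -
          have "card (P \<union> J) \<le> dim A" using so.J_props P by (intro independent_card_le) auto
          moreover have "card (P \<union> J) = card P + 4" using so.J_props J4' by (subst card_Un_disjoint) auto
          ultimately have "n \<ge> 4" using n by linarith
          then have "1 * 2 \<le> (n - 1) * (n + 2)" by (intro mult_le_mono) auto
          then show ?thesis by simp
        qed
        have "2 * card Y \<le> 2 + ((n - 1) * (n + 2) - 2) + 2 * (n + 1)"
          using S by (intro so.reduced_card_step[OF a Y K3]) force+
        also have "2 + (k - 2) + 2 * (n + 1) = 2 + k + 2 * n" if "2 \<le> k" for k :: nat using that by arith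
        note this[OF ge2]
        finally show ?thesis using fin[OF n0] by simp
      qed
    qed
  qed
qed

end

section \<open>Determinants of families of vectors\<close>

text \<open>
  The determinant of a family of vectors, written as rows. Indexing by arbitrary functions makes
  reordering, scaling and replacing members of the family convenient.
\<close>
definition rows_det :: "nat \<Rightarrow> (nat \<Rightarrow> nat \<Rightarrow> 'a) \<Rightarrow> 'a::comm_ring_1" where
  "rows_det m e = det (mat m m (\<lambda>(j, i). e j i))"

lemma rows_det_cong: "(\<And>i j. i < m \<Longrightarrow> j < m \<Longrightarrow> e j i = f j i) \<Longrightarrow> rows_det m e = rows_det m f"
  unfolding rows_det_def by (intro arg_cong[where f = det] eq_matI) auto

lemma rows_det_reindex:
  fixes h :: "'b \<Rightarrow> nat \<Rightarrow> 'a::linordered_idom"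
  assumes p: "bij_betw p {..<m} J" and q: "bij_betw q {..<m} J"
  shows "\<bar>rows_det m (\<lambda>j. h (p j))\<bar> = \<bar>rows_det m (\<lambda>j. h (q j))\<bar>"
proof -
  define s where "s j = (if j < m then inv_into {..<m} q (p j) else j)" for j
  have "bij_betw (inv_into {..<m} q \<circ> p) {..<m} {..<m}"
    using bij_betw_trans[OF p bij_betw_inv_into[OF q]] .
  then have "bij_betw s {..<m} {..<m}" by (rule bij_betw_cong[THEN iffD1, rotated]) (simp add: s_def)
  then have s: "s permutes {0..<m}"
    by (intro bij_imp_permutes) (auto simp: s_def lessThan_atLeast0)
  have qs: "q (s j) = p j" if "j < m" for j
  proof -
    have "p j \<in> q ` {..<m}" using bij_betw_imp_surj_on[OF q] bij_betw_apply[OF p, of j] that by auto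
    then show ?thesis using that by (simp add: s_def f_inv_into_f)
  qed
  have lt: "s j < m" if "j < m" for j using permutes_in_image[OF s, of j] that by auto
  let ?M = "mat m m (\<lambda>(j, i). h (q j) i)"
  have "rows_det m (\<lambda>j. h (p j)) = det (mat m m (\<lambda>(j, i). ?M $$ (s j, i)))"
    unfolding rows_det_def by (intro arg_cong[where f = det] eq_matI) (auto simp: qs lt)
  also have "\<dots> = signof s * rows_det m (\<lambda>j. h (q j))"
    unfolding rows_det_def by (rule det_permute_rows[OF _ s]) simp
  finally show ?thesis by (simp add: abs_mult sign_def)
qed

lemma rows_det_scale:
  "rows_det m (\<lambda>j i. c j * e j i) = prod c {..<m} * rows_det m e"
proof -
  let ?a = "\<lambda>j. vec m (e j)"
  have eq: "rows_det m e' = det (mat\<^sub>r m m (\<lambda>j. vec m (e' j)))" for e' :: "nat \<Rightarrow> nat \<Rightarrow> 'a"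
    unfolding rows_det_def by (intro arg_cong[where f = det] eq_matI) auto
  have "rows_det m (\<lambda>j i. c j * e j i) = det (mat\<^sub>r m m (\<lambda>j. c j \<cdot>\<^sub>v ?a j))"
    unfolding eq by (intro arg_cong[where f = det] eq_matI) auto
  also have "\<dots> = prod c {0..<m} * det (mat\<^sub>r m m ?a)" by (rule det_rows_mul) auto
  finally show ?thesis by (simp add: eq lessThan_atLeast0)
qed

lemma rows_det_repeat:
  assumes "j < m" "k < m" "j \<noteq> k" "\<And>i. i < m \<Longrightarrow> e j i = e k i" shows "rows_det m e = 0"
  unfolding rows_det_def using assms
  by (intro det_identical_rows[of _ m j k]) (auto intro!: eq_vecI)

lemma rows_det_cramer:
  assumes k: "k < m" and v: "\<And>i. i < m \<Longrightarrow> v i = (\<Sum>j<m. c j * e j i)"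
  shows "rows_det m (e(k := v)) = c k * rows_det m e"
proof -
  let ?M = "mat m m (\<lambda>(i, j). e j i)" let ?c = "vec m c"
  have tr: "rows_det m f = det (mat m m (\<lambda>(i, j). f j i))" for f :: "nat \<Rightarrow> nat \<Rightarrow> 'a"
  proof -
    have "mat m m (\<lambda>(j, i). f j i) = transpose_mat (mat m m (\<lambda>(i, j). f j i))"
      by (intro eq_matI) auto
    then show ?thesis unfolding rows_det_def by (metis det_transpose mat_carrier)
  qed
  have "replace_col ?M (?M *\<^sub>v ?c) k = mat m m (\<lambda>(i, j). (e(k := v)) j i)"
    by (intro eq_matI) (auto simp: replace_col_def v scalar_prod_def lessThan_atLeast0 mult.commute)
  then show ?thesis using cramer_lemma_mat[of ?M m ?c k] k by (simp add: tr)
qed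

lemma rows_det_zero_iff:
  fixes e :: "nat \<Rightarrow> nat \<Rightarrow> 'a::field"
  shows "rows_det m e = 0 \<longleftrightarrow> (\<exists>c. (\<exists>j<m. c j \<noteq> 0) \<and> (\<forall>i<m. (\<Sum>j<m. c j * e j i) = 0))"
proof -
  let ?M = "mat m m (\<lambda>(i, j). e j i)"
  have "mat m m (\<lambda>(j, i). e j i) = transpose_mat ?M" by (intro eq_matI) auto
  then have d: "rows_det m e = det ?M" unfolding rows_det_def by (metis det_transpose mat_carrier)
  have *: "?M *\<^sub>v w = 0\<^sub>v m \<longleftrightarrow> (\<forall>i<m. (\<Sum>j<m. w $ j * e j i) = 0)" if "w \<in> carrier_vec m" for w
    using that by (auto simp: vec_eq_iff scalar_prod_def lessThan_atLeast0 mult.commute)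
  have nz: "w \<noteq> 0\<^sub>v m \<longleftrightarrow> (\<exists>j<m. w $ j \<noteq> 0)" if "w \<in> carrier_vec m" for w
    using that by (auto simp: vec_eq_iff)
  show ?thesis unfolding d det_0_iff_vec_prod_zero_field[of ?M m, OF mat_carrier]
  proof safe
    fix w assume "w \<in> carrier_vec m" "w \<noteq> 0\<^sub>v m" "?M *\<^sub>v w = 0\<^sub>v m"
    then show "\<exists>c. (\<exists>j<m. c j \<noteq> 0) \<and> (\<forall>i<m. (\<Sum>j<m. c j * e j i) = 0)"
      using * nz by (intro exI[of _ "\<lambda>j. w $ j"]) auto
  next
    fix c j assume c: "\<forall>i<m. (\<Sum>j<m. c j * e j i) = 0" "j < m" "c j \<noteq> 0"
    have "(\<forall>i<m. (\<Sum>j<m. vec m c $ j * e j i) = 0)" using c by simp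
    then show "\<exists>v. v \<in> carrier_vec m \<and> v \<noteq> 0\<^sub>v m \<and> ?M *\<^sub>v v = 0\<^sub>v m"
      using *[of "vec m c"] c(2,3) by (intro exI[of _ "vec m c"]) (auto dest!: arg_cong[where f = "\<lambda>w. w $ j"])
  qed
qed

lemma sum_fun_apply: "(sum f I) x = (\<Sum>i\<in>I. f i x)"
  by (induction I rule: infinite_finite_induct) auto

text \<open>
  Vectors of all dimensions live in one vector space of functions, so that no type depends on \<open>m\<close>.
\<close>
interpretation fun_space: vector_space "\<lambda>(r::real) (f::nat \<Rightarrow> real) i. r * f i"
  by unfold_locales (auto simp: fun_eq_iff algebra_simps)

definition supp_vecs :: "nat \<Rightarrow> (nat \<Rightarrow> real) set" where
  "supp_vecs m = {f. \<forall>i\<ge>m. f i = 0}"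

lemma card_le_of_independent:
  assumes "fun_space.independent B" "B \<subseteq> supp_vecs m"
  shows "finite B \<and> card B \<le> m"
proof -
  let ?U = "(\<lambda>k i. if i = k then 1 else 0::real) ` {..<m}"
  have "f \<in> fun_space.span ?U" if "f \<in> supp_vecs m" for f
  proof -
    have "f = (\<Sum>k<m. (\<lambda>i. f k * (if i = k then 1 else 0)))"
      using that by (auto simp: fun_eq_iff sum_fun_apply supp_vecs_def if_distrib[where f = "\<lambda>x. _ * x"] cong: if_cong)
    also have "\<dots> \<in> fun_space.span ?U"
      by (intro fun_space.span_sum fun_space.span_scale fun_space.span_base) auto
    finally show ?thesis .
  qed
  then have "finite B \<and> card B \<le> card ?U"
    using assms by (intro fun_space.independent_span_bound) auto
  moreover have "card ?U \<le> m" using card_image_le[of "{..<m}"] by force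
  ultimately show ?thesis by simp
qed

lemma rows_det_independent:
  assumes e: "bij_betw e {..<m} B" and B: "B \<subseteq> supp_vecs m"
  shows "rows_det m e \<noteq> 0 \<longleftrightarrow> fun_space.independent B"
proof -
  have fin: "finite B" using e bij_betw_finite by blast
  have sum: "(\<Sum>b\<in>B. (\<lambda>i. u b * b i)) i = (\<Sum>j<m. u (e j) * e j i)" for u i
    using sum.reindex_bij_betw[OF e, of "\<lambda>b. u b * b i"] by (simp add: sum_fun_apply)
  have z: "e j i = 0" if "j < m" "i \<ge> m" for i j
    using that B bij_betw_apply[OF e, of j] by (auto simp: supp_vecs_def)
  have eq: "(\<Sum>b\<in>B. (\<lambda>i. u b * b i)) = 0 \<longleftrightarrow> (\<forall>i<m. (\<Sum>j<m. u (e j) * e j i) = 0)" for u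
    unfolding fun_eq_iff sum using z by (metis (mono_tags, lifting) lessThan_iff linorder_not_less mult_zero_right sum.neutral zero_fun_apply)
  show ?thesis unfolding rows_det_zero_iff fun_space.dependent_finite[OF fin] eq
  proof safe
    fix u b assume "\<nexists>c. (\<exists>j<m. c j \<noteq> 0) \<and> (\<forall>i<m. (\<Sum>j<m. c j * e j i) = 0)"
      "b \<in> B" "u b \<noteq> 0" "\<forall>i<m. (\<Sum>j<m. u (e j) * e j i) = 0"
    moreover obtain j where "j < m" "e j = b" using \<open>b \<in> B\<close> bij_betw_imp_surj_on[OF e] by auto
    ultimately show False by (auto dest!: spec[of _ "\<lambda>j. u (e j)"])
  next
    fix c j assume *: "\<nexists>u. (\<exists>v\<in>B. u v \<noteq> 0) \<and> (\<forall>i<m. (\<Sum>j<m. u (e j) * e j i) = 0)"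
      "\<forall>i<m. (\<Sum>j<m. c j * e j i) = 0" "j < m" "c j \<noteq> 0"
    have inv: "inv_into {..<m} e (e k) = k" if "k < m" for k
      using that e by (auto simp: bij_betw_def inv_into_f_f)
    let ?u = "\<lambda>b. c (inv_into {..<m} e b)"
    have "e j \<in> B" "?u (e j) \<noteq> 0" using * inv bij_betw_apply[OF e, of j] by auto
    moreover have "(\<Sum>j<m. ?u (e j) * e j i) = 0" if "i < m" for i
      using *(2) that inv by simp
    ultimately have "\<exists>u. (\<exists>v\<in>B. u v \<noteq> 0) \<and> (\<forall>i<m. (\<Sum>j<m. u (e j) * e j i) = 0)"
      by (intro exI[of _ ?u] conjI bexI[of _ "e j"] allI impI)
    then show False using *(1) by (rule notE[rotated])
  qed
qed

text \<open>
  The absolute value of the determinant does not depend on the enumeration of \<open>B\<close> that is chosen.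
\<close>
definition set_vol :: "nat \<Rightarrow> (nat \<Rightarrow> real) set \<Rightarrow> real" where
  "set_vol m B = \<bar>rows_det m (SOME e. bij_betw e {..<m} B)\<bar>"

lemma set_vol: assumes "bij_betw e {..<m} B" shows "set_vol m B = \<bar>rows_det m e\<bar>"
proof -
  have "bij_betw (SOME e. bij_betw e {..<m} B) {..<m} B" 
    using assms by (rule someI[where P = "\<lambda>e. bij_betw e {..<m} B"])
  from rows_det_reindex[OF this assms, of id] show ?thesis by (simp add: set_vol_def id_def)
qed

section \<open>The columns of an integer matrix\<close>

definition embed :: "nat \<Rightarrow> int vec \<Rightarrow> nat \<Rightarrow> real" where
  "embed m v = (\<lambda>i. if i < m then real_of_int (v $ i) else 0)"

text \<open>
  The index sets of a submatrix are arbitrary sets of natural numbers, of which only the parts below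
  the dimensions matter.
\<close>
lemma minors_finite:
  "finite {\<bar>det B\<bar> |B. B \<in> carrier_mat (dim_row A) (dim_row A) \<and> (\<exists>I J. B = submatrix A I J)}"
proof -
  let ?m = "dim_row A" let ?n = "dim_col A"
  let ?F = "\<lambda>(I, J). \<bar>det (submatrix A I J)\<bar>"
  have eq: "submatrix A I J = submatrix A (I \<inter> {..<?m}) (J \<inter> {..<?n})" for I J
  proof -
    have sets: "{i. i < ?m \<and> i \<in> I} = {i. i < ?m \<and> i \<in> I \<inter> {..<?m}}" "{i. i < ?n \<and> i \<in> J} = {i. i < ?n \<and> i \<in> J \<inter> {..<?n}}"
      "I \<inter> {..<?m} = {i. i < ?m \<and> i \<in> I}" "J \<inter> {..<?n} = {i. i < ?n \<and> i \<in> J}" by auto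
    show ?thesis unfolding submatrix_def sets(1)[symmetric] sets(2)[symmetric]
      by (intro eq_matI) (auto simp: pick_reduce_set sets(3,4))
  qed
  have "{\<bar>det B\<bar> |B. B \<in> carrier_mat ?m ?m \<and> (\<exists>I J. B = submatrix A I J)} \<subseteq>
      ?F ` (Pow {..<?m} \<times> Pow {..<?n})" 
  proof (intro subsetI)
    fix x assume "x \<in> {\<bar>det B\<bar> |B. B \<in> carrier_mat ?m ?m \<and> (\<exists>I J. B = submatrix A I J)}"
    then obtain I J where "x = \<bar>det (submatrix A I J)\<bar>" by blast
    then have "x = ?F (I \<inter> {..<?m}, J \<inter> {..<?n})" using eq[of I J] by simp
    then show "x \<in> ?F ` (Pow {..<?m} \<times> Pow {..<?n})" by blast
  qed
  then show ?thesis by (rule finite_subset) auto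
qed

text \<open>
  Submatrices list their columns in increasing order; any other order changes only the sign.
\<close>
lemma minor_le_max_minor:
  assumes m: "dim_row A = m" and g: "inj_on g {..<m}" "\<And>j. j < m \<Longrightarrow> g j < dim_col A"
  shows "\<bar>rows_det m (\<lambda>j i. A $$ (i, g j))\<bar> \<le> max_minor A"
proof -
  define J where "J = g ` {..<m}"
  have J: "{j. j < dim_col A \<and> j \<in> J} = J" "card J = m" using g by (auto simp: J_def card_image)
  let ?B = "submatrix A UNIV J"
  have B: "?B \<in> carrier_mat m m" unfolding carrier_mat_def by (simp add: dim_submatrix J m)
  have inj: "inj_on (pick J) {..<m}"
  proof (rule inj_onI)
    fix x y assume "x \<in> {..<m}" "y \<in> {..<m}" "pick J x = pick J y"
    then show "x = y" using pick_mono_le[of x J y] pick_mono_le[of y J x] J(2)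
      by (metis lessThan_iff less_irrefl linorder_neqE_nat)
  qed
  have "J = pick J ` {..<m}"
  proof (rule card_subset_eq[symmetric])
    show "finite J" by (simp add: J_def)
    show "pick J ` {..<m} \<subseteq> J" using pick_in_set_le[of _ J] J(2) by blast
    show "card (pick J ` {..<m}) = card J" using inj by (simp add: card_image J)
  qed
  then have "bij_betw (pick J) {..<m} J" "bij_betw g {..<m} J"
    using g inj by (auto simp: bij_betw_def J_def)
  from rows_det_reindex[OF this, of "\<lambda>c i. A $$ (i, c)"]
  have "\<bar>rows_det m (\<lambda>j i. A $$ (i, g j))\<bar> = \<bar>rows_det m (\<lambda>j i. A $$ (i, pick J j))\<bar>" by simp
  also have "rows_det m (\<lambda>j i. A $$ (i, pick J j)) = det (transpose_mat ?B)"
    unfolding rows_det_def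
    by (intro arg_cong[where f = det] eq_matI) (simp_all add: dim_submatrix submatrix_index pick_UNIV J m)
  also have "\<dots> = det ?B" by (rule det_transpose[OF B])
  finally have "\<bar>rows_det m (\<lambda>j i. A $$ (i, g j))\<bar> = \<bar>det ?B\<bar>" .
  moreover have "\<bar>det ?B\<bar> \<in> {\<bar>det B\<bar> |B. B \<in> carrier_mat m m \<and> (\<exists>I J. B = submatrix A I J)}"
    using B by blast
  ultimately show ?thesis unfolding max_minor_def m using Max_ge[OF minors_finite[of A]] m by simp
qed

lemma full_row_rank_basis:
  assumes m: "dim_row A = m" and r: "full_row_rank A"
  shows "\<exists>g. (\<forall>j<m. g j < dim_col A) \<and> rows_det m (\<lambda>j. embed m (col A (g j))) \<noteq> 0"
proof -
  interpret V: vec_space "TYPE(real)" m .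
  let ?A = "map_mat real_of_int A"
  have A: "?A \<in> carrier_mat m (dim_col A)" using m by auto
  define S where "S = (SOME S. maximal S (\<lambda>T. T \<subseteq> set (cols ?A) \<and> V.lin_indpt T))"
  have "\<exists>S. finite S \<and> maximal S (\<lambda>T. T \<subseteq> set (cols ?A) \<and> V.lin_indpt T) \<and> {} \<subseteq> S"
    by (rule maximal_exists_superset[of "set (cols ?A)"]) (auto simp: V.lin_dep_def)
  then obtain S where S: "finite S" "maximal S (\<lambda>T. T \<subseteq> set (cols ?A) \<and> V.lin_indpt T)" by blast
  have card: "card S = m" using V.rank_card_indpt[OF A S(2)] r m unfolding full_row_rank_def by simp
  have S': "S \<subseteq> set (cols ?A)" "V.lin_indpt S" using S(2) unfolding maximal_def by auto
  obtain xs where xs: "set xs = S" "distinct xs" using finite_distinct_list[OF S(1)] by blast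
  have len: "length xs = m" using xs card distinct_card by fastforce
  have car: "set xs \<subseteq> carrier_vec m" using S' xs cols_dim[of ?A] m by auto
  let ?M = "mat_of_cols m xs"
  have M: "?M \<in> carrier_mat m m" using len by auto
  have "V.rank ?M = m" by (rule V.lin_indpt_full_rank[OF M]) (use xs S' car in simp_all)
  then have det: "det ?M \<noteq> 0" using V.det_rank_iff[OF M] by simp
  have "\<exists>k<dim_col A. xs ! j = col ?A k" if "j < m" for j
  proof -
    have "xs ! j \<in> set (cols ?A)" using that len xs S' nth_mem by blast
    then show ?thesis by (auto simp: in_set_conv_nth)
  qed
  then obtain g where g: "\<And>j. j < m \<Longrightarrow> g j < dim_col A \<and> xs ! j = col ?A (g j)" by metis
  have "rows_det m (\<lambda>j. embed m (col A (g j))) = det (transpose_mat ?M)"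
    unfolding rows_det_def using g len m
    by (intro arg_cong[where f = det] eq_matI) (auto simp: embed_def mat_of_cols_def)
  also have "\<dots> = det ?M" using M by (rule det_transpose)
  finally show ?thesis using g det by (intro exI[of _ g]) auto
qed

text \<open>
  The volume of a basis is, up to signs of columns, a nonzero minor of the integer matrix, hence \<open>1\<close> or
  \<open>2\<close>, and the exchange property is Cramer's rule.
\<close>
lemma signed_columns_volume_config:
  fixes A :: "int mat"
  assumes m: "dim_row A = m" and r: "full_row_rank A" and d: "max_minor A \<le> 2"
  defines "AA \<equiv> embed m ` set (cols A) \<union> uminus ` embed m ` set (cols A)"
  shows "volume_config (\<lambda>r f i. r * f i) AA (set_vol m)" and "fun_space.dim AA = m"
proof -
  have sub: "AA \<subseteq> supp_vecs m" by (auto simp: AA_def supp_vecs_def embed_def)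
  have AA_ex: "\<exists>k<dim_col A. \<exists>\<sigma>\<in>{1,-1::real}. \<forall>i<m. x i = \<sigma> * real_of_int (A $$ (i, k))" if x: "x \<in> AA" for x
  proof -
    obtain k \<sigma> where "k < dim_col A" "\<sigma> \<in> {1,-1::real}" "x = (\<lambda>i. \<sigma> * embed m (col A k) i)"
    proof -
      from x consider k where "k < dim_col A" "x = embed m (col A k)" | k where "k < dim_col A" "x = - embed m (col A k)"
        unfolding AA_def by (auto simp: in_set_conv_nth)
      then show ?thesis 
      proof cases
        case 1 then show ?thesis using that[of k 1] by simp
      next
        case 2 then show ?thesis using that[of k "-1"] by (simp add: fun_eq_iff)
      qed
    qed
    then show ?thesis using m by (auto simp: embed_def intro!: exI[of _ k] bexI[of _ \<sigma>])
  qed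
  have card: "card B = m \<and> finite B" if B: "B \<subseteq> AA" "fun_space.independent B" "AA \<subseteq> fun_space.span B" for B
  proof -
    have le: "finite B \<and> card B \<le> m" using card_le_of_independent B sub by blast
    obtain g where g: "\<And>j. j < m \<Longrightarrow> g j < dim_col A" and nz: "rows_det m (\<lambda>j. embed m (col A (g j))) \<noteq> 0"
      using full_row_rank_basis[OF m r] by blast
    let ?e = "\<lambda>j. embed m (col A (g j))"
    have "inj_on ?e {..<m}"
    proof (rule inj_onI, rule ccontr)
      fix j k assume *: "j \<in> {..<m}" "k \<in> {..<m}" "?e j = ?e k" "j \<noteq> k"
      then have "rows_det m ?e = 0" by (intro rows_det_repeat[of j m k]) auto
      then show False using nz by simp
    qed
    then have bij: "bij_betw ?e {..<m} (?e ` {..<m})" by (simp add: bij_betw_def)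
    have im: "?e ` {..<m} \<subseteq> AA" unfolding AA_def using g by (auto simp: cols_def)
    have "fun_space.independent (?e ` {..<m})" using rows_det_independent[OF bij] im sub nz by blast
    then have "card (?e ` {..<m}) \<le> card B"
      using fun_space.independent_span_bound[of B "?e ` {..<m}"] le im B by blast
    then show ?thesis using le bij_betw_same_card[OF bij] by simp
  qed
  have fin: "finite AA" by (simp add: AA_def)
  show "volume_config (\<lambda>r f i. r * f i) AA (set_vol m)"
  proof
    show "finite AA" by fact
    show "- x \<in> AA" if "x \<in> AA" for x using that by (auto simp: AA_def)
  next
    fix B assume B: "B \<subseteq> AA" "fun_space.independent B" "AA \<subseteq> fun_space.span B"
    obtain e where e: "bij_betw e {..<m} B"
      using card[OF B] ex_bij_betw_nat_finite[of B] by (auto simp: lessThan_atLeast0)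
    have nz: "rows_det m e \<noteq> 0" using rows_det_independent[OF e] B sub by blast
    have "\<forall>j\<in>{..<m}. \<exists>k \<sigma>. k < dim_col A \<and> \<sigma>\<in>{1,-1::real} \<and> (\<forall>i<m. e j i = \<sigma> * real_of_int (A $$ (i, k)))"
      using AA_ex bij_betw_apply[OF e] B by blast
    then obtain g \<sigma> where g: "\<And>j. j < m \<Longrightarrow> g j < dim_col A" "\<And>j. j < m \<Longrightarrow> \<sigma> j \<in> {1,-1::real}"
      "\<And>i j. i < m \<Longrightarrow> j < m \<Longrightarrow> e j i = \<sigma> j * real_of_int (A $$ (i, g j))" by (metis lessThan_iff)
    let ?D = "rows_det m (\<lambda>j i. A $$ (i, g j))"
    have "rows_det m e = rows_det m (\<lambda>j i. \<sigma> j * real_of_int (A $$ (i, g j)))"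
      using g by (intro rows_det_cong) auto
    also have "\<dots> = prod \<sigma> {..<m} * rows_det m (\<lambda>j i. real_of_int (A $$ (i, g j)))" by (rule rows_det_scale)
    also have "rows_det m (\<lambda>j i. real_of_int (A $$ (i, g j))) = real_of_int ?D"
      unfolding rows_det_def of_int_hom.hom_det[symmetric] by (intro arg_cong[where f = det] eq_matI) auto
    finally have D: "rows_det m e = prod \<sigma> {..<m} * real_of_int ?D" .
    have "\<bar>prod \<sigma> {..<m}\<bar> = 1" unfolding abs_prod using g(2) by (intro prod.neutral) force
    then have abs: "\<bar>rows_det m e\<bar> = real_of_int \<bar>?D\<bar>" unfolding D abs_mult by simp
    have "inj_on g {..<m}"
    proof (rule inj_onI, rule ccontr)
      fix j k assume "j \<in> {..<m}" "k \<in> {..<m}" "g j = g k" "j \<noteq> k"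
      then have "?D = 0" by (intro rows_det_repeat[of j m k]) auto
      then show False using nz D by simp
    qed
    then have "\<bar>?D\<bar> \<le> 2" using minor_le_max_minor[OF m, of g] g d by force
    moreover have "\<bar>?D\<bar> \<noteq> 0" using nz D by auto
    ultimately have "\<bar>?D\<bar> \<in> {1, 2}" by auto
    then show "set_vol m B \<in> {1, 2}" unfolding set_vol[OF e] abs by auto
    fix b v assume b: "b \<in> B" "v \<in> AA" "fun_space.representation B v b \<noteq> 0"
    obtain k where k: "k < m" "e k = b" using b bij_betw_imp_surj_on[OF e] by auto
    have vB: "v \<notin> B - {b}" using b B fun_space.representation_basis[of B v] by (auto split: if_splits)
    have e': "bij_betw (e(k := v)) {..<m} (insert v (B - {b}))"
    proof -
      have inj: "inj_on e {..<m}" "e ` {..<m} = B" using e by (auto simp: bij_betw_def)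
      have "(e(k := v)) ` {..<m} = insert v (e ` ({..<m} - {k}))" using k by auto
      also have "e ` ({..<m} - {k}) = B - {b}" using inj k by (subst inj_on_image_set_diff[of e "{..<m}"]) auto
      finally show ?thesis using inj k vB by (auto simp: bij_betw_def inj_on_def)
    qed
    have "(\<Sum>b\<in>B. (\<lambda>i. fun_space.representation B v b * b i)) = v"
      using fun_space.sum_representation_eq[of B v B] card[OF B] B b by auto
    then have "v i = (\<Sum>b\<in>B. fun_space.representation B v b * b i)" for i
      unfolding fun_eq_iff sum_fun_apply by simp
    then have "v i = (\<Sum>j<m. fun_space.representation B v (e j) * e j i)" for i
      using sum.reindex_bij_betw[OF e, of "\<lambda>b. fun_space.representation B v b * b i"] by simp
    from rows_det_cramer[OF k(1), of v "\<lambda>j. fun_space.representation B v (e j)" e, OF this]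
    show "set_vol m (insert v (B - {b})) = \<bar>fun_space.representation B v b\<bar> * set_vol m B"
      unfolding set_vol[OF e] set_vol[OF e'] by (simp add: abs_mult k)
  qed
  obtain B where B: "B \<subseteq> AA" "fun_space.independent B" "AA \<subseteq> fun_space.span B"
    by (rule fun_space.maximal_independent_subset[of AA]) (rule that)
  then show "fun_space.dim AA = m" using card[OF B] fun_space.basis_card_eq_dim[OF B(1,3,2)] by simp
qed

lemma differing_card:
  assumes "differing_columns d X" shows "size X = card (set_mset X)"
proof -
  have "count X a = 1" if "a \<in># X" for a
  proof (rule ccontr)
    assume "count X a \<noteq> 1"
    moreover have "count X a > 0" using that by simp
    ultimately have "count X a \<ge> 2" by linarith
    then have "{#a, a#} \<subseteq># X" by (auto simp: subseteq_mset_def)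
    then show False using assms by (auto simp: differing_columns_def differ_def)
  qed
  then show ?thesis by (simp add: size_multiset_overloaded_eq)
qed

lemma differing_columns_bound:
  assumes m: "dim_row A = m" and r: "delta_modular 2 A"
    and X: "X \<subseteq># mset (cols A)" "differing_columns m X"
  shows "2 * size X \<le> m * (m + 3)"
proof -
  define AA where "AA = embed m ` set (cols A) \<union> uminus ` embed m ` set (cols A)"
  have "full_row_rank A" "max_minor A \<le> 2" using r by (auto simp: delta_modular_def)
  note S = signed_columns_volume_config[OF m this, folded AA_def]
  interpret C: volume_config "\<lambda>r f i. r * f i" AA "set_vol m" by (rule S)
  have Xc: "x \<in> set (cols A)" "x \<in> carrier_vec m" "x \<noteq> 0\<^sub>v m" if "x \<in># X" for x
    using that X mset_subset_eqD[OF X(1) that] by (auto simp: differing_columns_def)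
  have eq: "embed m x = embed m y \<longleftrightarrow> x = y" if "x \<in> carrier_vec m" "y \<in> carrier_vec m" for x y
    using that by (auto simp: embed_def fun_eq_iff vec_eq_iff)
  have neg: "- embed m x = embed m (- x)" if "x \<in> carrier_vec m" for x
    using that by (auto simp: embed_def fun_eq_iff)
  have zero: "embed m (0\<^sub>v m) = 0" by (auto simp: embed_def)
  have diff: "x \<noteq> y \<Longrightarrow> x \<noteq> - y" if "x \<in># X" "y \<in># X" for x y
  proof -
    assume "x \<noteq> y"
    then have "{#x, y#} \<subseteq># X" using that by (auto simp: subseteq_mset_def count_greater_eq_one_iff)
    then show ?thesis using X(2) by (auto simp: differing_columns_def differ_def)
  qed
  let ?Y = "embed m ` set_mset X"
  have "C.reduced {} ?Y" unfolding C.reduced_def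
  proof (intro conjI ballI impI)
    show "?Y \<subseteq> AA" using Xc by (auto simp: AA_def)
  next
    fix y assume "y \<in> ?Y"
    then show "y \<notin> fun_space.span {}" using Xc eq[of _ "0\<^sub>v m"] zero by auto
  next
    fix y z assume "y \<in> ?Y" "z \<in> ?Y" "y \<noteq> z"
    then show "y - z \<notin> fun_space.span {}" by auto
  next
    fix y z assume yz: "y \<in> ?Y" "z \<in> ?Y" "y \<noteq> z"
    then obtain a b where ab: "a \<in># X" "b \<in># X" "y = embed m a" "z = embed m b" "a \<noteq> b" by auto
    then have "y \<noteq> - z" using diff[of a b] Xc eq[of a "- b"] neg[of b] by auto
    then show "y + z \<notin> fun_space.span {}" by (auto simp: eq_neg_iff_add_eq_0)
  qed
  then have "2 * card ?Y \<le> m * (m + 3)"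
    using C.reduced_card[of "{}" ?Y m] S(2) by (simp add: fun_space.independent_empty)
  moreover have "card ?Y = size X" unfolding differing_card[OF X(2)]
    using Xc eq by (intro card_image) (auto simp: inj_on_def)
  ultimately show ?thesis by simp
qed

section \<open>Network matrices and the extremal columns\<close>

text \<open>
  A column of a network matrix, that is, of the signed incidence matrix of a directed graph, possibly
  with one end of an arc deleted.
\<close>
definition network :: "nat \<Rightarrow> (nat \<Rightarrow> int) \<Rightarrow> bool" where
  "network n f \<longleftrightarrow> (\<forall>i<n. f i \<in> {-1, 0, 1}) \<and> (\<forall>i<n. \<forall>k<n. f i = f k \<and> f i \<noteq> 0 \<longrightarrow> i = k)"

lemma network_single:
  assumes f: "network n f" and s: "(\<Sum>i<n. f i) \<noteq> 0"
  obtains k where "k < n" "f k \<in> {1, -1}" "\<And>i. i < n \<Longrightarrow> i \<noteq> k \<Longrightarrow> f i = 0"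
proof -
  obtain k where k: "k < n" "f k \<noteq> 0" using s by (metis lessThan_iff sum.neutral)
  have "f i = 0" if i: "i < n" "i \<noteq> k" for i
  proof (rule ccontr)
    assume "f i \<noteq> 0"
    moreover from this have "f i \<noteq> f k" using f i k unfolding network_def by blast
    moreover have "f i \<in> {-1, 0, 1}" "f k \<in> {-1, 0, 1}" using f i k unfolding network_def by blast+
    ultimately have fi: "f i + f k = 0" "f i \<noteq> 0" using k by auto
    have "f l = 0" if "l < n" "l \<noteq> i" "l \<noteq> k" for l
    proof (rule ccontr)
      assume l: "f l \<noteq> 0"
      then have "f l \<noteq> f i" "f l \<noteq> f k" using f i k that unfolding network_def by blast+
      moreover have "f l \<in> {-1, 0, 1}" "f i \<in> {-1, 0, 1}" "f k \<in> {-1, 0, 1}"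
        using f i k that unfolding network_def by blast+
      ultimately show False using l fi k by auto
    qed
    then have "(\<Sum>l<n. f l) = (\<Sum>l\<in>{i, k}. f l)" using i k by (intro sum.mono_neutral_right) auto
    then show False using s fi(1) i by simp
  qed
  then show thesis using that[of k] k f unfolding network_def by blast
qed

lemma network_reindex:
  assumes "network m f" "inj_on s {..<n}" "\<And>i. i < n \<Longrightarrow> s i < m"
  shows "network n (\<lambda>i. f (s i))"
  using assms unfolding network_def inj_on_def by (metis lessThan_iff)

text \<open>
  Total unimodularity of network matrices. If every vector has sum zero, the all-ones vector is
  orthogonal to all of them; otherwise some vector has a single nonzero entry, and the expansion along it
  leaves a smaller network matrix.
\<close>
lemma network_det:
  assumes "\<And>j. j < n \<Longrightarrow> network n (e j)"
  shows "\<bar>rows_det n e\<bar> \<le> 1"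
  using assms
proof (induction n arbitrary: e)
  case 0
  then show ?case by (simp add: rows_det_def)
next
  case (Suc n)
  let ?M = "mat (Suc n) (Suc n) (\<lambda>(j, i). e j i)"
  show ?case
  proof (cases "\<exists>j<Suc n. (\<Sum>i<Suc n. e j i) \<noteq> 0")
    case True
    then obtain j where j: "j < Suc n" "(\<Sum>i<Suc n. e j i) \<noteq> 0" by blast
    obtain k where k: "k < Suc n" "e j k \<in> {1, -1}" "\<And>i. i < Suc n \<Longrightarrow> i \<noteq> k \<Longrightarrow> e j i = 0"
      using network_single[OF Suc.prems[OF j(1)] j(2)] by blast
    let ?s = "\<lambda>a b. if b < a then b else Suc b"
    let ?e = "\<lambda>a b. e (?s j a) (?s k b)"
    have net: "network n (?e a)" if "a < n" for a
      by (rule network_reindex[OF Suc.prems]) (use that in \<open>auto simp: inj_on_def split: if_splits\<close>)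
    have "rows_det (Suc n) e = (\<Sum>i<Suc n. ?M $$ (j, i) * cofactor ?M j i)"
      unfolding rows_det_def by (rule laplace_expansion_row) (use j in auto)
    also have "\<dots> = (\<Sum>i\<in>{k}. ?M $$ (j, i) * cofactor ?M j i)"
      using j k by (intro sum.mono_neutral_right) auto
    also have "\<dots> = e j k * cofactor ?M j k" using j k by simp
    also have "cofactor ?M j k = (-1) ^ (j + k) * rows_det n ?e"
      unfolding cofactor_def rows_det_def
      by (intro arg_cong[where f = "\<lambda>x. _ * det x"] eq_matI) (auto simp: mat_delete_def)
    finally have "\<bar>rows_det (Suc n) e\<bar> = \<bar>rows_det n ?e\<bar>" using k(2) by (auto simp: abs_mult power_abs)
    then show ?thesis using Suc.IH[of ?e] net by simp
  next
    case False
    have "?M *\<^sub>v vec (Suc n) (\<lambda>_. 1) = 0\<^sub>v (Suc n)"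
      using False by (intro eq_vecI) (auto simp: scalar_prod_def lessThan_atLeast0)
    moreover have "vec (Suc n) (\<lambda>_. 1) \<noteq> (0\<^sub>v (Suc n) :: int vec)" by (auto dest!: arg_cong[where f = "\<lambda>w. w $ 0"])
    moreover have "vec (Suc n) (\<lambda>_. 1 :: int) \<in> carrier_vec (Suc n)" by simp
    ultimately have "det ?M = 0" using det_0_iff_vec_prod_zero[OF mat_carrier, of "Suc n" "\<lambda>(j, i). e j i"] by blast
    then show ?thesis by (simp add: rows_det_def)
  qed
qed

lemma rows_det_add_first:
  assumes "m \<ge> 1" "\<And>j. j < m \<Longrightarrow> e j 0 = p j + q j"
  shows "rows_det m e = rows_det m (\<lambda>j. (e j)(0 := p j)) + rows_det m (\<lambda>j. (e j)(0 := q j))"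
proof -
  define C where "C j = cofactor (mat m m (\<lambda>(j, i). e j i)) j 0" for j
  have *: "rows_det m (\<lambda>j. (e j)(0 := r j)) = (\<Sum>j<m. r j * C j)" for r
  proof -
    let ?M = "mat m m (\<lambda>(j, i). ((e j)(0 := r j)) i)"
    have "rows_det m (\<lambda>j. (e j)(0 := r j)) = (\<Sum>j<m. ?M $$ (j, 0) * cofactor ?M j 0)"
      unfolding rows_det_def by (rule laplace_expansion_column) (use assms in auto)
    also have "\<dots> = (\<Sum>j<m. r j * C j)"
    proof (rule sum.cong[OF refl])
      fix j assume j: "j \<in> {..<m}"
      have "mat_delete ?M j 0 = mat_delete (mat m m (\<lambda>(j, i). e j i)) j 0"
        by (intro eq_matI) (auto simp: mat_delete_def)
      then show "?M $$ (j, 0) * cofactor ?M j 0 = r j * C j"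
        using j assms(1) by (simp add: C_def cofactor_def)
    qed
    finally show ?thesis .
  qed
  have "rows_det m e = rows_det m (\<lambda>j. (e j)(0 := p j + q j))"
    using assms by (intro rows_det_cong) auto
  then show ?thesis unfolding * by (simp add: algebra_simps sum.distrib)
qed

text \<open>
  The index \<open>(i, j, s)\<close> stands for the vector that is \<open>s\<close> at position \<open>0\<close> and agrees with
  \<open>e\<^sub>j - e\<^sub>i\<close> elsewhere. Position \<open>0\<close> plays a double role: \<open>i = 0\<close> means that nothing is subtracted, and
  only then a nonzero \<open>s\<close> is allowed. Thus the family consists of \<open>e\<^sub>j - e\<^sub>i\<close> for
  \<open>0 < i < j\<close>, of \<open>e\<^sub>j + s e\<^sub>0\<close> with \<open>s \<in> {0, 1, 2}\<close> and \<open>0 < j\<close>, and of \<open>e\<^sub>0\<close> and \<open>2 e\<^sub>0\<close>.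
\<close>
definition extremal_index :: "nat \<Rightarrow> (nat \<times> nat \<times> int) set" where
  "extremal_index m = {(i, j, s). j < m \<and> (i < j \<and> s = 0 \<or> i = 0 \<and> s \<in> {1, 2})}"

fun extremal_vec :: "nat \<times> nat \<times> int \<Rightarrow> nat \<Rightarrow> int" where
  "extremal_vec (i, j, s) = (\<lambda>k. if k = 0 then s else (if k = j then 1 else 0) - (if k = i then 1 else 0))"

definition extremal_cols :: "nat \<Rightarrow> int vec set" where
  "extremal_cols m = (\<lambda>x. vec m (extremal_vec x)) ` extremal_index m"

text \<open>
  The determinant is linear in the entries at position \<open>0\<close>, and an entry from \<open>{0, 1, 2}\<close> is a sum of two
  entries from \<open>{0, 1}\<close>. For such entries the negated position \<open>0\<close> completes the vectors to network
  vectors, because a nonzero entry occurs there only if nothing is subtracted elsewhere.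
\<close>
lemma extremal_det:
  assumes m: "m \<ge> 1" and e: "\<And>j. j < m \<Longrightarrow> vec m (e j) \<in> extremal_cols m"
  shows "\<bar>rows_det m e\<bar> \<le> 2"
proof -
  have "\<forall>j\<in>{..<m}. \<exists>x\<in>extremal_index m. vec m (e j) = vec m (extremal_vec x)"
    using e by (auto simp: extremal_cols_def)
  then obtain x where x: "\<And>j. j < m \<Longrightarrow> x j \<in> extremal_index m"
    "\<And>j. j < m \<Longrightarrow> vec m (e j) = vec m (extremal_vec (x j))" by (metis lessThan_iff)
  have xe: "e j i = extremal_vec (x j) i" if "i < m" "j < m" for i j
    using x(2)[OF that(2)] that by (metis index_vec)
  have bound: "\<bar>rows_det m (\<lambda>j. (e j)(0 := t j))\<bar> \<le> 1" if t: "\<And>j. j < m \<Longrightarrow> t j \<in> {0, 1} \<and> t j \<le> e j 0" for t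
  proof -
    have "rows_det m (\<lambda>j. (e j)(0 := 0)) = rows_det m (\<lambda>j. (e j)(0 := t j)) + rows_det m (\<lambda>j. (e j)(0 := - t j))"
      using rows_det_add_first[OF m, of "\<lambda>j. (e j)(0 := 0)" t "\<lambda>j. - t j"] by (simp add: fun_upd_def cong: if_cong)
    moreover have "rows_det m (\<lambda>j. (e j)(0 := 0)) = 0"
      using rows_det_add_first[OF m, of "\<lambda>j. (e j)(0 := 0)" "\<lambda>j. 0" "\<lambda>j. 0"] by (simp add: fun_upd_def cong: if_cong)
    moreover have "\<bar>rows_det m (\<lambda>j. (e j)(0 := - t j))\<bar> \<le> 1"
    proof (rule network_det)
      fix j assume j: "j < m"
      obtain a b s where xj: "x j = (a, b, s)" by (cases "x j") auto
      have "e j 0 = s" using xe[of 0 j] j m xj by simp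
      then have cs: "b < m \<and> (a < b \<and> s = 0 \<or> a = 0 \<and> s \<in> {1, 2})" "t j \<in> {0, 1}" "t j \<le> s"
        using x(1)[OF j] t[OF j] xj by (auto simp: extremal_index_def)
      have "((e j)(0 := - t j)) i = (if i = 0 then - t j else (if i = b then 1 else 0) - (if i = a then 1 else 0))"
        if "i < m" for i using xe[OF that j] xj by simp
      then have f: "((e j)(0 := - t j)) i = (if i = 0 then - t j else if i = b then 1 else if i = a then -1 else 0)"
        if "i < m" for i using cs that by auto
      have "t j = 0 \<or> t j = 1 \<and> a = 0" using cs by auto
      then show "network m ((e j)(0 := - t j))"
      proof
        assume "t j = 0"
        then show ?thesis unfolding network_def using f by (simp split: if_split)
      next
        assume "t j = 1 \<and> a = 0"
        then show ?thesis unfolding network_def using f by (simp split: if_split)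
      qed
    qed
    ultimately show ?thesis by linarith
  qed
  define p q where "p j = (if e j 0 \<ge> 1 then 1 else 0::int)" and "q j = (if e j 0 = 2 then 1 else 0::int)" for j
  have s: "e j 0 \<in> {0, 1, 2}" if "j < m" for j
    using x(1)[OF that] xe[of 0 j] m that by (cases "x j") (auto simp: extremal_index_def)
  have p: "p j \<in> {0, 1} \<and> p j \<le> e j 0" and q: "q j \<in> {0, 1} \<and> q j \<le> e j 0"
    and pq: "e j 0 = p j + q j" if "j < m" for j
    using s[OF that] by (auto simp: p_def q_def)
  have "rows_det m e = rows_det m (\<lambda>j. (e j)(0 := p j)) + rows_det m (\<lambda>j. (e j)(0 := q j))"
    using pq by (rule rows_det_add_first[OF m])
  moreover have "\<bar>rows_det m (\<lambda>j. (e j)(0 := p j))\<bar> \<le> 1" using p by (rule bound)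
  moreover have "\<bar>rows_det m (\<lambda>j. (e j)(0 := q j))\<bar> \<le> 1" using q by (rule bound)
  ultimately show ?thesis by linarith
qed

lemma card_extremal_index: "2 * card (extremal_index m) = m * (m + 3)" and finite_extremal_index: "finite (extremal_index m)"
proof -
  let ?P = "(\<lambda>(j, i). (i, j, 0::int)) ` (SIGMA j:{..<m}. {..<j})" let ?Q = "(\<lambda>(j, s). (0::nat, j, s::int)) ` ({..<m} \<times> {1, 2})"
  have eq: "extremal_index m = ?P \<union> ?Q" by (auto simp: extremal_index_def image_iff)
  show "finite (extremal_index m)" unfolding eq by auto
  have "card (extremal_index m) = card ?P + card ?Q" unfolding eq by (intro card_Un_disjoint) auto
  also have "card ?P = (\<Sum>j<m. j)" by (subst card_image) (auto simp: inj_on_def)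
  also have "card ?Q = 2 * m" by (subst card_image) (auto simp: inj_on_def)
  moreover have "2 * (\<Sum>j<m. j) + m = m * m" by (induction m) auto
  ultimately show "2 * card (extremal_index m) = m * (m + 3)" by (simp add: algebra_simps)
qed

text \<open>
  For \<open>\<sigma> = -1\<close> the positions of the entries \<open>1\<close> and \<open>-1\<close> would be interchanged, against \<open>i < j\<close>.
\<close>
lemma extremal_vec_differ:
  assumes m: "m \<ge> 1" and x: "x \<in> extremal_index m" and y: "y \<in> extremal_index m"
    and \<sigma>: "\<sigma> \<in> {1, -1}" and eq: "\<And>k. k < m \<Longrightarrow> extremal_vec x k = \<sigma> * extremal_vec y k"
  shows "x = y \<and> \<sigma> = 1"
proof -
  obtain i j s i' j' s' where xy: "x = (i, j, s)" "y = (i', j', s')" by (cases x, cases y) auto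
  have h: "j < m" "i < j \<and> s = 0 \<or> i = 0 \<and> s \<in> {1, 2}" "j' < m" "i' < j' \<and> s' = 0 \<or> i' = 0 \<and> s' \<in> {1, 2}"
    using x y by (auto simp: xy extremal_index_def)
  have s: "s = \<sigma> * s'" using eq[of 0] m by (simp add: xy)
  have val: "(if k = j then 1 else 0) - (if k = i then 1 else 0) =
      \<sigma> * ((if k = j' then 1 else 0) - (if k = i' then 1 else 0 :: int))" if "k < m" "k \<noteq> 0" for k
    using eq[OF that(1)] that(2) by (simp add: xy)
  show ?thesis
  proof (cases "\<sigma> = 1")
    case True
    note v = val[unfolded True]
    show ?thesis
    proof (cases "s = 0")
      case zero: True
      then have ij: "i < j" "i' < j'" using h s True by auto
      then have "j = j'" using v[of j] h by (auto split: if_splits)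
      moreover have "i = i'"
      proof (cases "i = 0")
        case True
        then show ?thesis using v[of i'] ij h \<open>j = j'\<close> by (cases "i' = 0") (auto split: if_splits)
      next
        case False
        then show ?thesis using v[of i] ij h \<open>j = j'\<close> by (auto split: if_splits)
      qed
      ultimately show ?thesis using True s xy by simp
    next
      case False
      then have i: "i = 0" "i' = 0" using h s True by auto
      have "j = j'"
      proof (cases "j = 0")
        case True
        then show ?thesis using v[of j'] i h by (cases "j' = 0") (auto split: if_splits)
      next
        case False
        then show ?thesis using v[of j] i h by (auto split: if_splits)
      qed
      then show ?thesis using True s xy i by simp
    qed
  next
    case False
    then have m1: "\<sigma> = -1" using \<sigma> by simp
    have "s \<ge> 0" "s' \<ge> 0" using h by auto
    then have "s = 0" "s' = 0" using s m1 by auto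
    then have ij: "i < j" "i' < j'" using h by auto
    then have "j = i'" using val[of j] h m1 by (auto split: if_splits)
    moreover have "j' = i" using val[of j'] ij h m1 by (auto split: if_splits)
    ultimately show ?thesis using ij by simp
  qed
qed

lemma extremal_cols_differ:
  assumes m: "m \<ge> 1" and v: "v \<in> extremal_cols m" "w \<in> extremal_cols m"
  shows "v \<noteq> - w" "v \<noteq> 0\<^sub>v m"
proof -
  obtain x y where xy: "x \<in> extremal_index m" "y \<in> extremal_index m" "v = vec m (extremal_vec x)" "w = vec m (extremal_vec y)"
    using v by (auto simp: extremal_cols_def)
  show "v \<noteq> - w"
  proof
    assume "v = - w"
    then have "extremal_vec x k = - 1 * extremal_vec y k" if "k < m" for k
      using that xy by (auto simp: vec_eq_iff)
    then show False using extremal_vec_differ[OF m xy(1,2), of "-1"] by auto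
  qed
  show "v \<noteq> 0\<^sub>v m"
  proof
    assume "v = 0\<^sub>v m"
    then have "extremal_vec x k = - 1 * extremal_vec x k" if "k < m" for k
      using that xy by (auto simp: vec_eq_iff)
    then show False using extremal_vec_differ[OF m xy(1,1), of "-1"] by auto
  qed
qed

lemma card_extremal_cols:
  assumes "m \<ge> 1" shows "2 * card (extremal_cols m) = m * (m + 3)"
proof -
  have "inj_on (\<lambda>x. vec m (extremal_vec x)) (extremal_index m)"
  proof (rule inj_onI)
    fix x y assume xy: "x \<in> extremal_index m" "y \<in> extremal_index m" "vec m (extremal_vec x) = vec m (extremal_vec y)"
    have "extremal_vec x k = 1 * extremal_vec y k" if "k < m" for k
      using arg_cong[OF xy(3), of "\<lambda>v. v $ k"] that by simp
    then show "x = y" using extremal_vec_differ[OF assms xy(1,2), of 1] by simp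
  qed
  then show ?thesis unfolding extremal_cols_def by (simp add: card_image card_extremal_index)
qed

lemma full_row_rankI:
  assumes "dim_row A = m" "\<And>i. i < m \<Longrightarrow> unit_vec m i \<in> set (cols A)"
  shows "full_row_rank A"
proof -
  interpret V: vec_space "TYPE(real)" m .
  let ?A = "map_mat real_of_int A" let ?U = "set (unit_vecs m) :: real vec set"
  have A: "?A \<in> carrier_mat m (dim_col A)" using assms by auto
  have "map_vec real_of_int (unit_vec m i) = unit_vec m i" for i by (intro eq_vecI) (auto simp: unit_vec_def)
  moreover have "set (cols ?A) = map_vec real_of_int ` set (cols A)" 
  proof -
    have "cols ?A = map (map_vec real_of_int) (cols A)" by (intro nth_equalityI) auto
    then show ?thesis by simp
  qed
  ultimately have U: "?U \<subseteq> set (cols ?A)" using assms(2) by (force simp: unit_vecs_def)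
  have li: "V.lin_indpt ?U" using V.unit_vecs_basis unfolding V.basis_def by blast
  have cU: "card ?U = m" using V.dim_is_n V.dim_basis[OF finite_set V.unit_vecs_basis] by simp
  have "B = ?U" if B: "B \<supseteq> ?U" "B \<subseteq> set (cols ?A)" "V.lin_indpt B" for B
  proof -
    have "B \<subseteq> carrier_vec m" using B(2) cols_dim[of ?A] assms by auto
    then have "card B \<le> m" "finite B" using V.li_le_dim[OF V.fin_dim, of B] B(3) V.dim_is_n by auto
    then show ?thesis using card_seteq[OF _ B(1)] cU by (metis (no_types))
  qed
  then have "maximal ?U (\<lambda>T. T \<subseteq> set (cols ?A) \<and> V.lin_indpt T)" unfolding maximal_def using U li by blast
  then show ?thesis unfolding full_row_rank_def assms(1) using V.rank_card_indpt[OF A] cU by simp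
qed

section \<open>The column number\<close>

lemma finite_num_differing: "finite {size X |X. X \<subseteq># M \<and> P X}"
  by (rule finite_subset[of _ "{..size M}"]) (auto intro: size_mset_mono)

lemma num_differing_le:
  assumes "dim_row A = m" "delta_modular 2 A"
  shows "2 * num_differing A \<le> m * (m + 3)"
proof -
  let ?S = "{size X |X. X \<subseteq># mset (cols A) \<and> differing_columns (dim_row A) X}"
  have "size {#} \<in> ?S" by (intro CollectI exI[of _ "{#}"]) (simp add: differing_columns_def)
  then have "Max ?S \<in> ?S" by (intro Max_in finite_num_differing) blast
  then obtain X where "num_differing A = size X" "X \<subseteq># mset (cols A)" "differing_columns m X"
    unfolding num_differing_def using assms by auto
  then show ?thesis using differing_columns_bound[OF assms] by simp
qed

lemma extremal_matrix:
  assumes m: "m \<ge> 1"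
  obtains A where "dim_row A = m" "delta_modular 2 A" "m * (m + 3) \<le> 2 * num_differing A"
proof -
  have fin: "finite (extremal_cols m)" unfolding extremal_cols_def by (simp add: finite_extremal_index)
  obtain cs where cs: "set cs = extremal_cols m" "distinct cs" using finite_distinct_list[OF fin] by blast
  have car: "set cs \<subseteq> carrier_vec m" using cs by (auto simp: extremal_cols_def)
  define A where "A = mat_of_cols m cs"
  have A: "dim_row A = m" "dim_col A = length cs" "cols A = cs" using car by (simp_all add: A_def)
  have len: "2 * length cs = m * (m + 3)" using card_extremal_cols[OF m] cs distinct_card by metis
  have "unit_vec m i \<in> set (cols A)" if "i < m" for i
  proof -
    have "unit_vec m i = vec m (extremal_vec (0, i, if i = 0 then 1 else 0))"
      by (intro eq_vecI) (auto simp: unit_vec_def)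
    moreover have "(0, i, if i = 0 then 1 else 0) \<in> extremal_index m" using that by (auto simp: extremal_index_def)
    ultimately show ?thesis unfolding A(3) cs(1) extremal_cols_def by (rule image_eqI)
  qed
  then have full: "full_row_rank A" by (rule full_row_rankI[OF A(1)])
  have minor: "\<bar>det (submatrix A I J)\<bar> \<le> 2" if B: "submatrix A I J \<in> carrier_mat m m" for I J
  proof -
    let ?B = "submatrix A I J"
    have cI: "card {i. i < m \<and> i \<in> I} = m" and cJ: "card {j. j < dim_col A \<and> j \<in> J} = m"
      using B by (auto simp: dim_submatrix A)
    have "{i. i < m \<and> i \<in> I} = {..<m}" using cI by (intro card_subset_eq) auto
    then have I: "i \<in> I" if "i < m" for i using that by auto
    have pI: "pick I i = i" if "i < m" for i
    proof -
      have "{a \<in> I. a < i} = {..<i}" using I that by auto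
      then show ?thesis using pick_card_in_set[OF I[OF that]] by simp
    qed
    have pJ: "pick J j < length cs" if "j < m" for j
      using pick_le[of j "dim_col A" J] cJ that A by simp
    have "det ?B = det (transpose_mat ?B)" using det_transpose[OF B] by simp
    also have "\<dots> = rows_det m (\<lambda>j i. cs ! pick J j $ i)" unfolding rows_det_def
    proof (intro arg_cong[where f = det] eq_matI)
      fix j i assume ji: "j < dim_row (mat m m (\<lambda>(j, i). cs ! pick J j $ i))" "i < dim_col (mat m m (\<lambda>(j, i). cs ! pick J j $ i))"
      then have "transpose_mat ?B $$ (j, i) = ?B $$ (i, j)" using B by auto
      also have "\<dots> = A $$ (pick I i, pick J j)" using ji cI cJ A by (intro submatrix_index) auto
      also have "\<dots> = cs ! pick J j $ i" using ji pI pJ by (simp add: A_def mat_of_cols_index)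
      finally show "transpose_mat ?B $$ (j, i) = mat m m (\<lambda>(j, i). cs ! pick J j $ i) $$ (j, i)" using ji by simp
    qed (use B in auto)
    also have "\<bar>\<dots>\<bar> \<le> 2"
    proof (rule extremal_det[OF m])
      fix j assume "j < m"
      then have "cs ! pick J j \<in> extremal_cols m" using pJ cs nth_mem by blast
      moreover from this have "vec m (\<lambda>i. cs ! pick J j $ i) = cs ! pick J j" 
        using car cs by (intro eq_vecI) auto
      ultimately show "vec m (\<lambda>i. cs ! pick J j $ i) \<in> extremal_cols m" by simp
    qed
    finally show ?thesis .
  qed
  let ?D = "{\<bar>det B\<bar> |B. B \<in> carrier_mat (dim_row A) (dim_row A) \<and> (\<exists>I J. B = submatrix A I J)}"
  have "submatrix A UNIV {..<m} \<in> carrier_mat m m"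
  proof -
    have "m \<le> length cs" using len mult_le_mono2[of 2 "m + 3" m] by linarith
    then have "{j. j < length cs \<and> j < m} = {..<m}" by auto
    then show ?thesis unfolding carrier_mat_def by (simp add: dim_submatrix A)
  qed
  then have "?D \<noteq> {}" using A by auto
  then have "max_minor A \<le> 2" unfolding max_minor_def using minor minors_finite[of A] A
    by (intro Max.boundedI) auto
  then have mod: "delta_modular 2 A" using full by (simp add: delta_modular_def)
  have "differing_columns m (mset cs)"
    unfolding differing_columns_def
  proof (intro conjI allI impI)
    show "set_mset (mset cs) \<subseteq> carrier_vec m" using car by simp
    show "0\<^sub>v m \<notin># mset cs" using extremal_cols_differ(2)[OF m] cs by auto
    fix a b assume ab: "{#a, b#} \<subseteq># mset cs"
    then have "a \<in> set cs" "b \<in> set cs" by (auto dest: mset_subset_eqD)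
    moreover have "a \<noteq> b"
    proof
      assume "a = b"
      then have "count (mset cs) a \<ge> 2" using ab by (auto simp: subseteq_mset_def dest: spec[of _ a])
      then show False using cs(2) distinct_count_atmost_1[of cs] by (auto split: if_splits)
    qed
    ultimately show "differ a b" using extremal_cols_differ(1)[OF m, of a b] cs by (simp add: differ_def)
  qed
  then have "size (mset cs) \<le> num_differing A"
    unfolding num_differing_def A by (intro Max_ge finite_num_differing CollectI exI[of _ "mset cs"]) simp
  then show thesis using that[OF A(1) mod] len by simp
qed

theorem theorem1:
  fixes m :: nat
  assumes "m \<ge> 1"
  shows "real (col_number 2 m) = 1 / 2 * (real m ^ 2 + real m) + real m"
proof -
  let ?S = "{num_differing A |A. dim_row A = m \<and> delta_modular 2 A}"
  obtain A where A: "dim_row A = m" "delta_modular 2 A" "m * (m + 3) \<le> 2 * num_differing A"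
    using extremal_matrix[OF assms] by blast
  then have max: "2 * num_differing A = m * (m + 3)" using num_differing_le[OF A(1,2)] by simp
  have le: "s \<le> num_differing A" if "s \<in> ?S" for s 
  proof -
    from that obtain A' where "s = num_differing A'" "dim_row A' = m" "delta_modular 2 A'" by blast
    then show ?thesis using num_differing_le[of A' m] max by linarith
  qed
  then have "finite ?S" using finite_nat_set_iff_bounded_le by blast
  then have "Max ?S = num_differing A" using A le by (intro Max_eqI) auto
  then have "2 * col_number 2 m = m * (m + 3)" using max by (simp add: col_number_def)
  then have "2 * real (col_number 2 m) = real m * (real m + 3)"
    by (metis of_nat_add of_nat_mult of_nat_numeral)
  then show ?thesis by (simp add: power2_eq_square algebra_simps)
qed

end
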